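(* Suppose that Assumptions (I), (II), (III) and (IV) listed in the context hold. Then any limit point $\beta^*\in\mathscr U_{SM}$ of the sequence $\{\beta_k\}\subset\mathscr U_{SM}$ obtained by the average-cost policy iteration algorithm described in the context is PAC-optimal.
   Context: Notation: $\mathbb N_0=\{0,1,2,\dots\}$; $\delta_{(n,i)(m,j)}$ is the Kronecker delta on $\mathbb N_0\times\mathbb N_0$; sums over $(m,j)$ run over $\mathbb N_0\times\mathbb N_0$. Control model: $\lambda,\mu>0$ and $0<\gamma\le R<\infty$ are constants. The state space is $\mathbb N_0\times\mathbb N_0$ (state $(n,i)$: $n$ customers, $i$ items in inventory), the action space in every state is $[\gamma,R]$ (production rates). For $a\in[\gamma,R]$ the transition rates are: $\pi^{a}_{(n,i)(n,i+1)}=a$ for all $n,i\ge0$; $\pi^{a}_{(n,i)(n+1,i)}=\lambda$ for $n\ge0,i\ge1$; $\pi^{a}_{(n,i)(n-1,i-1)}=\mu$ for $n,i\ge1$; all other off-diagonal rates are $0$; and $\pi^{a}_{(n,i)(n,i)}=-\sum_{(m,j)\ne(n,i)}\pi^a_{(n,i)(m,j)}$. Put $\pi^*_{(n,i)}:=\sup_{a\in[\gamma,R]}\big(-\pi^{a}_{(n,i)(n,i)}\big)$. The cost rate is $r(n,i,a)=c_0\, i+c_1 n+a\,c_2\,\mathbf 1_{\{i>S\}}+c_3\,n\,\mathbf 1_{\{i=0\}}$ with constants $c_0,c_1,c_2,c_3\ge0$ and $S\in\mathbb N_0$. Policies: $\mathscr U_{SM}$ is the set of all functions $\beta:\mathbb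 N_0\times\mathbb N_0\to[\gamma,R]$ (deterministic stationary policies), with the product topology (pointwise convergence). For $\beta\in\mathscr U_{SM}$, write $\pi^\beta_{(n,i)(m,j)}=\pi^{\beta(n,i)}_{(n,i)(m,j)}$, let $Y(t)$ be the right-continuous Markov chain with these rates, and let $P^\beta_{(n,i)},E^\beta_{(n,i)}$ be the probability and expectation when $Y(0)=(n,i)$. Pathwise average cost (PAC) criterion: $J_c(n,i,\beta):=\limsup_{T\to\infty}\frac1T\int_0^T r(Y(t),\beta(Y(t-)))\,dt$, a random variable under $P^\beta_{(n,i)}$. A policy $\hat\beta\in\mathscr U_{SM}$ is PAC-optimal if there is a constant $\hat g$ such that $P^{\hat\beta}_{(n,i)}(J_c(n,i,\hat\beta)\le \hat g)=1$ and $P^\beta_{(n,i)}(J_c(n,i,\beta)\ge \hat g)=1$ for all $(n,i)$ and all $\beta\in\mathscr U_{SM}$. Weighted space: for $V\ge1$, $\|u\|_V=\sup_{(n,i)}|u(n,i)|/V(n,i)$ and $B_V(\mathbb N_0\times\mathbb N_0)=\{u:\mathbb N_0\times\mathbb N_0\to\mathbb R:\|u\|_V<\infty\}$. Assumption (I): there are a function $W\ge1$ on $\mathbb N_0\times\mathbb N_0$, nondecreasing along some fixed enumeration of $\mathbb N_0\times\mathbb N_0$, and constants $\bar c_1>0$, $\bar b_1\ge0$, $M>0$ such that for all $(n,i)$ and $a\in[\gamma,R]$: $\sum_{(m,j)}\pi^{a}_{(n,i)(m,j)}W(m,j)\le-\bar c_1W(n,i)+\bar b_1\delta_{(n,i)(0,0)}$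 and $r(n,i,a)\le M\,W(n,i)$. Under (I), for each $\beta\in\mathscr U_{SM}$ the (irreducible) chain $Y$ has a unique invariant probability measure $\vartheta_\beta$, and $\vartheta_\beta(u):=\sum_{(m,j)}u(m,j)\vartheta_\beta(m,j)$ is finite for $u\in B_W(\mathbb N_0\times\mathbb N_0)$. Assumption (II): with $W$ as in (I), there are a nonnegative function $W'$ on $\mathbb N_0\times\mathbb N_0$ and constants $c'>0$, $b'\ge0$, $M'>0$ such that for all $(n,i)$ and $a\in[\gamma,R]$: $\pi^*_{(n,i)}W(n,i)\le M'W'(n,i)$ and $\sum_{(m,j)}\pi^{a}_{(n,i)(m,j)}W'(m,j)\le c'W'(n,i)+b'$. Assumption (III) (uniform ergodicity): with $W$ as in (I), there are constants $\delta>0$, $L_2>0$ such that $\sup_{\beta\in\mathscr U_{SM}}|E^\beta_{(n,i)}u(Y(t))-\vartheta_\beta(u)|\le L_2e^{-\delta t}\|u\|_W W(n,i)$ for all $(n,i)$, all $u\in B_W(\mathbb N_0\times\mathbb N_0)$ and all $t\ge0$. Assumption (IV): with $W$ as in (I), for $k=1,2$ there are functions $W_k^*\ge1$ on $\mathbb N_0\times\mathbb N_0$ and constants $c_k^*>0$, $b_k^*\ge0$, $M_k^*>0$ such that for all $(n,i)$ and $a\in[\gamma,R]$: $W^2(n,i)\le M_1^*W_1^*(n,i)$, $[\pi^*_{(n,i)}W(n,i)]^2\le M_2^*W_2^*(n,i)$, and $\sum_{(m,j)}\pi^a_{(n,i)(m,j)}W_k^*(m,j)\le-c_k^*W_k^*(n,i)+b_k^*$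 for $k=1,2$. Gain and bias: for $\beta\in\mathscr U_{SM}$, $g(\beta):=\sum_{(m,j)}r(m,j,\beta(m,j))\vartheta_\beta(m,j)$ and $h_\beta(n,i):=\int_0^\infty\big[E^\beta_{(n,i)}r(Y(t),\beta(Y(t)))-g(\beta)\big]dt$. Under (I)–(III), $h_\beta$ is the unique element of $B_W(\mathbb N_0\times\mathbb N_0)$ with $g(\beta)=r(n,i,\beta(n,i))+\sum_{(m,j)}\pi^\beta_{(n,i)(m,j)}h_\beta(m,j)$ for all $(n,i)$ and $\vartheta_\beta(h_\beta)=0$. Average-cost policy iteration algorithm: start from an arbitrary policy in $\mathscr U_{SM}$. Given $\beta_k$, compute $\vartheta_{\beta_k}$, $g(\beta_k)$ and $h_{\beta_k}$. For each $(n,i)$ put $\beta_{k+1}(n,i):=\beta_k(n,i)$ if $r(n,i,\beta_k(n,i))+\sum_{(m,j)}\pi^{\beta_k}_{(n,i)(m,j)}h_{\beta_k}(m,j)=\inf_{a\in[\gamma,R]}\{r(n,i,a)+\sum_{(m,j)}\pi^a_{(n,i)(m,j)}h_{\beta_k}(m,j)\}$; otherwise choose $\beta_{k+1}(n,i)\in[\gamma,R]$ attaining this infimum. If $\beta_{k+1}=\beta_k$, the algorithm stops (and the sequence is then regarded as constant from that index on); otherwise replace $\beta_k$ by $\beta_{k+1}$ and repeat. *)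

theory Defs
  imports "HOL-Probability.Probability"
begin

type_synonym state = "nat \<times> nat"
type_synonym policy = "state \<Rightarrow> real"

fun jump_rate :: "real \<Rightarrow> real \<Rightarrow> real \<Rightarrow> state \<Rightarrow> state \<Rightarrow> real" where
  "jump_rate lam mu a (n, i) (m, j) =
     (if m = n \<and> j = i + 1 then a
      else if 1 \<le> i \<and> m = n + 1 \<and> j = i then lam
      else if 1 \<le> n \<and> 1 \<le> i \<and> m + 1 = n \<and> j + 1 = i then mu
      else 0)"

definition queue_rate :: "real \<Rightarrow> real \<Rightarrow> real \<Rightarrow> state \<Rightarrow> state \<Rightarrow> real" where
  "queue_rate lam mu a x y =
     (if y = x then - (\<Sum>\<^sub>\<infinity>z\<in>- {x}. jump_rate lam mu a x z) else jump_rate lam mu a x y)"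

fun queue_cost :: "real \<Rightarrow> real \<Rightarrow> real \<Rightarrow> real \<Rightarrow> nat \<Rightarrow> state \<Rightarrow> real \<Rightarrow> real" where
  "queue_cost c0 c1 c2 c3 S (n, i) a =
     c0 * real i + c1 * real n + a * c2 * of_bool (i > S) + c3 * real n * of_bool (i = 0)"

text \<open>
  From here on, \<open>A\<close> is the action set, \<open>q a x y\<close> the transition rate from \<open>x\<close> to \<open>y\<close> under action
  \<open>a\<close>, and \<open>r x a\<close> the cost rate. For \<open>q = queue_rate lam mu\<close> every row of \<open>q a\<close> has
  finite support, so the sums over states against \<open>q a x\<close> below always converge.
\<close>

definition stationary_policies :: "real set \<Rightarrow> policy set" where
  "stationary_policies A = {\<beta>. \<forall>x. \<beta> x \<in> A}"

definition policy_rate :: "(real \<Rightarrow> state \<Rightarrow> state \<Rightarrow> real) \<Rightarrow> policy \<Rightarrow> state \<Rightarrow> state \<Rightarrow> real" where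
  "policy_rate q \<beta> x y = q (\<beta> x) x y"

definition max_exit_rate :: "real set \<Rightarrow> (real \<Rightarrow> state \<Rightarrow> state \<Rightarrow> real) \<Rightarrow> state \<Rightarrow> real" where
  "max_exit_rate A q x = (SUP a\<in>A. - q a x x)"

definition generator :: "(real \<Rightarrow> state \<Rightarrow> state \<Rightarrow> real) \<Rightarrow> real \<Rightarrow> (state \<Rightarrow> real) \<Rightarrow> state \<Rightarrow> real" where
  "generator q a u x = (\<Sum>\<^sub>\<infinity>y. q a x y * u y)"

text \<open>
  \<open>P x\<close> is the law under which the process \<open>Y\<close>, indexed by times \<open>t \<ge> 0\<close>, starts in \<open>x\<close>. The
  conjuncts are: start in \<open>x\<close>, right-continuity of all paths in the (discrete) state space, the
  time-homogeneous Markov property in terms of finite-dimensional distributions, and \<open>Q\<close> being the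
  derivative at \<open>0\<close> of the transition function \<open>(t, x, y) \<mapsto> P x (Y t = y)\<close>.
\<close>

definition right_continuous_markov_chain ::
    "(state \<Rightarrow> state \<Rightarrow> real) \<Rightarrow> (state \<Rightarrow> 'w measure) \<Rightarrow> (real \<Rightarrow> 'w \<Rightarrow> state) \<Rightarrow> bool" where
  "right_continuous_markov_chain Q P Y \<longleftrightarrow>
     (\<forall>x. prob_space (P x) \<and>
        (\<forall>t\<ge>0. Y t \<in> measurable (P x) (count_space UNIV)) \<and>
        (AE \<omega> in P x. Y 0 \<omega> = x) \<and>
        (\<forall>\<omega>\<in>space (P x). \<forall>t\<ge>0. continuous (at_right t) (\<lambda>s. Y s \<omega>)) \<and>
        (\<forall>(k::nat) (t::nat \<Rightarrow> real) (y::nat \<Rightarrow> state).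
           0 \<le> t 0 \<longrightarrow> (\<forall>l\<le>k. t l \<le> t (Suc l)) \<longrightarrow>
           \<P>(\<omega> in P x. \<forall>l\<le>Suc k. Y (t l) \<omega> = y l) =
             \<P>(\<omega> in P x. \<forall>l\<le>k. Y (t l) \<omega> = y l) *
             \<P>(\<omega> in P (y k). Y (t (Suc k) - t k) \<omega> = y (Suc k))) \<and>
        (\<forall>y. ((\<lambda>t. (\<P>(\<omega> in P x. Y t \<omega> = y) - of_bool (y = x)) / t) \<longlongrightarrow> Q x y) (at_right 0)))"

definition invariant_pmf :: "(state \<Rightarrow> 'w measure) \<Rightarrow> (real \<Rightarrow> 'w \<Rightarrow> state) \<Rightarrow> state pmf \<Rightarrow> bool" where
  "invariant_pmf P Y \<theta> \<longleftrightarrow>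
     (\<forall>t\<ge>0. \<forall>y. (\<Sum>\<^sub>\<infinity>x. pmf \<theta> x * \<P>(\<omega> in P x. Y t \<omega> = y)) = pmf \<theta> y)"

definition the_invariant_pmf :: "(state \<Rightarrow> 'w measure) \<Rightarrow> (real \<Rightarrow> 'w \<Rightarrow> state) \<Rightarrow> state pmf" where
  "the_invariant_pmf P Y = (THE \<theta>. invariant_pmf P Y \<theta>)"

definition gain ::
    "(state \<Rightarrow> real \<Rightarrow> real) \<Rightarrow> (state \<Rightarrow> 'w measure) \<Rightarrow> (real \<Rightarrow> 'w \<Rightarrow> state) \<Rightarrow> policy \<Rightarrow> real" where
  "gain r P Y \<beta> = measure_pmf.expectation (the_invariant_pmf P Y) (\<lambda>x. r x (\<beta> x))"

definition bias ::
    "(state \<Rightarrow> real \<Rightarrow> real) \<Rightarrow> (state \<Rightarrow> 'w measure) \<Rightarrow> (real \<Rightarrow> 'w \<Rightarrow> state) \<Rightarrow> policy \<Rightarrow> state \<Rightarrow> real" where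
  "bias r P Y \<beta> x =
     (LBINT t:{0..}. (LINT \<omega>|P x. r (Y t \<omega>) (\<beta> (Y t \<omega>))) - gain r P Y \<beta>)"

text \<open>\<open>Lim (at_left t) (\<lambda>s. Y s \<omega>)\<close> is the left limit \<open>Y(t-)\<close>.\<close>

definition pathwise_average_cost ::
    "(state \<Rightarrow> real \<Rightarrow> real) \<Rightarrow> (real \<Rightarrow> 'w \<Rightarrow> state) \<Rightarrow> policy \<Rightarrow> 'w \<Rightarrow> ereal" where
  "pathwise_average_cost r Y \<beta> \<omega> =
     Limsup at_top (\<lambda>T::real. ereal (1 / T *
       (LBINT t:{0..T}. r (Y t \<omega>) (\<beta> (Lim (at_left t) (\<lambda>s. Y s \<omega>))))))"

definition PAC_optimal ::
    "real set \<Rightarrow> (state \<Rightarrow> real \<Rightarrow> real) \<Rightarrow> (policy \<Rightarrow> state \<Rightarrow> 'w measure) \<Rightarrow>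
     (policy \<Rightarrow> real \<Rightarrow> 'w \<Rightarrow> state) \<Rightarrow> policy \<Rightarrow> bool" where
  "PAC_optimal A r P Y \<beta>' \<longleftrightarrow>
     \<beta>' \<in> stationary_policies A \<and>
     (\<exists>g::real. \<forall>x.
        (AE \<omega> in P \<beta>' x. pathwise_average_cost r (Y \<beta>') \<beta>' \<omega> \<le> ereal g) \<and>
        (\<forall>\<beta>\<in>stationary_policies A.
           AE \<omega> in P \<beta> x. pathwise_average_cost r (Y \<beta>) \<beta> \<omega> \<ge> ereal g))"

definition weighted_norm :: "(state \<Rightarrow> real) \<Rightarrow> (state \<Rightarrow> real) \<Rightarrow> real" where
  "weighted_norm V u = (SUP x. \<bar>u x\<bar> / V x)"

definition weighted_space :: "(state \<Rightarrow> real) \<Rightarrow> (state \<Rightarrow> real) set" where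
  "weighted_space V = {u. bdd_above (range (\<lambda>x. \<bar>u x\<bar> / V x))}"

definition assumption_I ::
    "real set \<Rightarrow> (real \<Rightarrow> state \<Rightarrow> state \<Rightarrow> real) \<Rightarrow> (state \<Rightarrow> real \<Rightarrow> real) \<Rightarrow> (state \<Rightarrow> real) \<Rightarrow> bool" where
  "assumption_I A q r W \<longleftrightarrow>
     (\<forall>x. W x \<ge> 1) \<and>
     (\<exists>e::nat \<Rightarrow> state. bij e \<and> mono (\<lambda>k. W (e k))) \<and>
     (\<exists>c b M. c > 0 \<and> b \<ge> 0 \<and> M > 0 \<and>
        (\<forall>x. \<forall>a\<in>A. generator q a W x \<le> - c * W x + b * of_bool (x = (0, 0)) \<and> r x a \<le> M * W x))"

definition assumption_II ::
    "real set \<Rightarrow> (real \<Rightarrow> state \<Rightarrow> state \<Rightarrow> real) \<Rightarrow> (state \<Rightarrow> real) \<Rightarrow> bool" where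
  "assumption_II A q W \<longleftrightarrow>
     (\<exists>(W'::state \<Rightarrow> real) c b M. (\<forall>x. W' x \<ge> 0) \<and> c > 0 \<and> b \<ge> 0 \<and> M > 0 \<and>
        (\<forall>x. \<forall>a\<in>A. max_exit_rate A q x * W x \<le> M * W' x \<and> generator q a W' x \<le> c * W' x + b))"

definition assumption_III ::
    "real set \<Rightarrow> (policy \<Rightarrow> state \<Rightarrow> 'w measure) \<Rightarrow> (policy \<Rightarrow> real \<Rightarrow> 'w \<Rightarrow> state) \<Rightarrow>
     (state \<Rightarrow> real) \<Rightarrow> bool" where
  "assumption_III A P Y W \<longleftrightarrow>
     (\<exists>\<delta> L. \<delta> > 0 \<and> L > 0 \<and>
        (\<forall>x. \<forall>u\<in>weighted_space W. \<forall>t\<ge>0.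
           (SUP \<beta>\<in>stationary_policies A.
              ereal \<bar>(LINT \<omega>|P \<beta> x. u (Y \<beta> t \<omega>)) -
                     measure_pmf.expectation (the_invariant_pmf (P \<beta>) (Y \<beta>)) u\<bar>)
           \<le> ereal (L * exp (- \<delta> * t) * weighted_norm W u * W x)))"

definition assumption_IV ::
    "real set \<Rightarrow> (real \<Rightarrow> state \<Rightarrow> state \<Rightarrow> real) \<Rightarrow> (state \<Rightarrow> real) \<Rightarrow> bool" where
  "assumption_IV A q W \<longleftrightarrow>
     (\<exists>(W1::state \<Rightarrow> real) (W2::state \<Rightarrow> real) c1 c2 b1 b2 M1 M2.
        (\<forall>x. W1 x \<ge> 1 \<and> W2 x \<ge> 1) \<and>
        c1 > 0 \<and> c2 > 0 \<and> b1 \<ge> 0 \<and> b2 \<ge> 0 \<and> M1 > 0 \<and> M2 > 0 \<and>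
        (\<forall>x. \<forall>a\<in>A.
           (W x)\<^sup>2 \<le> M1 * W1 x \<and>
           (max_exit_rate A q x * W x)\<^sup>2 \<le> M2 * W2 x \<and>
           generator q a W1 x \<le> - c1 * W1 x + b1 \<and>
           generator q a W2 x \<le> - c2 * W2 x + b2))"

text \<open>
  A run of the algorithm as an infinite sequence. The stopping rule needs no separate clause: if
  \<open>\<beta> (Suc k) = \<beta> k\<close> then \<open>\<beta> k x\<close> attains the infimum for every \<open>x\<close>, so the step condition forces
  \<open>\<beta>\<close> to be constant from \<open>k\<close> on.
\<close>

definition improvement_value ::
    "(real \<Rightarrow> state \<Rightarrow> state \<Rightarrow> real) \<Rightarrow> (state \<Rightarrow> real \<Rightarrow> real) \<Rightarrow> (state \<Rightarrow> real) \<Rightarrow> state \<Rightarrow> real \<Rightarrow> real" where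
  "improvement_value q r h x a = r x a + generator q a h x"

definition policy_iteration ::
    "real set \<Rightarrow> (real \<Rightarrow> state \<Rightarrow> state \<Rightarrow> real) \<Rightarrow> (state \<Rightarrow> real \<Rightarrow> real) \<Rightarrow>
     (policy \<Rightarrow> state \<Rightarrow> 'w measure) \<Rightarrow> (policy \<Rightarrow> real \<Rightarrow> 'w \<Rightarrow> state) \<Rightarrow> (nat \<Rightarrow> policy) \<Rightarrow> bool" where
  "policy_iteration A q r P Y \<beta> \<longleftrightarrow>
     \<beta> 0 \<in> stationary_policies A \<and>
     (\<forall>k x. let f = improvement_value q r (bias r (P (\<beta> k)) (Y (\<beta> k)) (\<beta> k)) x;
                v = (INF a\<in>A. f a)
            in if f (\<beta> k x) = v then \<beta> (Suc k) x = \<beta> k x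
               else \<beta> (Suc k) x \<in> A \<and> f (\<beta> (Suc k) x) = v)"

end

theory Submission
  imports Defs
begin

text \<open>
  Every limit policy has the smallest gain, and under every policy the pathwise average cost is
  almost surely equal to the gain; together these two facts are the claim.

  \<^emph>\<open>Semigroup.\<close> The exit rates are bounded and the rows of the rate matrix are finite, so the
  transition function satisfies the backward equation and a maximum principle
  (\<open>maximum_principle\<close>). A comparison function with \<open>G V \<le> - c V + b\<close> therefore has
  expectations bounded in time (\<open>Pt_drift_le\<close>). The uniform ergodicity estimate
  identifies the invariant law \<open>\<theta>\<close> as the limit law; together with the drift of \<open>W\<close> it
  yields invariance in the form
  \<open>E\<^sub>\<theta> (G u) = 0\<close> for all \<open>u\<close> bounded by a multiple of \<open>W\<close> (\<open>\<theta>_G\<close>) and the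
  Poisson equation for the bias (\<open>Poisson_equation\<close>), by integrating the backward equation
  over \<open>[0, \<infinity>)\<close>.

  \<^emph>\<open>Pathwise cost.\<close> Exponentially decaying correlations and a bound on \<open>E W\<^sup>2\<close> make the second
  moment of \<open>\<integral>\<^sub>0\<^sup>T (f (Y t) - g) dt\<close> grow at most linearly in \<open>T\<close>. Summing over
  \<open>T = n\<^sup>2\<close> gives almost sure convergence of the time averages along squares, and monotonicity of
  \<open>\<integral>\<^sub>0\<^sup>T f\<close> fills the gaps (\<open>ergodic_time_average\<close>).

  \<^emph>\<open>Policy iteration.\<close> Let \<open>gap k x \<ge> 0\<close> be the difference between the gain \<open>g k\<close> of the \<open>k\<close>-th
  policy and the infimum over the actions in the improvement step at \<open>x\<close>. Integrating against the
  invariant law of the next policy gives \<open>g (k + 1) = g k - E (gap k)\<close>. Hence \<open>g k\<close>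
  decreases to some \<open>g'\<close>, and because invariant laws charge every state uniformly in the policy
  (\<open>uniformly_charged\<close>), \<open>gap k x\<close> tends to \<open>0\<close> for every \<open>x\<close>. Integrating the improvement
  inequality against the invariant law of an arbitrary policy gives \<open>g' \<le> g b\<close>, and integrating the
  Poisson equations of the iterates against the invariant law of the limit policy gives that its
  gain is \<open>g'\<close> (\<open>limit_policy_optimal\<close>). Both passages to the limit are by dominated
  convergence, because all biases are bounded by one multiple of \<open>W\<close>; no limit of the biases
  has to be extracted.
\<close>

section \<open>Integration with respect to probability mass functions\<close>

lemma pmf_bind_integral_nonneg:
  fixes u :: "'b \<Rightarrow> real"
  assumes int: "integrable (measure_pmf (bind_pmf p k)) u" and nn: "\<And>y. u y \<ge> 0"
  shows "integrable (measure_pmf p) (\<lambda>x. measure_pmf.expectation (k x) u)"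
    and "\<And>x. x \<in> set_pmf p \<Longrightarrow> integrable (measure_pmf (k x)) u"
    and "measure_pmf.expectation (bind_pmf p k) u
           = measure_pmf.expectation p (\<lambda>x. measure_pmf.expectation (k x) u)"
proof -
  have "(\<integral>\<^sup>+x. (\<integral>\<^sup>+y. ennreal (u y) \<partial>k x) \<partial>p) = (\<integral>\<^sup>+y. ennreal (u y) \<partial>bind_pmf p k)"
    by simp
  also have "\<dots> = ennreal (measure_pmf.expectation (bind_pmf p k) u)"
    using int nn by (intro nn_integral_eq_integral) auto
  finally have eq: "(\<integral>\<^sup>+x. (\<integral>\<^sup>+y. ennreal (u y) \<partial>k x) \<partial>p)
      = ennreal (measure_pmf.expectation (bind_pmf p k) u)" .
  have "AE x in measure_pmf p. (\<integral>\<^sup>+y. ennreal (u y) \<partial>k x) \<noteq> \<infinity>"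
    using eq by (intro nn_integral_PInf_AE) auto
  then have fin: "(\<integral>\<^sup>+y. ennreal (u y) \<partial>k x) < \<infinity>" if "x \<in> set_pmf p" for x
    using that by (auto simp: AE_measure_pmf_iff less_top)
  show int': "integrable (measure_pmf (k x)) u" if "x \<in> set_pmf p" for x
    using fin[OF that] nn by (intro integrableI_bounded) auto
  have inner: "(\<integral>\<^sup>+y. ennreal (u y) \<partial>k x) = ennreal (measure_pmf.expectation (k x) u)"
    if "x \<in> set_pmf p" for x
    using int'[OF that] nn by (intro nn_integral_eq_integral) auto
  have "(\<integral>\<^sup>+x. ennreal (measure_pmf.expectation (k x) u) \<partial>p)
      = (\<integral>\<^sup>+x. (\<integral>\<^sup>+y. ennreal (u y) \<partial>k x) \<partial>p)"
    using inner by (intro nn_integral_cong_AE) (auto simp: AE_measure_pmf_iff)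
  with eq have eq': "(\<integral>\<^sup>+x. ennreal (measure_pmf.expectation (k x) u) \<partial>p)
      = ennreal (measure_pmf.expectation (bind_pmf p k) u)" by simp
  have nn': "measure_pmf.expectation (k x) u \<ge> 0" for x
    using nn by simp
  show "integrable (measure_pmf p) (\<lambda>x. measure_pmf.expectation (k x) u)"
    using eq' nn' by (intro integrableI_bounded) auto
  have "measure_pmf.expectation p (\<lambda>x. measure_pmf.expectation (k x) u)
      = enn2real (\<integral>\<^sup>+x. ennreal (measure_pmf.expectation (k x) u) \<partial>p)"
    using nn' by (intro integral_eq_nn_integral) auto
  then show "measure_pmf.expectation (bind_pmf p k) u
      = measure_pmf.expectation p (\<lambda>x. measure_pmf.expectation (k x) u)"
    using eq' nn by simp
qed

lemma pmf_bind_integral: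
  fixes u :: "'b \<Rightarrow> real"
  assumes int: "integrable (measure_pmf (bind_pmf p k)) u"
  shows "measure_pmf.expectation (bind_pmf p k) u
           = measure_pmf.expectation p (\<lambda>x. measure_pmf.expectation (k x) u)"
proof -
  let ?p = "\<lambda>y. max 0 (u y)" and ?m = "\<lambda>y. max 0 (- u y)"
  have i: "integrable (measure_pmf (bind_pmf p k)) ?p" "integrable (measure_pmf (bind_pmf p k)) ?m"
    using int by auto
  have u: "u = (\<lambda>y. ?p y - ?m y)" by auto
  note P = pmf_bind_integral_nonneg[OF i(1) max.cobounded1]
  note M = pmf_bind_integral_nonneg[OF i(2) max.cobounded1]
  have "measure_pmf.expectation (bind_pmf p k) u
      = measure_pmf.expectation (bind_pmf p k) ?p - measure_pmf.expectation (bind_pmf p k) ?m"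
    by (subst u, rule Bochner_Integration.integral_diff[OF i])
  also have "\<dots> = measure_pmf.expectation p
      (\<lambda>x. measure_pmf.expectation (k x) ?p - measure_pmf.expectation (k x) ?m)"
    unfolding P(3) M(3) by (rule Bochner_Integration.integral_diff[symmetric, OF P(1) M(1)])
  also have "\<dots> = measure_pmf.expectation p (\<lambda>x. measure_pmf.expectation (k x) u)"
    using P(2) M(2)
    by (intro integral_cong_AE, simp, simp)
       (auto simp: AE_measure_pmf_iff u[symmetric] simp flip: Bochner_Integration.integral_diff)
  finally show ?thesis .
qed

lemma integrable_pmf_bounded:
  fixes u :: "'b \<Rightarrow> real"
  assumes "\<And>x. \<bar>u x\<bar> \<le> B"
  shows "integrable (measure_pmf p) u"
  by (rule measure_pmf.integrable_const_bound[where B=B]) (auto simp: assms)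

lemma abs_expectation_pmf_le:
  fixes u :: "'b \<Rightarrow> real"
  assumes "\<And>x. \<bar>u x\<bar> \<le> B"
  shows "\<bar>measure_pmf.expectation p u\<bar> \<le> B"
proof -
  have "\<bar>measure_pmf.expectation p u\<bar> \<le> measure_pmf.expectation p (\<lambda>x. \<bar>u x\<bar>)"
    by (rule integral_abs_bound)
  also have "\<dots> \<le> measure_pmf.expectation p (\<lambda>x. B)"
    by (intro integral_mono integrable_pmf_bounded[where B="\<bar>B\<bar>"])
       (use assms in \<open>auto intro: order_trans[OF assms abs_ge_self]\<close>)
  finally show ?thesis by simp
qed

lemma
  fixes V :: "'b \<Rightarrow> real"
  assumes V: "\<And>y. V y \<ge> 0"
    and le: "\<And>n::nat. measure_pmf.expectation p (\<lambda>y. min (V y) (real n)) \<le> C"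
  shows integrable_of_truncations: "integrable (measure_pmf p) V"
    and expectation_le_of_truncations: "measure_pmf.expectation p V \<le> C"
proof -
  let ?u = "\<lambda>n y. min (V y) (real n)"
  have C: "C \<ge> 0" using le[of 0] V by (simp add: min_absorb2)
  have le': "(\<integral>\<^sup>+y. ennreal (?u n y) \<partial>p) \<le> ennreal C" for n
  proof -
    have "(\<integral>\<^sup>+y. ennreal (?u n y) \<partial>p) = ennreal (measure_pmf.expectation p (?u n))"
      using V by (intro nn_integral_eq_integral integrable_pmf_bounded[where B="real n"]) auto
    then show ?thesis using le[of n] by (simp add: ennreal_leI)
  qed
  have "(\<integral>\<^sup>+y. ennreal (V y) \<partial>p) = (\<integral>\<^sup>+y. (SUP n. ennreal (?u n y)) \<partial>p)"
  proof (intro nn_integral_cong)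
    fix y
    obtain m where m: "V y \<le> real m" using real_arch_simple by blast
    show "ennreal (V y) = (SUP n. ennreal (?u n y))"
    proof (rule antisym)
      show "ennreal (V y) \<le> (SUP n. ennreal (?u n y))"
        by (rule SUP_upper2[of m]) (use m in \<open>auto simp: min_absorb1\<close>)
    qed (auto intro!: SUP_least ennreal_leI)
  qed
  also have "\<dots> = (SUP n. \<integral>\<^sup>+y. ennreal (?u n y) \<partial>p)"
    by (intro nn_integral_monotone_convergence_SUP)
       (auto simp: incseq_def le_fun_def intro!: ennreal_leI)
  also have "\<dots> \<le> ennreal C" by (intro SUP_least le')
  finally have fin: "(\<integral>\<^sup>+y. ennreal (V y) \<partial>p) \<le> ennreal C" .
  then show int: "integrable (measure_pmf p) V"
    using V by (intro integrableI_bounded) (auto intro: le_less_trans[OF fin])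
  have "ennreal (measure_pmf.expectation p V) = (\<integral>\<^sup>+y. ennreal (V y) \<partial>p)"
    using V int by (intro nn_integral_eq_integral[symmetric]) auto
  with fin show "measure_pmf.expectation p V \<le> C"
    using C by (metis ennreal_le_iff)
qed

section \<open>Markov semigroups with bounded rates\<close>

text \<open>
  A Markov semigroup of transition laws \<open>K t x\<close> with conservative rate matrix \<open>Q\<close>, whose row \<open>x\<close> is
  supported in the finite set \<open>N x\<close> and whose exit rates are at most \<open>\<Lambda>\<close>.
\<close>

locale bounded_rate_semigroup =
  fixes K :: "real \<Rightarrow> 'a \<Rightarrow> 'a pmf"
    and Q :: "'a \<Rightarrow> 'a \<Rightarrow> real"
    and N :: "'a \<Rightarrow> 'a set"
    and \<Lambda> :: real
  assumes K_0: "K 0 x = return_pmf x"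
    and K_add: "0 \<le> s \<Longrightarrow> 0 \<le> t \<Longrightarrow> K (s + t) x = bind_pmf (K s x) (K t)"
    and K_deriv: "((\<lambda>t. (pmf (K t x) y - of_bool (y = x)) / t) \<longlongrightarrow> Q x y) (at_right 0)"
    and finite_N: "finite (N x)" and self_N: "x \<in> N x"
    and Q_outside: "y \<notin> N x \<Longrightarrow> Q x y = 0"
    and Q_conservative: "(\<Sum>y\<in>N x. Q x y) = 0"
    and Q_nonneg: "y \<noteq> x \<Longrightarrow> Q x y \<ge> 0"
    and Q_diag: "- Q x x \<le> \<Lambda>"
begin

text \<open>The action of the semigroup, and of its generator, on functions.\<close>

definition Pt :: "real \<Rightarrow> ('a \<Rightarrow> real) \<Rightarrow> 'a \<Rightarrow> real" where
  "Pt t u x = measure_pmf.expectation (K t x) u"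

definition G :: "('a \<Rightarrow> real) \<Rightarrow> 'a \<Rightarrow> real" where
  "G u x = (\<Sum>y\<in>N x. Q x y * u y)"

lemma G_const: "G (\<lambda>_. c) x = 0"
  unfolding G_def by (simp add: Q_conservative flip: sum_distrib_right)

lemma G_add: "G (\<lambda>y. u y + v y) x = G u x + G v x"
  unfolding G_def by (simp add: algebra_simps sum.distrib)

lemma G_diff: "G (\<lambda>y. u y - v y) x = G u x - G v x"
  unfolding G_def by (simp add: algebra_simps sum_subtractf)

lemma G_cmult: "G (\<lambda>y. c * u y) x = c * G u x"
  unfolding G_def by (simp add: algebra_simps sum_distrib_left)

lemma Q_diag_nonpos: "Q x x \<le> 0"
proof -
  have "Q x x + (\<Sum>y\<in>N x - {x}. Q x y) = 0"
    using Q_conservative[of x] finite_N self_N by (metis sum.remove)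
  moreover have "(\<Sum>y\<in>N x - {x}. Q x y) \<ge> 0"
    by (intro sum_nonneg) (auto intro: Q_nonneg)
  ultimately show ?thesis by linarith
qed

lemma \<Lambda>_nonneg: "\<Lambda> \<ge> 0"
  using Q_diag Q_diag_nonpos by (metis neg_0_le_iff_le order.trans)

lemma sum_abs_Q_weighted:
  "(\<Sum>y\<in>N x. \<bar>Q x y\<bar> * w y) = G w x - 2 * Q x x * w x"
proof -
  have "(\<Sum>y\<in>N x. \<bar>Q x y\<bar> * w y) = \<bar>Q x x\<bar> * w x + (\<Sum>y\<in>N x - {x}. \<bar>Q x y\<bar> * w y)"
    using finite_N self_N by (rule sum.remove)
  also have "(\<Sum>y\<in>N x - {x}. \<bar>Q x y\<bar> * w y) = (\<Sum>y\<in>N x - {x}. Q x y * w y)"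
    by (intro sum.cong) (auto simp: Q_nonneg)
  also have "\<dots> = G w x - Q x x * w x"
    unfolding G_def using finite_N[of x] self_N[of x] by (simp add: sum.remove[of "N x" x])
  finally show ?thesis using Q_diag_nonpos[of x] by simp
qed

lemma abs_G_le:
  assumes "\<And>y. \<bar>u y\<bar> \<le> C * w y"
  shows "\<bar>G u x\<bar> \<le> C * (G w x - 2 * Q x x * w x)"
proof -
  have "\<bar>G u x\<bar> \<le> (\<Sum>y\<in>N x. \<bar>Q x y * u y\<bar>)"
    unfolding G_def by (rule sum_abs)
  also have "\<dots> \<le> (\<Sum>y\<in>N x. \<bar>Q x y\<bar> * (C * w y))"
    by (intro sum_mono) (simp add: abs_mult mult_left_mono assms)
  also have "\<dots> = C * (\<Sum>y\<in>N x. \<bar>Q x y\<bar> * w y)"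
    by (simp add: sum_distrib_left algebra_simps)
  finally show ?thesis by (simp add: sum_abs_Q_weighted)
qed

lemma abs_G_bounded_le:
  assumes "\<And>y. \<bar>u y\<bar> \<le> B"
  shows "\<bar>G u x\<bar> \<le> 2 * \<Lambda> * B"
proof -
  have B: "B \<ge> 0" using assms[of x] by linarith
  have "\<bar>G u x\<bar> \<le> B * (G (\<lambda>_. 1) x - 2 * Q x x * 1)"
    using assms by (intro abs_G_le) auto
  also have "\<dots> = 2 * (- Q x x) * B" by (simp add: G_const)
  also have "\<dots> \<le> 2 * \<Lambda> * B"
    using Q_diag[of x] B by (intro mult_right_mono) auto
  finally show ?thesis .
qed

lemma tendsto_G:
  assumes "\<And>y. ((\<lambda>t. u t y) \<longlongrightarrow> v y) F"
  shows "((\<lambda>t. G (u t) x) \<longlongrightarrow> G v x) F"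
  unfolding G_def by (intro tendsto_intros assms)

lemma Pt_0: "Pt 0 u x = u x"
  by (simp add: Pt_def K_0)

lemma abs_Pt_le: "(\<And>y. \<bar>u y\<bar> \<le> B) \<Longrightarrow> \<bar>Pt t u x\<bar> \<le> B"
  unfolding Pt_def by (rule abs_expectation_pmf_le)

lemma Pt_add:
  assumes "0 \<le> s" "0 \<le> t" "\<And>y. \<bar>u y\<bar> \<le> B"
  shows "Pt (s + t) u x = Pt s (Pt t u) x"
  unfolding Pt_def K_add[OF assms(1,2)]
  by (rule pmf_bind_integral) (rule integrable_pmf_bounded[OF assms(3)])

text \<open>
  The difference quotients of the transition probabilities converge to the rates in \<open>\<ell>\<^sup>1\<close>, because
  the limit row is finitely supported and both sides have total mass \<open>0\<close>. Hence they may be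
  applied to bounded functions that depend on \<open>t\<close> as well.
\<close>

lemma difference_quotient_tendsto_G:
  assumes bdd: "\<forall>\<^sub>F t in at_right 0. \<forall>y. \<bar>u t y\<bar> \<le> B"
    and lim: "\<And>y. ((\<lambda>t. u t y) \<longlongrightarrow> v y) (at_right 0)"
  shows "((\<lambda>t. (Pt t (u t) x - u t x) / t) \<longlongrightarrow> G v x) (at_right (0::real))"
proof -
  define d where "d t y = (pmf (K t x) y - of_bool (y = x)) / t" for t y
  define e where "e t = (1 - (\<Sum>y\<in>N x. pmf (K t x) y)) / t" for t
  define rest where "rest t = measure_pmf.expectation (K t x) (\<lambda>y. u t y * indicator (- N x) y)" for t
  have main: "((\<lambda>t. \<Sum>y\<in>N x. d t y * u t y) \<longlongrightarrow> G v x) (at_right 0)"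
    unfolding G_def d_def by (intro tendsto_intros K_deriv lim)
  have d_sum: "e t = - (\<Sum>y\<in>N x. d t y)" for t
  proof -
    have "(\<Sum>y\<in>N x. of_bool (y = x)) = (1::real)"
      using finite_N self_N by (simp add: of_bool_def)
    then have "(\<Sum>y\<in>N x. d t y) = ((\<Sum>y\<in>N x. pmf (K t x) y) - 1) / t"
      unfolding d_def by (simp add: sum_subtractf flip: sum_divide_distrib)
    then show ?thesis
      by (metis e_def minus_diff_eq minus_divide_left)
  qed
  have "((\<lambda>t. - (\<Sum>y\<in>N x. d t y)) \<longlongrightarrow> - (\<Sum>y\<in>N x. Q x y)) (at_right 0)"
    unfolding d_def by (intro tendsto_intros K_deriv)
  then have e0: "(e \<longlongrightarrow> 0) (at_right 0)"
    by (simp add: d_sum Q_conservative flip: d_sum)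
  have ev: "\<forall>\<^sub>F t in at_right 0. (Pt t (u t) x - u t x) / t = (\<Sum>y\<in>N x. d t y * u t y) + rest t / t
      \<and> \<bar>rest t / t\<bar> \<le> B * e t"
    using bdd eventually_at_right_less[of "0::real"]
  proof eventually_elim
    case (elim t)
    then have b: "\<And>y. \<bar>u t y\<bar> \<le> B" and t: "t > 0" by auto
    have i1: "integrable (K t x) (\<lambda>y. u t y * indicator (N x) y)"
      and i2: "integrable (K t x) (\<lambda>y. u t y * indicator (- N x) y)"
      using b order_trans[OF abs_ge_zero b[of x]]
      by (auto intro!: integrable_pmf_bounded[where B=B] simp: indicator_def)
    have "Pt t (u t) x = measure_pmf.expectation (K t x)
        (\<lambda>y. u t y * indicator (N x) y + u t y * indicator (- N x) y)"
      unfolding Pt_def by (intro Bochner_Integration.integral_cong) (auto simp: indicator_def)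
    also have "\<dots> = measure_pmf.expectation (K t x) (\<lambda>y. u t y * indicator (N x) y) + rest t"
      unfolding rest_def by (rule Bochner_Integration.integral_add[OF i1 i2])
    also have "measure_pmf.expectation (K t x) (\<lambda>y. u t y * indicator (N x) y)
        = (\<Sum>y\<in>N x. u t y * pmf (K t x) y)"
      by (subst integral_measure_pmf_real[OF finite_N[of x]]) (auto split: split_indicator_asm)
    finally have Pt: "Pt t (u t) x = (\<Sum>y\<in>N x. u t y * pmf (K t x) y) + rest t" .
    have "u t x = (\<Sum>y\<in>N x. of_bool (y = x) * u t y)"
      using finite_N self_N by (simp add: of_bool_def if_distrib[of "\<lambda>z. z * _"] cong: if_cong)
    then have 1: "(Pt t (u t) x - u t x) / t = (\<Sum>y\<in>N x. d t y * u t y) + rest t / t"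
      unfolding Pt d_def
      by (simp add: algebra_simps add_divide_distrib diff_divide_distrib sum_subtractf sum_divide_distrib)
    have "\<bar>rest t\<bar> \<le> measure_pmf.expectation (K t x) (\<lambda>y. \<bar>u t y * indicator (- N x) y\<bar>)"
      unfolding rest_def by (rule integral_abs_bound)
    also have "\<dots> \<le> measure_pmf.expectation (K t x) (\<lambda>y. B * indicator (- N x) y)"
    proof (intro integral_mono)
      show "integrable (K t x) (\<lambda>y. B * indicator (- N x) y)"
        by (rule integrable_pmf_bounded[where B="\<bar>B\<bar>"]) (auto simp: indicator_def)
    qed (use i2 b in \<open>auto simp: indicator_def\<close>)
    also have "\<dots> = B * measure_pmf.prob (K t x) (- N x)" by simp
    also have "measure_pmf.prob (K t x) (- N x) = 1 - (\<Sum>y\<in>N x. pmf (K t x) y)"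
      using measure_pmf.prob_compl[of "N x" "K t x"] measure_measure_pmf_finite[OF finite_N[of x], of "K t x"]
      by (simp add: Compl_eq_Diff_UNIV)
    finally have "\<bar>rest t / t\<bar> \<le> B * e t"
      unfolding e_def using t by (simp add: divide_right_mono)
    with 1 show ?case by simp
  qed
  have "((\<lambda>t. rest t / t) \<longlongrightarrow> 0) (at_right 0)"
    by (rule Lim_null_comparison[of _ "\<lambda>t. B * e t"])
       (use ev in eventually_elim, simp, use tendsto_mult[OF tendsto_const[of B] e0] in simp)
  from tendsto_add[OF main this] show ?thesis
    by (auto elim!: Lim_transform_eventually intro: eventually_mono[OF ev])
qed

lemma pmf_K_self_tendsto: "((\<lambda>s. pmf (K s x) x) \<longlongrightarrow> 1) (at_right 0)"
proof -
  have "((\<lambda>s. s * ((pmf (K s x) x - of_bool (x = x)) / s) + 1) \<longlongrightarrow> 0 * Q x x + 1) (at_right 0)"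
    by (intro tendsto_intros K_deriv)
  moreover have "\<forall>\<^sub>F s in at_right (0::real).
      s * ((pmf (K s x) x - of_bool (x = x)) / s) + 1 = pmf (K s x) x"
    using eventually_at_right_less[of "0::real"] by eventually_elim simp
  ultimately have "((\<lambda>s. pmf (K s x) x) \<longlongrightarrow> 0 * Q x x + 1) (at_right 0)"
    by (rule Lim_transform_eventually)
  then show ?thesis by simp
qed

lemma Pt_increment_le:
  assumes "0 \<le> s" "0 \<le> t" and b: "\<And>y. \<bar>u y\<bar> \<le> B"
  shows "\<bar>Pt (s + t) u x - Pt t u x\<bar> \<le> 2 * B * (1 - pmf (K s x) x)"
proof -
  let ?v = "Pt t u"
  have v: "\<bar>?v y\<bar> \<le> B" for y by (rule abs_Pt_le[OF b])
  have B: "B \<ge> 0" using v[of x] by linarith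
  have i: "integrable (K s x) ?v" by (rule integrable_pmf_bounded[OF v])
  have "Pt (s + t) u x - Pt t u x = measure_pmf.expectation (K s x) (\<lambda>y. ?v y - ?v x)"
    using i by (simp add: Pt_add[OF assms] Pt_def[of s])
  also have "\<bar>\<dots>\<bar> \<le> measure_pmf.expectation (K s x) (\<lambda>y. \<bar>?v y - ?v x\<bar>)"
    by (rule integral_abs_bound)
  also have "\<dots> \<le> measure_pmf.expectation (K s x) (\<lambda>y. 2 * B * indicator (- {x}) y)"
  proof (intro integral_mono)
    show "integrable (K s x) (\<lambda>y. \<bar>?v y - ?v x\<bar>)" using i by simp
    show "integrable (K s x) (\<lambda>y. 2 * B * indicator (- {x}) y :: real)"
      using B by (intro integrable_pmf_bounded[where B="2*B"]) (auto simp: indicator_def)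
    show "\<bar>?v y - ?v x\<bar> \<le> 2 * B * indicator (- {x}) y" for y
      using v[of x] v[of y] by (auto simp: indicator_def)
  qed
  also have "\<dots> = 2 * B * measure_pmf.prob (K s x) (- {x})" by simp
  also have "measure_pmf.prob (K s x) (- {x}) = 1 - pmf (K s x) x"
    using measure_pmf.prob_compl[of "{x}" "K s x"] by (simp add: Compl_eq_Diff_UNIV measure_pmf_single)
  finally show ?thesis .
qed

lemma Pt_left_limit:
  assumes t: "t > 0" and b: "\<And>y. \<bar>u y\<bar> \<le> B"
  shows "((\<lambda>s. Pt (t - s) u x) \<longlongrightarrow> Pt t u x) (at_right 0)"
proof -
  have "\<forall>\<^sub>F s in at_right 0. norm (Pt (t - s) u x - Pt t u x) \<le> 2 * B * (1 - pmf (K s x) x)"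
    unfolding eventually_at_right_field
  proof (intro exI[of _ t] conjI allI impI t)
    fix s assume s: "0 < s" "s < t"
    have "\<bar>Pt (s + (t - s)) u x - Pt (t - s) u x\<bar> \<le> 2 * B * (1 - pmf (K s x) x)"
      by (rule Pt_increment_le[OF _ _ b]) (use s in auto)
    then show "norm (Pt (t - s) u x - Pt t u x) \<le> 2 * B * (1 - pmf (K s x) x)"
      by (simp add: abs_minus_commute)
  qed
  moreover have "((\<lambda>s. 2 * B * (1 - pmf (K s x) x)) \<longlongrightarrow> 2 * B * (1 - 1)) (at_right 0)"
    by (intro tendsto_mult tendsto_diff tendsto_const pmf_K_self_tendsto)
  then have "((\<lambda>s. 2 * B * (1 - pmf (K s x) x)) \<longlongrightarrow> 0) (at_right 0)"
    by simp
  ultimately have "((\<lambda>s. Pt (t - s) u x - Pt t u x) \<longlongrightarrow> 0) (at_right 0)"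
    by (rule Lim_null_comparison)
  then show ?thesis by (rule LIM_zero_cancel)
qed

lemma backward_equation_right:
  assumes t: "t \<ge> 0" and b: "\<And>y. \<bar>u y\<bar> \<le> B"
  shows "((\<lambda>t. Pt t u x) has_real_derivative G (Pt t u) x) (at_right t)"
proof -
  have "((\<lambda>s. (Pt s (Pt t u) x - Pt t u x) / s) \<longlongrightarrow> G (Pt t u) x) (at_right 0)"
    by (rule difference_quotient_tendsto_G[where B=B]) (auto intro: abs_Pt_le[OF b])
  moreover have "\<forall>\<^sub>F s in at_right 0. (Pt s (Pt t u) x - Pt t u x) / s
      = (Pt (s + t) u x - Pt t u x) / (s + t - t)"
    using eventually_at_right_less[of "0::real"] by eventually_elim (simp add: Pt_add[OF _ t b])
  ultimately show ?thesis
    unfolding has_field_derivative_iff filterlim_at_right_to_0[of _ _ t] by (rule Lim_transform_eventually)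
qed

text \<open>Kolmogorov's backward equation.\<close>

lemma backward_equation:
  assumes t: "t > 0" and b: "\<And>y. \<bar>u y\<bar> \<le> B"
  shows "((\<lambda>t. Pt t u x) has_real_derivative G (Pt t u) x) (at t)"
proof -
  have "((\<lambda>s. (Pt s (Pt (t - s) u) x - Pt (t - s) u x) / s) \<longlongrightarrow> G (Pt t u) x) (at_right 0)"
    by (rule difference_quotient_tendsto_G[where B=B])
       (use abs_Pt_le[OF b] Pt_left_limit[OF t b] in auto)
  moreover have "\<forall>\<^sub>F s in at_right 0. (Pt s (Pt (t - s) u) x - Pt (t - s) u x) / s
      = (Pt (t - s) u x - Pt t u x) / (t - s - t)"
    unfolding eventually_at_right_field
  proof (intro exI[of _ t] conjI allI impI t)
    fix s assume s: "0 < s" "s < t"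
    have "Pt s (Pt (t - s) u) x = Pt t u x"
      using Pt_add[where s=s and t="t - s" and u=u and x=x, OF _ _ b] s by simp
    then show "(Pt s (Pt (t - s) u) x - Pt (t - s) u x) / s = (Pt (t - s) u x - Pt t u x) / (t - s - t)"
      using s by (simp add: field_simps)
  qed
  ultimately have "((\<lambda>s. (Pt (t - s) u x - Pt t u x) / (t - s - t)) \<longlongrightarrow> G (Pt t u) x) (at_right 0)"
    by (rule Lim_transform_eventually)
  then have "((\<lambda>s. (Pt s u x - Pt t u x) / (s - t)) \<longlongrightarrow> G (Pt t u) x) (at_left t)"
    unfolding filterlim_at_left_to_right[of _ _ t] filterlim_at_right_to_0[of _ _ "- t"] by simp
  moreover have "((\<lambda>s. (Pt s u x - Pt t u x) / (s - t)) \<longlongrightarrow> G (Pt t u) x) (at_right t)"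
    using backward_equation_right[OF less_imp_le[OF t] b] by (simp add: has_field_derivative_iff)
  ultimately show ?thesis
    by (simp add: has_field_derivative_iff filterlim_at_split)
qed

lemma continuous_on_Pt:
  assumes b: "\<And>y. \<bar>u y\<bar> \<le> B"
  shows "continuous_on {0..} (\<lambda>t. Pt t u x)"
  unfolding continuous_on_eq_continuous_within
proof
  fix t :: real assume "t \<in> {0..}"
  then have "t = 0 \<or> t > 0" by auto
  then show "continuous (at t within {0..}) (\<lambda>t. Pt t u x)"
  proof
    assume t: "t = 0"
    have "continuous (at_right 0) (\<lambda>t. Pt t u x)"
      by (rule DERIV_continuous[OF backward_equation_right[OF order_refl]]) (rule b)
    then show ?thesis unfolding t at_within_Ici_at_right .
  next
    assume t: "t > 0"
    have "isCont (\<lambda>t. Pt t u x) t"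
      by (rule DERIV_isCont[OF backward_equation[OF t]]) (rule b)
    then show ?thesis by (rule continuous_at_imp_continuous_at_within)
  qed
qed

text \<open>
  Maximum principle: multiplying by \<open>exp (\<Lambda> * t)\<close> turns \<open>G\<close> into an operator with nonnegative
  coefficients and row sums \<open>\<Lambda>\<close>; integrating the inequality repeatedly improves a
  constant lower bound to \<open>- C * (\<Lambda> * t) ^ k / fact k\<close> for every \<open>k\<close>.
\<close>

lemma maximum_principle:
  fixes D D' :: "real \<Rightarrow> 'a \<Rightarrow> real"
  assumes cont: "\<And>x. continuous_on {0..T} (\<lambda>t. D t x)"
    and deriv: "\<And>x t. 0 < t \<Longrightarrow> t < T \<Longrightarrow> ((\<lambda>t. D t x) has_real_derivative D' t x) (at t)"
    and super: "\<And>x t. 0 < t \<Longrightarrow> t < T \<Longrightarrow> D' t x \<ge> G (D t) x"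
    and init: "\<And>x. D 0 x \<ge> 0"
    and lower: "\<And>x t. 0 \<le> t \<Longrightarrow> t \<le> T \<Longrightarrow> D t x \<ge> - B"
    and t: "0 \<le> t" "t \<le> T"
  shows "D t x \<ge> 0"
proof -
  define C where "C = exp (\<Lambda> * T) * \<bar>B\<bar>"
  have C: "C \<ge> 0" by (simp add: C_def)
  have bound: "exp (\<Lambda> * t) * D t x \<ge> - C * (\<Lambda> * t) ^ k / fact k" if "0 \<le> t" "t \<le> T" for k t x
    using that
  proof (induction k arbitrary: t x)
    case 0
    have "- C \<le> exp (\<Lambda> * t) * (- \<bar>B\<bar>)"
      using 0 \<Lambda>_nonneg by (auto simp: C_def intro!: mult_right_mono mult_left_mono)
    also have "\<dots> \<le> exp (\<Lambda> * t) * D t x"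
      using lower[OF 0, of x] by (intro mult_left_mono) auto
    finally show ?case by simp
  next
    case (Suc k)
    define \<phi> where "\<phi> s = exp (\<Lambda> * s) * D s x + C * \<Lambda> ^ Suc k * s ^ Suc k / fact (Suc k)" for s
    define \<phi>' where "\<phi>' s = exp (\<Lambda> * s) * (D' s x + \<Lambda> * D s x) + C * \<Lambda> ^ Suc k * s ^ k / fact k" for s
    have d: "(\<phi> has_real_derivative \<phi>' s) (at s)" if "0 < s" "s < T" for s
    proof -
      have "((\<lambda>s. C * \<Lambda> ^ Suc k * s ^ Suc k / fact (Suc k)) has_real_derivative
          C * \<Lambda> ^ Suc k * (real (Suc k) * s ^ k) / fact (Suc k)) (at s)"
        by (auto intro!: derivative_eq_intros simp del: power_Suc fact_Suc)
      also have "C * \<Lambda> ^ Suc k * (real (Suc k) * s ^ k) / fact (Suc k) = C * \<Lambda> ^ Suc k * s ^ k / fact k"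
        by (simp add: fact_Suc del: power_Suc)
      finally have 1: "((\<lambda>s. C * \<Lambda> ^ Suc k * s ^ Suc k / fact (Suc k)) has_real_derivative
          C * \<Lambda> ^ Suc k * s ^ k / fact k) (at s)" .
      have 2: "((\<lambda>s. exp (\<Lambda> * s) * D s x) has_real_derivative
          exp (\<Lambda> * s) * (D' s x + \<Lambda> * D s x)) (at s)"
        by (auto intro!: derivative_eq_intros deriv[OF that] simp: algebra_simps)
      show ?thesis
        unfolding \<phi>_def \<phi>'_def by (rule DERIV_add[OF 2 1])
    qed
    have nn: "\<phi>' s \<ge> 0" if s: "0 < s" "s < T" for s
    proof -
      have low: "exp (\<Lambda> * s) * D s y \<ge> - C * (\<Lambda> * s) ^ k / fact k" for y
        using Suc.IH[of s y] s by simp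
      have eqL: "(\<Sum>y\<in>N x. (Q x y + \<Lambda> * of_bool (y = x)) * v y) = G v x + \<Lambda> * v x" for v
        unfolding G_def using finite_N[of x] self_N[of x]
        by (simp add: algebra_simps sum.distrib of_bool_def if_distrib[of "\<lambda>z. _ * z"] cong: if_cong)
      have "(\<Sum>y\<in>N x. (Q x y + \<Lambda> * of_bool (y = x)) * (- C * (\<Lambda> * s) ^ k / fact k))
          \<le> (\<Sum>y\<in>N x. (Q x y + \<Lambda> * of_bool (y = x)) * (exp (\<Lambda> * s) * D s y))"
      proof (intro sum_mono mult_left_mono low)
        show "0 \<le> Q x y + \<Lambda> * of_bool (y = x)" for y
          using Q_nonneg[of y x] Q_diag[of x] by (cases "y = x") auto
      qed
      then have "\<Lambda> * (- C * (\<Lambda> * s) ^ k / fact k) \<le> G (\<lambda>y. exp (\<Lambda> * s) * D s y) x + \<Lambda> * (exp (\<Lambda> * s) * D s x)"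
        unfolding eqL G_const by simp
      also have "G (\<lambda>y. exp (\<Lambda> * s) * D s y) x \<le> exp (\<Lambda> * s) * D' s x"
        unfolding G_cmult using super[OF s] by simp
      finally show ?thesis
        unfolding \<phi>'_def by (simp add: algebra_simps power_mult_distrib)
    qed
    have "\<phi> 0 \<le> \<phi> t"
    proof (cases "t = 0")
      case False
      with Suc.prems have t: "0 < t" by simp
      have cont_\<phi>: "continuous_on {0..t} \<phi>"
        unfolding \<phi>_def using Suc.prems
        by (intro continuous_intros continuous_on_subset[OF cont[of x]]) auto
      show ?thesis
      proof (rule DERIV_nonneg_imp_increasing_open[OF less_imp_le[OF t] _ cont_\<phi>])
        show "\<exists>y. (\<phi> has_real_derivative y) (at s) \<and> 0 \<le> y" if "0 < s" "s < t" for s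
          using d[of s] nn[of s] that Suc.prems by auto
      qed
    qed simp
    moreover have "\<phi> 0 \<ge> 0" using init[of x] by (simp add: \<phi>_def)
    ultimately show ?case
      by (simp add: \<phi>_def power_mult_distrib del: power_Suc fact_Suc)
  qed
  have "(\<lambda>k. - C * ((\<Lambda> * t) ^ k / fact k)) \<longlonglongrightarrow> - C * 0"
    by (intro tendsto_mult tendsto_const)
       (use summable_LIMSEQ_zero[OF summable_exp[of "\<Lambda> * t"]] in \<open>simp add: divide_inverse mult.commute\<close>)
  then have lim: "(\<lambda>k. - C * (\<Lambda> * t) ^ k / fact k) \<longlonglongrightarrow> 0"
    by simp
  have "exp (\<Lambda> * t) * D t x \<ge> 0"
    by (rule LIMSEQ_le_const2[OF lim]) (use bound[OF t, where x=x] in blast)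
  then show ?thesis by (simp add: zero_le_mult_iff)
qed

text \<open>
  Comparison of \<open>Pt t u\<close> with the supersolution
  \<open>exp (- c * t) * V x + b / c * (1 - exp (- c * t))\<close>. The maximum principle asks for a lower bound
  on the difference, so \<open>u\<close> is bounded here.
\<close>

lemma Pt_le_drift:
  fixes V :: "'a \<Rightarrow> real"
  assumes c: "c > 0" and b: "b \<ge> 0" and V: "\<And>x. V x \<ge> 0"
    and drift: "\<And>x. G V x \<le> - c * V x + b"
    and u: "\<And>x. 0 \<le> u x" "\<And>x. u x \<le> V x" "\<And>x. u x \<le> B"
    and t: "t \<ge> 0"
  shows "Pt t u x \<le> V x + b / c"
proof -
  define E where "E t x = exp (- c * t) * V x + b / c * (1 - exp (- c * t))" for t x
  define E' where "E' t x = exp (- c * t) * (- c * V x + b)" for t x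
  have ub: "\<bar>u y\<bar> \<le> B" for y using u[of y] by simp
  have "E t x - Pt t u x \<ge> 0"
  proof (rule maximum_principle[where D="\<lambda>t x. E t x - Pt t u x" and D'="\<lambda>t x. E' t x - G (Pt t u) x"
        and T=t and B=B])
    show "continuous_on {0..t} (\<lambda>t. E t x - Pt t u x)" for x
      unfolding E_def by (intro continuous_intros continuous_on_subset[OF continuous_on_Pt[OF ub]]) auto
    show "((\<lambda>t. E t x - Pt t u x) has_real_derivative E' s x - G (Pt s u) x) (at s)" if "0 < s" for s x
    proof (intro DERIV_diff backward_equation[OF that ub])
      show "((\<lambda>t. E t x) has_real_derivative E' s x) (at s)"
        unfolding E_def E'_def using c by (auto intro!: derivative_eq_intros simp: field_simps)
    qed
    show "G (\<lambda>x. E s x - Pt s u x) x \<le> E' s x - G (Pt s u) x" for s x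
    proof -
      have "G (\<lambda>x. E s x - Pt s u x) x = G (E s) x - G (Pt s u) x"
        by (rule G_diff)
      also have "G (E s) x = exp (- c * s) * G V x"
        unfolding E_def[abs_def] G_add G_cmult G_const by simp
      also have "\<dots> \<le> E' s x"
        unfolding E'_def using drift by (intro mult_left_mono) auto
      finally show ?thesis by simp
    qed
    show "0 \<le> E 0 x - Pt 0 u x" for x using u by (simp add: E_def Pt_0)
    show "- B \<le> E s x - Pt s u x" if "0 \<le> s" for s x
    proof -
      have "E s x \<ge> 0" unfolding E_def using V[of x] c b that by (auto intro!: add_nonneg_nonneg mult_nonneg_nonneg)
      moreover have "\<bar>Pt s u x\<bar> \<le> B" by (rule abs_Pt_le[OF ub])
      ultimately show ?thesis by linarith
    qed
  qed (use t in auto)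
  moreover have "E t x \<le> V x + b / c"
  proof -
    have "exp (- c * t) * V x \<le> 1 * V x"
      using V[of x] c t by (intro mult_right_mono) auto
    moreover have "b / c * (1 - exp (- c * t)) \<le> b / c * 1"
      using b c by (intro mult_left_mono) auto
    ultimately show ?thesis by (simp add: E_def)
  qed
  ultimately show ?thesis by linarith
qed

lemma
  fixes V :: "'a \<Rightarrow> real"
  assumes c: "c > 0" and b: "b \<ge> 0" and V: "\<And>x. V x \<ge> 0"
    and drift: "\<And>x. G V x \<le> - c * V x + b"
    and t: "t \<ge> 0"
  shows integrable_drift: "integrable (K t x) V"
    and Pt_drift_le: "Pt t V x \<le> V x + b / c"
proof -
  have le: "measure_pmf.expectation (K t x) (\<lambda>y. min (V y) (real n)) \<le> V x + b / c" for n
    using V unfolding Pt_def[symmetric]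
    by (intro Pt_le_drift[OF c b V drift _ _ _ t, where B="real n"]) auto
  show "integrable (K t x) V" by (rule integrable_of_truncations[OF V le])
  show "Pt t V x \<le> V x + b / c" unfolding Pt_def by (rule expectation_le_of_truncations[OF V le])
qed

end

section \<open>Invariant law and Poisson equation\<close>

text \<open>
  The law \<open>\<theta>\<close> is not assumed to be invariant; this follows from the estimate \<open>ergodic\<close>, which makes
  it the limit law. The state \<open>z\<close> is the only one at which the drift of \<open>W\<close> may be positive.
\<close>

locale ergodic_semigroup = bounded_rate_semigroup K Q N \<Lambda>
  for K :: "real \<Rightarrow> 'a \<Rightarrow> 'a pmf" and Q N \<Lambda> +
  fixes \<theta> :: "'a pmf" and W :: "'a \<Rightarrow> real" and z :: 'a and c b \<delta> L :: real
  assumes W_ge_1: "W x \<ge> 1"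
    and c_pos: "c > 0" and b_nonneg: "b \<ge> 0"
    and drift: "G W x \<le> - c * W x + b * of_bool (x = z)"
    and \<delta>_pos: "\<delta> > 0" and L_pos: "L > 0"
    and ergodic: "(\<And>y. \<bar>u y\<bar> \<le> C * W y) \<Longrightarrow> t \<ge> 0 \<Longrightarrow>
      \<bar>Pt t u x - measure_pmf.expectation \<theta> u\<bar> \<le> L * exp (- \<delta> * t) * C * W x"
begin

lemma W_nonneg: "W x \<ge> 0"
  using W_ge_1[of x] by linarith

lemma drift': "G W x \<le> - c * W x + b"
  using drift[of x] b_nonneg by (cases "x = z") auto

lemmas integrable_K_W = integrable_drift[OF c_pos b_nonneg W_nonneg drift']
lemmas Pt_W_le = Pt_drift_le[OF c_pos b_nonneg W_nonneg drift']

lemma C_nonneg: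
  assumes "\<And>y. \<bar>u y\<bar> \<le> C * W y"
  shows "C \<ge> 0"
proof -
  have "0 \<le> C * W z" using assms[of z] by linarith
  then show ?thesis using W_ge_1[of z] by (simp add: zero_le_mult_iff)
qed

lemma bounded_imp_weighted:
  assumes "\<And>y. \<bar>u y\<bar> \<le> B"
  shows "\<bar>u y\<bar> \<le> B * W y"
proof -
  have "B * 1 \<le> B * W y" using assms[of y] W_ge_1[of y] by (intro mult_left_mono) auto
  then show ?thesis using assms[of y] by linarith
qed

lemma exp_decay: "((\<lambda>t. L * exp (- \<delta> * t) * C * W x) \<longlongrightarrow> 0) at_top"
proof -
  have "((\<lambda>t. exp (- \<delta> * t)) \<longlongrightarrow> 0) at_top"
    using \<delta>_pos
    by (auto intro!: filterlim_compose[OF exp_at_bot] filterlim_tendsto_pos_mult_at_top[OF tendsto_const]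
        filterlim_ident simp: filterlim_uminus_at_bot)
  from tendsto_mult[OF tendsto_const this, of "L * C * W x"] show ?thesis
    by (simp add: mult_ac)
qed

lemma Pt_tendsto_theta:
  assumes u: "\<And>y. \<bar>u y\<bar> \<le> C * W y"
  shows "((\<lambda>t. Pt t u x) \<longlongrightarrow> measure_pmf.expectation \<theta> u) at_top"
proof -
  have "\<forall>\<^sub>F t in at_top. norm (Pt t u x - measure_pmf.expectation \<theta> u) \<le> L * exp (- \<delta> * t) * C * W x"
    using eventually_ge_at_top[of 0] by eventually_elim (use ergodic[OF u] in simp)
  then have "((\<lambda>t. Pt t u x - measure_pmf.expectation \<theta> u) \<longlongrightarrow> 0) at_top"
    using exp_decay by (rule Lim_null_comparison)
  then show ?thesis by (rule LIM_zero_cancel)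
qed

lemma integrable_\<theta>_W: "integrable (measure_pmf \<theta>) W"
proof (rule integrable_of_truncations[OF W_nonneg])
  fix n :: nat
  let ?u = "\<lambda>y. min (W y) (real n)"
  have uW: "\<bar>?u y\<bar> \<le> 1 * W y" for y using W_nonneg[of y] by simp
  have "Pt t ?u z \<le> W z + b / c" if "t \<ge> 0" for t
    by (rule Pt_le_drift[where B="real n" and V=W, OF c_pos b_nonneg W_nonneg drift' _ _ _ that])
       (use W_nonneg in auto)
  then show "measure_pmf.expectation \<theta> ?u \<le> W z + b / c"
    by (intro tendsto_upperbound[OF Pt_tendsto_theta[OF uW]] eventually_mono[OF eventually_ge_at_top[of 0]]) auto
qed

lemma integrable_weighted:
  assumes "integrable (measure_pmf p) W" and u: "\<And>y. \<bar>u y\<bar> \<le> C * W y"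
  shows "integrable (measure_pmf p) u"
  by (rule Bochner_Integration.integrable_bound[where f="\<lambda>y. C * W y"])
     (use assms W_nonneg C_nonneg[OF u] in \<open>auto intro: order_trans[OF u]\<close>)

lemmas integrable_\<theta> = integrable_weighted[OF integrable_\<theta>_W]
lemmas integrable_K = integrable_weighted[OF integrable_K_W]

lemma \<theta>_Pt:
  assumes u: "\<And>y. \<bar>u y\<bar> \<le> B" and t: "t \<ge> 0"
  shows "measure_pmf.expectation \<theta> (Pt t u) = measure_pmf.expectation \<theta> u"
proof (rule tendsto_unique[OF trivial_limit_at_top_linorder])
  show "((\<lambda>s. Pt s (Pt t u) z) \<longlongrightarrow> measure_pmf.expectation \<theta> (Pt t u)) at_top"
    by (rule Pt_tendsto_theta[OF bounded_imp_weighted[OF abs_Pt_le[OF u]]])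
  have "((\<lambda>s. Pt s u z) \<longlongrightarrow> measure_pmf.expectation \<theta> u) at_top"
    by (rule Pt_tendsto_theta[OF bounded_imp_weighted[OF u]])
  then have "((\<lambda>s. Pt (s + t) u z) \<longlongrightarrow> measure_pmf.expectation \<theta> u) at_top"
  proof (rule filterlim_compose)
    show "filterlim (\<lambda>s. s + t) at_top at_top"
      using filterlim_tendsto_add_at_top[OF tendsto_const[of t] filterlim_ident[of "at_top :: real filter"]]
      by (simp add: add.commute)
  qed
  moreover have "\<forall>\<^sub>F s in at_top. Pt (s + t) u z = Pt s (Pt t u) z"
    using eventually_ge_at_top[of 0] by eventually_elim (rule Pt_add[OF _ t u])
  ultimately show "((\<lambda>s. Pt s (Pt t u) z) \<longlongrightarrow> measure_pmf.expectation \<theta> u) at_top"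
    by (rule Lim_transform_eventually)
qed

lemma abs_G_weighted_le:
  assumes u: "\<And>y. \<bar>u y\<bar> \<le> C * W y"
  shows "\<bar>G u x\<bar> \<le> C * (2 * \<Lambda> + b) * W x"
proof -
  have C: "C \<ge> 0" by (rule C_nonneg[OF u])
  have "- Q x x * W x \<le> \<Lambda> * W x" using Q_diag W_nonneg by (rule mult_right_mono)
  moreover have "b * 1 \<le> b * W x" using W_ge_1 b_nonneg by (intro mult_left_mono)
  moreover have "c * W x \<ge> 0" using c_pos W_nonneg[of x] by simp
  ultimately have "G W x - 2 * Q x x * W x \<le> (2 * \<Lambda> + b) * W x"
    using drift'[of x] by (simp add: algebra_simps)
  then have "C * (G W x - 2 * Q x x * W x) \<le> C * ((2 * \<Lambda> + b) * W x)"
    using C by (rule mult_left_mono)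
  with abs_G_le[where u=u and w=W and x=x, OF u] show ?thesis by (simp add: mult_ac)
qed

text \<open>
  The difference quotients of \<open>Pt t u\<close> at \<open>t = 0\<close> have \<open>\<theta>\<close>-expectation \<open>0\<close> and converge boundedly
  to \<open>G u\<close>.
\<close>

lemma \<theta>_G_bounded:
  assumes u: "\<And>y. \<bar>u y\<bar> \<le> B"
  shows "measure_pmf.expectation \<theta> (G u) = 0"
proof -
  define s where "s n = inverse (real (Suc n))" for n
  have s_pos: "s n > 0" for n by (simp add: s_def)
  have s_lim: "filterlim s (at_right 0) sequentially"
    unfolding s_def filterlim_at
    using LIMSEQ_inverse_real_of_nat by (auto simp: eventually_sequentially)
  let ?d = "\<lambda>n x. (Pt (s n) u x - u x) / s n"
  have lim: "(\<lambda>n. ?d n x) \<longlonglongrightarrow> G u x" for x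
    by (rule filterlim_compose[OF _ s_lim, of "\<lambda>t. (Pt t u x - u x) / t"],
        rule difference_quotient_tendsto_G[where B=B and u="\<lambda>_. u"])
       (use u in auto)
  have bound: "\<bar>?d n x\<bar> \<le> 2 * \<Lambda> * B" for n x
  proof -
    have "\<exists>l \<xi>. 0 < \<xi> \<and> \<xi> < s n \<and> ((\<lambda>t. Pt t u x) has_real_derivative l) (at \<xi>) \<and>
        Pt (s n) u x - Pt 0 u x = (s n - 0) * l"
    proof (rule MVT[OF s_pos])
      show "continuous_on {0..s n} (\<lambda>t. Pt t u x)"
        by (rule continuous_on_subset[OF continuous_on_Pt[OF u]]) auto
      show "(\<lambda>t. Pt t u x) differentiable (at t)" if "0 < t" for t
        using backward_equation[where u=u and x=x, OF that u] unfolding real_differentiable_def by blast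
    qed
    then obtain l \<xi> where \<xi>: "0 < \<xi>" "((\<lambda>t. Pt t u x) has_real_derivative l) (at \<xi>)"
      and eq: "Pt (s n) u x - u x = s n * l"
      by (auto simp: Pt_0)
    have "l = G (Pt \<xi> u) x"
      by (rule DERIV_unique[OF \<xi>(2) backward_equation[OF \<xi>(1) u]])
    moreover have "?d n x = l" unfolding eq using s_pos[of n] by simp
    ultimately show ?thesis using abs_G_bounded_le[OF abs_Pt_le[OF u]] by simp
  qed
  have "(\<lambda>n. measure_pmf.expectation \<theta> (?d n)) \<longlonglongrightarrow> measure_pmf.expectation \<theta> (G u)"
    by (rule integral_dominated_convergence[where w="\<lambda>_. 2 * \<Lambda> * B"]) (use lim bound in auto)
  moreover have "measure_pmf.expectation \<theta> (?d n) = 0" for n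
  proof -
    have i: "integrable \<theta> u" "integrable \<theta> (Pt (s n) u)"
      by (rule integrable_pmf_bounded[OF u], rule integrable_pmf_bounded[OF abs_Pt_le[OF u]])
    have "measure_pmf.expectation \<theta> (\<lambda>x. Pt (s n) u x - u x) = 0"
      using \<theta>_Pt[OF u less_imp_le[OF s_pos[of n]]] by (simp add: Bochner_Integration.integral_diff[OF i(2,1)])
    then show ?thesis by simp
  qed
  ultimately show ?thesis unfolding \<open>\<And>n. measure_pmf.expectation \<theta> (?d n) = 0\<close> by (simp add: LIMSEQ_const_iff)
qed

text \<open>Unbounded functions are reached by truncation, dominated by a multiple of \<open>W\<close>.\<close>

lemma \<theta>_G:
  assumes u: "\<And>y. \<bar>u y\<bar> \<le> C * W y"
  shows "measure_pmf.expectation \<theta> (G u) = 0"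
proof -
  define v where "v n y = max (- real n) (min (real n) (u y))" for n y
  have vC: "\<bar>v n y\<bar> \<le> C * W y" for n y
    using u[of y] by (auto simp: v_def)
  have "(\<lambda>n. v n y) \<longlonglongrightarrow> u y" for y
  proof (rule tendsto_eventually)
    obtain m where m: "\<bar>u y\<bar> \<le> real m" using real_arch_simple by blast
    show "\<forall>\<^sub>F n in sequentially. v n y = u y"
      using eventually_ge_at_top[of m] by eventually_elim (use m in \<open>auto simp: v_def\<close>)
  qed
  then have lim: "(\<lambda>n. G (v n) x) \<longlonglongrightarrow> G u x" for x
    by (rule tendsto_G)
  have "(\<lambda>n. measure_pmf.expectation \<theta> (G (v n))) \<longlonglongrightarrow> measure_pmf.expectation \<theta> (G u)"
    by (rule integral_dominated_convergence[where w="\<lambda>x. C * (2 * \<Lambda> + b) * W x"])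
       (use lim abs_G_weighted_le[OF vC] integrable_\<theta>_W in auto)
  moreover have "measure_pmf.expectation \<theta> (G (v n)) = 0" for n
    by (rule \<theta>_G_bounded[where B="real n"]) (auto simp: v_def)
  ultimately show ?thesis by (simp add: LIMSEQ_const_iff)
qed

text \<open>The identity \<open>E\<^sub>\<theta> (G u) = 0\<close> with \<open>u = W\<close>.\<close>

lemma pmf_\<theta>_center: "c \<le> b * pmf \<theta> z"
proof -
  have 1: "\<bar>W y\<bar> \<le> 1 * W y" for y using W_nonneg[of y] by simp
  have i: "integrable \<theta> (G W)" by (rule integrable_\<theta>[OF abs_G_weighted_le[OF 1]])
  have j: "integrable \<theta> (\<lambda>x. b * of_bool (x = z) :: real)"
    by (rule integrable_pmf_bounded[where B="\<bar>b\<bar>"]) auto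
  have "0 = measure_pmf.expectation \<theta> (G W)" using \<theta>_G[OF 1] by simp
  also have "\<dots> \<le> measure_pmf.expectation \<theta> (\<lambda>x. b * of_bool (x = z) - c)"
  proof (rule integral_mono[OF i])
    show "integrable \<theta> (\<lambda>x. b * of_bool (x = z) - c)" using j by simp
    show "G W x \<le> b * of_bool (x = z) - c" for x
      using drift[of x] mult_left_mono[OF W_ge_1[of x] less_imp_le[OF c_pos]] by simp
  qed
  also have "\<dots> = b * measure_pmf.expectation \<theta> (\<lambda>x. of_bool (x = z)) - c"
    using j by simp
  also have "measure_pmf.expectation \<theta> (\<lambda>x. of_bool (x = z)) = pmf \<theta> z"
    by (subst integral_measure_pmf_real[of "{z}"]) auto
  finally show ?thesis by simp
qed

text \<open>The same identity with \<open>u\<close> the indicator of \<open>y\<close>: the flow into \<open>y\<close> equals the flow out of \<open>y\<close>.\<close>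

lemma pmf_\<theta>_flow:
  assumes "y \<noteq> x"
  shows "pmf \<theta> x * Q x y \<le> \<Lambda> * pmf \<theta> y"
proof -
  let ?u = "\<lambda>v. of_bool (v = y) :: real"
  have 1: "\<bar>?u v\<bar> \<le> 1" for v by simp
  have Gu: "G ?u v = Q v y" for v
    unfolding G_def using Q_outside[of y v] finite_N[of v]
    by (cases "y \<in> N v") (auto simp: of_bool_def if_distrib[of "\<lambda>z. _ * z"] cong: if_cong)
  have i: "integrable \<theta> (G ?u)"
    by (rule integrable_pmf_bounded[OF abs_G_bounded_le[OF 1]])
  have f: "finite {x, y}" by simp
  have "Q x y * pmf \<theta> x - \<Lambda> * pmf \<theta> y
      = measure_pmf.expectation \<theta> (\<lambda>v. Q x y * of_bool (v = x) - \<Lambda> * of_bool (v = y))"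
    using assms by (subst integral_measure_pmf_real[OF f]) auto
  also have "\<dots> \<le> measure_pmf.expectation \<theta> (G ?u)"
  proof (rule integral_mono[OF _ i])
    show "integrable \<theta> (\<lambda>v. Q x y * of_bool (v = x) - \<Lambda> * of_bool (v = y) :: real)"
      by (rule integrable_pmf_bounded[where B="\<bar>Q x y\<bar> + \<bar>\<Lambda>\<bar>"]) auto
    show "Q x y * of_bool (v = x) - \<Lambda> * of_bool (v = y) \<le> G ?u v" for v
      unfolding Gu using Q_nonneg[of y v] Q_diag[of y] assms by auto
  qed
  also have "\<dots> = 0" by (rule \<theta>_G_bounded[OF 1])
  finally show ?thesis by (simp add: mult.commute)
qed

text \<open>
  The transient part of the semigroup applied to \<open>u\<close>, and its time integral over the half-line,
  which solves the Poisson equation. The integral is over the open half-line because the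
  backward equation is two-sided only at positive times.
\<close>

definition transient :: "('a \<Rightarrow> real) \<Rightarrow> real \<Rightarrow> 'a \<Rightarrow> real" where
  "transient u t x = Pt t u x - measure_pmf.expectation \<theta> u"

definition potential :: "('a \<Rightarrow> real) \<Rightarrow> 'a \<Rightarrow> real" where
  "potential u x = (LBINT t:{0<..}. transient u t x)"

lemma potential_eq_Ici: "potential u x = (LBINT t:{0..}. transient u t x)"
  unfolding potential_def set_lebesgue_integral_def
  by (rule integral_discrete_difference[where X="{0}"]) (auto simp: indicator_def)

text \<open>The integrable majorant of \<open>transient u\<close> for \<open>u\<close> bounded by \<open>C * W\<close>.\<close>

definition envelope :: "real \<Rightarrow> 'a \<Rightarrow> real \<Rightarrow> real" where
  "envelope C x t = indicator {0<..} t * (L * exp (- \<delta> * t) * C * W x)"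

lemma envelope:
  shows integrable_envelope: "integrable lborel (envelope C x)"
    and integral_envelope: "(LBINT t. envelope C x t) = L * C / \<delta> * W x"
proof -
  have eq: "envelope C x = (\<lambda>t. (L * C * W x) * (indicator {0<..} t *\<^sub>R exp (- (t * \<delta>))))"
    by (auto simp: envelope_def mult_ac)
  have i: "integrable lborel (\<lambda>t. indicator {0<..} t *\<^sub>R exp (- (t * \<delta>)))"
    using integrable_I0i_exp_mscale[OF \<delta>_pos] by (simp add: set_integrable_def)
  then show "integrable lborel (envelope C x)" unfolding eq by simp
  have "(LBINT t. indicator {0<..} t *\<^sub>R exp (- (t * \<delta>))) = 1 / \<delta>"
    using LBINT_I0i_exp_mscale[OF \<delta>_pos]
    by (simp add: zero_ereal_def interval_integral_to_infinity_eq set_lebesgue_integral_def)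
  then show "(LBINT t. envelope C x t) = L * C / \<delta> * W x"
    unfolding eq using i by simp
qed

lemma transient_le_envelope:
  assumes u: "\<And>y. \<bar>u y\<bar> \<le> C * W y"
  shows "\<bar>indicator {0<..} t * transient u t x\<bar> \<le> envelope C x t"
  using ergodic[OF u, of t x] by (auto simp: envelope_def transient_def indicator_def)

lemma transient_measurable_bounded:
  assumes u: "\<And>y. \<bar>u y\<bar> \<le> B"
  shows "(\<lambda>t. indicator {0<..} t * transient u t x) \<in> borel_measurable lborel"
proof -
  have "continuous_on {0<..} (\<lambda>t. transient u t x)"
    unfolding transient_def
    by (intro continuous_intros continuous_on_subset[OF continuous_on_Pt[OF u]]) auto
  then have "(\<lambda>t. indicator {0<..} t *\<^sub>R transient u t x) \<in> borel_measurable borel"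
    by (intro borel_measurable_continuous_on_indicator) auto
  then show ?thesis by simp
qed

text \<open>
  Integrating the backward equation over \<open>(0, \<infinity>)\<close> gives the Poisson equation: the derivative of
  \<open>Pt t u x\<close> integrates to its limit minus \<open>u x\<close>, and on the other side \<open>Pt t u\<close> may be
  replaced by \<open>transient u t\<close> because \<open>G\<close> annihilates constants.
\<close>

lemma Poisson_equation_bounded:
  assumes u: "\<And>y. \<bar>u y\<bar> \<le> B"
  shows "measure_pmf.expectation \<theta> u = u x + G (potential u) x"
proof -
  let ?g = "measure_pmf.expectation \<theta> u"
  note uW = bounded_imp_weighted[OF u]
  have int: "set_integrable lborel {0<..} (\<lambda>t. transient u t y)" for y
    unfolding set_integrable_def
    by (rule Bochner_Integration.integrable_bound[OF integrable_envelope[of B]])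
       (use transient_measurable_bounded[where u=u and x=y, OF u] transient_le_envelope[OF uW] in
         \<open>auto intro: order_trans[OF transient_le_envelope[OF uW] abs_ge_self]\<close>)
  have G_eq: "G (Pt t u) y = (\<Sum>v\<in>N y. Q y v * transient u t v)" for t y
    using G_diff[where u="Pt t u" and v="\<lambda>_. ?g" and x=y] by (simp add: G_const G_def[of "\<lambda>v. Pt t u v - ?g"] transient_def)
  have intG: "set_integrable lborel {0<..} (\<lambda>t. G (Pt t u) x)"
  proof -
    have "integrable lborel (\<lambda>t. \<Sum>v\<in>N x. Q x v * (indicator {0<..} t *\<^sub>R transient u t v))"
      using int by (intro Bochner_Integration.integrable_sum integrable_mult_right) (simp add: set_integrable_def)
    then show ?thesis
      unfolding G_eq set_integrable_def by (simp add: sum_distrib_left mult.left_commute)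
  qed
  have "(LBINT t=0..\<infinity>. G (Pt t u) x) = ?g - u x"
  proof (rule interval_integral_FTC_integrable[where F="\<lambda>t. Pt t u x"])
    show "((\<lambda>t. Pt t u x) has_vector_derivative G (Pt t u) x) (at t)" if "0 < ereal t" for t
      using backward_equation[where u=u and x=x, OF _ u] that
      by (simp add: has_real_derivative_iff_has_vector_derivative)
    show "isCont (\<lambda>t. G (Pt t u) x) t" if "0 < ereal t" for t
    proof -
      have "isCont (\<lambda>t. Pt t u y) t" for y
        by (rule DERIV_isCont[OF backward_equation[OF _ u]]) (use that in simp)
      then show ?thesis unfolding G_def by (intro continuous_intros)
    qed
    show "set_integrable lborel (einterval 0 \<infinity>) (\<lambda>t. G (Pt t u) x)"
      using intG by (simp add: zero_ereal_def)
    have "((\<lambda>t. Pt t u x) \<longlongrightarrow> Pt 0 u x) (at_right 0)"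
      using backward_equation_right[OF order_refl u, THEN DERIV_continuous]
      by (simp add: continuous_within)
    then show "(((\<lambda>t. Pt t u x) \<circ> real_of_ereal) \<longlongrightarrow> u x) (at_right 0)"
      by (simp add: zero_ereal_def ereal_tendsto_simps Pt_0)
    show "(((\<lambda>t. Pt t u x) \<circ> real_of_ereal) \<longlongrightarrow> ?g) (at_left \<infinity>)"
      using Pt_tendsto_theta[OF uW] by (simp add: ereal_tendsto_simps)
  qed auto
  also have "(LBINT t=0..\<infinity>. G (Pt t u) x) = (LBINT t:{0<..}. G (Pt t u) x)"
    by (simp add: zero_ereal_def interval_integral_to_infinity_eq)
  also have "\<dots> = (\<Sum>v\<in>N x. Q x v * (LBINT t:{0<..}. transient u t v))"
    unfolding G_eq using int finite_N
    by (simp add: set_lebesgue_integral_def set_integrable_def sum_distrib_left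
        Bochner_Integration.integral_sum mult.left_commute)
  finally show ?thesis by (simp add: G_def potential_def)
qed

lemma abs_potential_le:
  assumes u: "\<And>y. \<bar>u y\<bar> \<le> C * W y"
  shows "\<bar>potential u x\<bar> \<le> L * C / \<delta> * W x"
proof -
  have "\<bar>potential u x\<bar> \<le> (LBINT t. \<bar>indicator {0<..} t * transient u t x\<bar>)"
    unfolding potential_def set_lebesgue_integral_def by (simp flip: real_norm_def)
  also have "\<dots> \<le> (LBINT t. envelope C x t)"
    using order_trans[OF abs_ge_zero transient_le_envelope[where u=u, OF u]]
    by (intro integral_mono_AE' integrable_envelope AE_I2 transient_le_envelope[where u=u, OF u]) auto
  finally show ?thesis by (simp add: integral_envelope)
qed

lemma Poisson_equation:
  assumes u: "\<And>y. \<bar>u y\<bar> \<le> C * W y" and nn: "\<And>y. u y \<ge> 0"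
  shows "measure_pmf.expectation \<theta> u = u x + G (potential u) x"
proof -
  define v where "v n y = min (u y) (real n)" for n y
  have vB: "\<bar>v n y\<bar> \<le> real n" for n y using nn[of y] by (simp add: v_def)
  have vu: "\<bar>v n y\<bar> \<le> \<bar>u y\<bar>" for n y using nn[of y] by (simp add: v_def)
  have vC: "\<bar>v n y\<bar> \<le> C * W y" for n y using vu[of n y] u[of y] by linarith
  have lim: "(\<lambda>n. v n y) \<longlonglongrightarrow> u y" for y
  proof (rule tendsto_eventually)
    obtain m where m: "u y \<le> real m" using real_arch_simple by blast
    show "\<forall>\<^sub>F n in sequentially. v n y = u y"
      using eventually_ge_at_top[of m] by eventually_elim (use m in \<open>auto simp: v_def\<close>)
  qed
  have E_lim: "(\<lambda>n. measure_pmf.expectation p (v n)) \<longlonglongrightarrow> measure_pmf.expectation p u"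
    if p: "integrable (measure_pmf p) W" for p
    by (rule integral_dominated_convergence[where w="\<lambda>y. C * W y"]) (use p vC lim in auto)
  have trans_lim: "(\<lambda>n. transient (v n) t y) \<longlonglongrightarrow> transient u t y" if "t > 0" for t y
    unfolding transient_def Pt_def
    by (intro tendsto_diff E_lim integrable_\<theta>_W integrable_K_W less_imp_le[OF that])
  have "(\<lambda>n. potential (v n) y) \<longlonglongrightarrow> potential u y" for y
    unfolding potential_def set_lebesgue_integral_def real_scaleR_def
  proof (rule integral_dominated_convergence[where w="envelope C y"])
    show lim: "AE t in lborel. (\<lambda>n. indicator {0<..} t * transient (v n) t y)
        \<longlonglongrightarrow> indicator {0<..} t * transient u t y"
      using trans_lim by (auto simp: indicator_def)
    have "(\<lambda>n. indicator {0<..} t * transient (v n) t y) \<longlonglongrightarrow> indicator {0<..} t * transient u t y" for t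
      using trans_lim by (auto simp: indicator_def)
    then show "(\<lambda>t. indicator {0<..} t * transient u t y) \<in> borel_measurable lborel"
      by (rule borel_measurable_LIMSEQ_real) (rule transient_measurable_bounded[OF vB])
  qed (use transient_measurable_bounded[OF vB] transient_le_envelope[OF vC] integrable_envelope in auto)
  then have "(\<lambda>n. v n x + G (potential (v n)) x) \<longlonglongrightarrow> u x + G (potential u) x"
    by (intro tendsto_add lim tendsto_G)
  then have "(\<lambda>n. measure_pmf.expectation \<theta> (v n)) \<longlonglongrightarrow> u x + G (potential u) x"
    unfolding Poisson_equation_bounded[where u="v _" and x=x, OF vB] .
  with E_lim[OF integrable_\<theta>_W] show ?thesis by (rule LIMSEQ_unique)
qed

end

section \<open>Time averages along right-continuous paths\<close>

text \<open>The exponential decay on the nonnegative half-line, which dominates correlations.\<close>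

definition decay :: "real \<Rightarrow> real \<Rightarrow> real" where
  "decay \<delta> u = indicator {0..} u * exp (- \<delta> * u)"

lemma decay:
  assumes "\<delta> > 0"
  shows integrable_decay: "integrable lborel (decay \<delta>)"
    and integral_decay: "(LBINT u. decay \<delta> u) = 1 / \<delta>"
proof -
  have eq: "indicator {0<..} u *\<^sub>R exp (- (u * \<delta>)) = decay \<delta> u" if "u \<notin> {0}" for u :: real
    using that by (auto simp: decay_def indicator_def mult.commute)
  have i: "integrable lborel (\<lambda>u. indicator {0<..} u *\<^sub>R exp (- (u * \<delta>)))"
    using integrable_I0i_exp_mscale[OF assms] by (simp add: set_integrable_def)
  also have "?this \<longleftrightarrow> integrable lborel (decay \<delta>)"
    by (rule integrable_discrete_difference[where X="{0}"]) (use eq in auto)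
  finally show "integrable lborel (decay \<delta>)" .
  have "(LBINT u. decay \<delta> u) = (LBINT u. indicator {0<..} u *\<^sub>R exp (- (u * \<delta>)))"
    by (rule integral_discrete_difference[where X="{0}"]) (use eq in auto)
  also have "\<dots> = 1 / \<delta>"
    using LBINT_I0i_exp_mscale[OF assms]
    by (simp add: zero_ereal_def interval_integral_to_infinity_eq set_lebesgue_integral_def)
  finally show "(LBINT u. decay \<delta> u) = 1 / \<delta>" .
qed

text \<open>
  A process with values in a countable discrete set, indexed by times \<open>t \<ge> 0\<close>; nothing is assumed
  about negative times.
\<close>

locale right_continuous_process = prob_space M for M :: "'w measure" +
  fixes Y :: "real \<Rightarrow> 'w \<Rightarrow> 'a::countable"
  assumes Y_measurable: "t \<ge> 0 \<Longrightarrow> Y t \<in> measurable M (count_space UNIV)"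
    and right_continuous: "\<omega> \<in> space M \<Longrightarrow> t \<ge> 0 \<Longrightarrow> \<forall>\<^sub>F s in at_right t. Y s \<omega> = Y t \<omega>"
begin

text \<open>The path of \<open>F (Y t)\<close>, set to \<open>0\<close> at negative times so that it is measurable on the whole line.\<close>

definition path :: "('a \<Rightarrow> real) \<Rightarrow> real \<Rightarrow> 'w \<Rightarrow> real" where
  "path F t \<omega> = indicator {0..} t * F (Y t \<omega>)"

text \<open>
  Joint measurability: a right-continuous path is the limit of the paths that read the process at
  the next larger multiple of \<open>1 / (n + 1)\<close>.
\<close>

lemma path_measurable: "(\<lambda>(t, \<omega>). path F t \<omega>) \<in> borel_measurable (lborel \<Otimes>\<^sub>M M)"
proof -
  define k where "k n t = nat \<lfloor>real (Suc n) * t\<rfloor>" for n :: nat and t :: real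
  define s where "s n t = (real (k n t) + 1) / real (Suc n)" for n t
  have k_meas: "k n \<in> measurable lborel (count_space UNIV)" for n
    unfolding k_def by measurable
  have approx: "(\<lambda>(t, \<omega>). indicator {0..} t * F (Y (s n t) \<omega>)) \<in> borel_measurable (lborel \<Otimes>\<^sub>M M)" for n
  proof -
    have Yc: "(\<lambda>\<omega>. F (Y ((real i + 1) / real (Suc n)) \<omega>)) \<in> borel_measurable M" for i
      by (rule measurable_compose[OF Y_measurable]) auto
    have "(\<lambda>p. F (Y ((real (k n (fst p)) + 1) / real (Suc n)) (snd p))) \<in> borel_measurable (lborel \<Otimes>\<^sub>M M)"
    proof (rule measurable_compose_countable[where f="\<lambda>i p. F (Y ((real i + 1) / real (Suc n)) (snd p))"
          and g="\<lambda>p. k n (fst p)"])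
      show "(\<lambda>p. F (Y ((real i + 1) / real (Suc n)) (snd p))) \<in> borel_measurable (lborel \<Otimes>\<^sub>M M)" for i
        by (rule measurable_compose[OF measurable_snd Yc])
      show "(\<lambda>p. k n (fst p)) \<in> measurable (lborel \<Otimes>\<^sub>M M) (count_space UNIV)"
        by (rule measurable_compose[OF measurable_fst k_meas])
    qed
    then show ?thesis unfolding s_def by (simp add: split_beta')
  qed
  show ?thesis
  proof (rule borel_measurable_LIMSEQ_real[OF _ approx])
    fix p :: "real \<times> 'w" assume "p \<in> space (lborel \<Otimes>\<^sub>M M)"
    then obtain t \<omega> where p: "p = (t, \<omega>)" and \<omega>: "\<omega> \<in> space M"
      by (auto simp: space_pair_measure)
    have "(\<lambda>n. indicator {0..} t * F (Y (s n t) \<omega>)) \<longlonglongrightarrow> indicator {0..} t * F (Y t \<omega>)"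
    proof (cases "t \<ge> 0")
      case True
      have s_gt: "s n t > t" and s_le: "s n t \<le> t + 1 / real (Suc n)" for n
      proof -
        have "real (k n t) = of_int \<lfloor>real (Suc n) * t\<rfloor>"
          using True unfolding k_def by (subst of_nat_nat) auto
        then have 1: "real (Suc n) * t < real (k n t) + 1" and 2: "real (k n t) \<le> real (Suc n) * t"
          by linarith+
        then show "s n t > t" unfolding s_def by (simp add: field_simps)
        have "s n t \<le> (real (Suc n) * t + 1) / real (Suc n)"
          unfolding s_def using 2 by (intro divide_right_mono) auto
        then show "s n t \<le> t + 1 / real (Suc n)" by (simp add: add_divide_distrib del: of_nat_Suc)
      qed
      have "(\<lambda>n. t + 1 / real (Suc n)) \<longlonglongrightarrow> t + 0"
        by (intro tendsto_add tendsto_const) (use LIMSEQ_inverse_real_of_nat in \<open>simp add: inverse_eq_divide\<close>)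
      then have "(\<lambda>n. s n t) \<longlonglongrightarrow> t"
        using s_gt s_le by (intro tendsto_sandwich[of "\<lambda>_. t" "\<lambda>n. s n t" _ "\<lambda>n. t + 1 / real (Suc n)"])
          (auto simp: less_imp_le)
      then have "filterlim (\<lambda>n. s n t) (at_right t) sequentially"
        using s_gt by (auto simp: filterlim_at intro!: always_eventually less_imp_neq[symmetric])
      then have "\<forall>\<^sub>F n in sequentially. Y (s n t) \<omega> = Y t \<omega>"
        using right_continuous[OF \<omega> True] by (rule eventually_compose_filterlim[rotated])
      then have "\<forall>\<^sub>F n in sequentially. indicator {0..} t * F (Y (s n t) \<omega>) = indicator {0..} t * F (Y t \<omega>)"
        by eventually_elim simp
      then show ?thesis by (rule tendsto_eventually)
    qed simp
    then show "(\<lambda>n. case p of (t, \<omega>) \<Rightarrow> indicator {0..} t * F (Y (s n t) \<omega>)) \<longlonglongrightarrow>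
        (case p of (t, \<omega>) \<Rightarrow> path F t \<omega>)"
      by (simp add: p path_def)
  qed
qed

lemma set_integral_path:
  fixes F :: "'a \<Rightarrow> real"
  shows "(LBINT t:{0..T}. F (Y t \<omega>)) = (LBINT t. indicator {0..T} t * path F t \<omega>)"
  unfolding set_lebesgue_integral_def path_def
  by (intro Bochner_Integration.integral_cong) (auto simp: indicator_def)

lemma set_integrable_path:
  "set_integrable lborel {0..T} (\<lambda>t. F (Y t \<omega>)) \<longleftrightarrow> integrable lborel (\<lambda>t. indicator {0..T} t * path F t \<omega>)"
  unfolding set_integrable_def path_def
  by (intro Bochner_Integration.integrable_cong) (auto simp: indicator_def)

lemma AE_set_integrable_path:
  fixes F :: "'a \<Rightarrow> real"
  assumes int: "\<And>t. t \<ge> 0 \<Longrightarrow> integrable M (\<lambda>\<omega>. F (Y t \<omega>))"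
    and bound: "\<And>t. t \<ge> 0 \<Longrightarrow> (\<integral>\<omega>. \<bar>F (Y t \<omega>)\<bar> \<partial>M) \<le> \<kappa>"
  shows "AE \<omega> in M. set_integrable lborel {0..T} (\<lambda>t. F (Y t \<omega>))"
proof -
  interpret P: pair_sigma_finite lborel M ..
  let ?Z = "\<lambda>t \<omega>. indicator {0..T} t * path F t \<omega>"
  have meas: "(\<lambda>(t, \<omega>). ?Z t \<omega>) \<in> borel_measurable (lborel \<Otimes>\<^sub>M M)"
    using path_measurable[of F] by (auto simp: split_beta' intro!: borel_measurable_times)
  have Zint: "integrable M (?Z t)" for t
    using int[of t] by (auto simp: path_def indicator_def)
  have inner: "(\<lambda>t. \<integral>\<omega>. norm (?Z t \<omega>) \<partial>M) \<in> borel_measurable lborel"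
    using meas by (intro borel_measurable_lebesgue_integral) (auto simp: split_beta')
  have "integrable (lborel \<Otimes>\<^sub>M M) (\<lambda>(t, \<omega>). ?Z t \<omega>)"
  proof (rule P.Fubini_integrable[OF meas])
    show "integrable lborel (\<lambda>t. \<integral>\<omega>. norm (case (t, \<omega>) of (t, \<omega>) \<Rightarrow> ?Z t \<omega>) \<partial>M)"
    proof (rule Bochner_Integration.integrable_bound[where f="\<lambda>t. \<kappa> * indicator {0..T} t"])
      show "integrable lborel (\<lambda>t. \<kappa> * indicator {0..T} t :: real)"
        by (intro integrable_mult_right integrable_real_indicator) (auto simp: emeasure_lborel_Icc_eq)
      have "norm (\<integral>\<omega>. norm (?Z t \<omega>) \<partial>M) \<le> norm (\<kappa> * indicator {0..T} t)" for t
      proof (cases "t \<in> {0..T}")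
        case True
        then have "(\<integral>\<omega>. norm (?Z t \<omega>) \<partial>M) = (\<integral>\<omega>. \<bar>F (Y t \<omega>)\<bar> \<partial>M)"
          by (simp add: path_def)
        moreover have "0 \<le> (\<integral>\<omega>. \<bar>F (Y t \<omega>)\<bar> \<partial>M)" by simp
        ultimately show ?thesis using bound[of t] True by auto
      qed simp
      then show "AE t in lborel. norm (\<integral>\<omega>. norm (case (t, \<omega>) of (t, \<omega>) \<Rightarrow> ?Z t \<omega>) \<partial>M)
          \<le> norm (\<kappa> * indicator {0..T} t)" by simp
    qed (use inner in simp)
    show "AE t in lborel. integrable M (\<lambda>\<omega>. case (t, \<omega>) of (t, \<omega>) \<Rightarrow> ?Z t \<omega>)"
      using Zint by simp
  qed
  from P.AE_integrable_snd[OF this] show ?thesis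
    unfolding set_integrable_path .
qed

text \<open>
  The second moment of a time integral grows at most linearly when correlations decay
  exponentially.
\<close>

lemma time_integral_second_moment:
  fixes F :: "'a \<Rightarrow> real"
  assumes \<delta>: "\<delta> > 0" and T: "T \<ge> 0" and \<rho>: "\<rho> \<ge> 0"
    and sq: "\<And>t. t \<ge> 0 \<Longrightarrow> integrable M (\<lambda>\<omega>. (F (Y t \<omega>))\<^sup>2)"
    and sq_le: "\<And>t. t \<ge> 0 \<Longrightarrow> (\<integral>\<omega>. (F (Y t \<omega>))\<^sup>2 \<partial>M) \<le> \<kappa>"
    and corr: "\<And>s t. 0 \<le> s \<Longrightarrow> s \<le> t \<Longrightarrow>
      \<bar>\<integral>\<omega>. F (Y s \<omega>) * F (Y t \<omega>) \<partial>M\<bar> \<le> \<rho> * exp (- \<delta> * (t - s))"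
  shows "(\<integral>\<^sup>+\<omega>. ennreal ((LBINT t:{0..T}. F (Y t \<omega>))\<^sup>2) \<partial>M) \<le> ennreal (2 * \<rho> / \<delta> * T)"
proof -
  interpret P: pair_sigma_finite "lborel \<Otimes>\<^sub>M lborel :: (real \<times> real) measure" M ..
  define Z where "Z t \<omega> = indicator {0..T} t * path F t \<omega>" for t \<omega>
  define J where "J \<omega> = (LBINT t. Z t \<omega>)" for \<omega>
  have Zpath: "Z t \<omega> = (if t \<in> {0..T} then F (Y t \<omega>) else 0)" for t \<omega>
    by (auto simp: Z_def path_def)
  have Z_meas: "(\<lambda>p. Z (fst p) (snd p)) \<in> borel_measurable (lborel \<Otimes>\<^sub>M M)"
    using path_measurable[of F] by (auto simp: Z_def split_beta' intro!: borel_measurable_times)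
  define H where "H p = Z (fst (fst p)) (snd p) * Z (snd (fst p)) (snd p)"
    for p :: "(real \<times> real) \<times> 'w"
  have H_meas: "H \<in> borel_measurable ((lborel \<Otimes>\<^sub>M lborel) \<Otimes>\<^sub>M M)"
  proof -
    have "(\<lambda>p. Z (fst (fst p)) (snd p)) \<in> borel_measurable ((lborel \<Otimes>\<^sub>M lborel) \<Otimes>\<^sub>M M)"
    proof -
      have "(\<lambda>p. (fst (fst p), snd p)) \<in> measurable ((lborel \<Otimes>\<^sub>M lborel) \<Otimes>\<^sub>M M) (lborel \<Otimes>\<^sub>M M)"
        by measurable
      from measurable_compose[OF this Z_meas] show ?thesis by simp
    qed
    moreover have "(\<lambda>p. Z (snd (fst p)) (snd p)) \<in> borel_measurable ((lborel \<Otimes>\<^sub>M lborel) \<Otimes>\<^sub>M M)"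
    proof -
      have "(\<lambda>p. (snd (fst p), snd p)) \<in> measurable ((lborel \<Otimes>\<^sub>M lborel) \<Otimes>\<^sub>M M) (lborel \<Otimes>\<^sub>M M)"
        by measurable
      from measurable_compose[OF this Z_meas] show ?thesis by simp
    qed
    ultimately show ?thesis unfolding H_def by (rule borel_measurable_times)
  qed
  have F_meas: "(\<lambda>\<omega>. F (Y t \<omega>)) \<in> borel_measurable M" if "t \<ge> 0" for t
    by (rule measurable_compose[OF Y_measurable[OF that]]) auto
  have prod_int: "integrable M (\<lambda>\<omega>. F (Y s \<omega>) * F (Y t \<omega>))"
    and prod_le: "(\<integral>\<omega>. \<bar>F (Y s \<omega>) * F (Y t \<omega>)\<bar> \<partial>M) \<le> \<kappa>" if st: "s \<ge> 0" "t \<ge> 0" for s t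
  proof -
    have ineq: "\<bar>a * b\<bar> \<le> (a\<^sup>2 + b\<^sup>2) / 2" for a b :: real
      using sum_squares_bound[of a b] sum_squares_bound[of a "- b"] by (auto simp: abs_le_iff)
    have i: "integrable M (\<lambda>\<omega>. ((F (Y s \<omega>))\<^sup>2 + (F (Y t \<omega>))\<^sup>2) / 2)"
      using sq st by auto
    show int: "integrable M (\<lambda>\<omega>. F (Y s \<omega>) * F (Y t \<omega>))"
    proof (rule Bochner_Integration.integrable_bound[OF i])
      show "(\<lambda>\<omega>. F (Y s \<omega>) * F (Y t \<omega>)) \<in> borel_measurable M"
        by (intro borel_measurable_times F_meas st)
      show "AE \<omega> in M. norm (F (Y s \<omega>) * F (Y t \<omega>)) \<le> norm (((F (Y s \<omega>))\<^sup>2 + (F (Y t \<omega>))\<^sup>2) / 2)"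
        using ineq by (intro AE_I2) simp
    qed
    have "(\<integral>\<omega>. \<bar>F (Y s \<omega>) * F (Y t \<omega>)\<bar> \<partial>M) \<le> (\<integral>\<omega>. ((F (Y s \<omega>))\<^sup>2 + (F (Y t \<omega>))\<^sup>2) / 2 \<partial>M)"
      using int i ineq by (intro integral_mono) auto
    also have "\<dots> = ((\<integral>\<omega>. (F (Y s \<omega>))\<^sup>2 \<partial>M) + (\<integral>\<omega>. (F (Y t \<omega>))\<^sup>2 \<partial>M)) / 2"
      using sq st by simp
    also have "\<dots> \<le> \<kappa>" using sq_le[OF st(1)] sq_le[OF st(2)] by simp
    finally show "(\<integral>\<omega>. \<bar>F (Y s \<omega>) * F (Y t \<omega>)\<bar> \<partial>M) \<le> \<kappa>" .
  qed
  define box :: "real \<times> real \<Rightarrow> real" where "box = indicator ({0..T} \<times> {0..T})"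
  have box_meas: "{0..T} \<times> {0..T} \<in> sets (lborel \<Otimes>\<^sub>M lborel :: (real \<times> real) measure)" by auto
  have box_int: "integrable (lborel \<Otimes>\<^sub>M lborel) (\<lambda>p. C * box p :: real)" for C
    unfolding box_def
    by (intro integrable_mult_right integrable_real_indicator box_meas)
       (simp add: lborel.emeasure_pair_measure_Times ennreal_mult_less_top emeasure_lborel_Icc_eq)
  have H_int: "integrable ((lborel \<Otimes>\<^sub>M lborel) \<Otimes>\<^sub>M M) H"
  proof (rule P.Fubini_integrable[OF H_meas])
    show "AE p in lborel \<Otimes>\<^sub>M lborel. integrable M (\<lambda>\<omega>. H (p, \<omega>))"
    proof (intro AE_I2)
      fix p :: "real \<times> real"
      show "integrable M (\<lambda>\<omega>. H (p, \<omega>))"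
        using prod_int[of "fst p" "snd p"]
        by (cases "fst p \<in> {0..T} \<and> snd p \<in> {0..T}") (auto simp: H_def Zpath)
    qed
    show "integrable (lborel \<Otimes>\<^sub>M lborel) (\<lambda>p. \<integral>\<omega>. norm (H (p, \<omega>)) \<partial>M)"
    proof (rule Bochner_Integration.integrable_bound[OF box_int[of \<kappa>]])
      show "(\<lambda>p. \<integral>\<omega>. norm (H (p, \<omega>)) \<partial>M) \<in> borel_measurable (lborel \<Otimes>\<^sub>M lborel)"
        using H_meas by (intro borel_measurable_lebesgue_integral) (auto simp: split_beta')
      have "norm (\<integral>\<omega>. norm (H (p, \<omega>)) \<partial>M) \<le> norm (\<kappa> * box p)" for p
      proof (cases "p \<in> {0..T} \<times> {0..T}")
        case True
        then have "(\<integral>\<omega>. norm (H (p, \<omega>)) \<partial>M) = (\<integral>\<omega>. \<bar>F (Y (fst p) \<omega>) * F (Y (snd p) \<omega>)\<bar> \<partial>M)"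
          by (auto simp: H_def Zpath)
        moreover have "\<dots> \<le> \<kappa>" using True by (intro prod_le) auto
        moreover have "0 \<le> (\<integral>\<omega>. \<bar>F (Y (fst p) \<omega>) * F (Y (snd p) \<omega>)\<bar> \<partial>M)" by simp
        ultimately show ?thesis using True by (simp add: box_def)
      next
        case False
        then have "H (p, \<omega>) = 0" for \<omega> by (cases p) (auto simp: H_def Zpath)
        then show ?thesis by simp
      qed
      then show "AE p in lborel \<Otimes>\<^sub>M lborel. norm (\<integral>\<omega>. norm (H (p, \<omega>)) \<partial>M) \<le> norm (\<kappa> * box p)"
        by simp
    qed
  qed
  have H_int': "integrable ((lborel \<Otimes>\<^sub>M lborel) \<Otimes>\<^sub>M M) (case_prod (\<lambda>p \<omega>. H (p, \<omega>)))"
    using H_int by simp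
  have J_sq: "AE \<omega> in M. (\<integral>p. H (p, \<omega>) \<partial>(lborel \<Otimes>\<^sub>M lborel)) = (J \<omega>)\<^sup>2"
    using P.AE_integrable_snd[OF H_int']
  proof eventually_elim
    case (elim \<omega>)
    from lborel_pair.integral_fst'[OF elim]
    have "(\<integral>p. H (p, \<omega>) \<partial>(lborel \<Otimes>\<^sub>M lborel)) = (LBINT s. LBINT t. H ((s, t), \<omega>))" by simp
    also have "\<dots> = (J \<omega>)\<^sup>2"
      unfolding H_def J_def by (simp add: power2_eq_square)
    finally show ?case .
  qed
  define k where "k p = \<rho> * (box p * exp (- \<delta> * \<bar>snd p - fst p\<bar>))" for p :: "real \<times> real"
  have k_meas: "k \<in> borel_measurable (lborel \<Otimes>\<^sub>M lborel)"
    unfolding k_def box_def using box_meas by (auto intro!: borel_measurable_times)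
  have k_int: "integrable (lborel \<Otimes>\<^sub>M lborel) k"
    by (rule Bochner_Integration.integrable_bound[OF box_int[of \<rho>] k_meas])
       (use \<rho> \<delta> in \<open>auto simp: k_def box_def indicator_def mult_left_le\<close>)
  have k_inner: "(LBINT t. k (s, t)) \<le> indicator {0..T} s * (2 * \<rho> / \<delta>)" for s
  proof (cases "s \<in> {0..T}")
    case True
    have d1: "integrable lborel (\<lambda>t. decay \<delta> (t - s))" "(LBINT t. decay \<delta> (t - s)) = 1 / \<delta>"
      using lborel_integrable_real_affine[OF integrable_decay[OF \<delta>], of 1 "- s"]
        lborel_integral_real_affine[of 1 "decay \<delta>" "- s"] integral_decay[OF \<delta>] by simp_all
    have d2: "integrable lborel (\<lambda>t. decay \<delta> (s - t))" "(LBINT t. decay \<delta> (s - t)) = 1 / \<delta>"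
      using lborel_integrable_real_affine[OF integrable_decay[OF \<delta>], of "-1" s]
        lborel_integral_real_affine[of "-1" "decay \<delta>" s] integral_decay[OF \<delta>] by simp_all
    have "(LBINT t. k (s, t)) \<le> (LBINT t. \<rho> * (decay \<delta> (t - s) + decay \<delta> (s - t)))"
    proof (rule integral_mono_AE')
      show "integrable lborel (\<lambda>t. \<rho> * (decay \<delta> (t - s) + decay \<delta> (s - t)))"
        using d1 d2 by auto
      show "AE t in lborel. k (s, t) \<le> \<rho> * (decay \<delta> (t - s) + decay \<delta> (s - t))"
        using \<rho> by (auto simp: k_def box_def decay_def indicator_def intro!: mult_left_mono)
      show "AE t in lborel. 0 \<le> \<rho> * (decay \<delta> (t - s) + decay \<delta> (s - t))"
        using \<rho> by (auto simp: decay_def)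
    qed
    also have "\<dots> = 2 * \<rho> / \<delta>" using d1 d2 by (simp add: algebra_simps)
    finally show ?thesis using True by simp
  next
    case False
    then have "k (s, t) = 0" for t by (auto simp: k_def box_def)
    then show ?thesis using \<rho> \<delta> by simp
  qed
  have J_meas: "(\<lambda>\<omega>. (J \<omega>)\<^sup>2) \<in> borel_measurable M"
    unfolding J_def using measurable_compose[OF measurable_pair_swap' Z_meas]
    by (intro borel_measurable_power lborel.borel_measurable_lebesgue_integral) (auto simp: split_beta')
  have "(\<integral>\<omega>. (J \<omega>)\<^sup>2 \<partial>M) = (\<integral>\<omega>. (\<integral>p. H (p, \<omega>) \<partial>(lborel \<Otimes>\<^sub>M lborel)) \<partial>M)"
  proof (rule integral_cong_AE)
    show "(\<lambda>\<omega>. \<integral>p. H (p, \<omega>) \<partial>(lborel \<Otimes>\<^sub>M lborel)) \<in> borel_measurable M"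
      using P.integrable_snd[OF H_int'] by auto
    show "(\<lambda>\<omega>. (J \<omega>)\<^sup>2) \<in> borel_measurable M" by (rule J_meas)
  qed (use J_sq in auto)
  also have "\<dots> = (\<integral>p. (\<integral>\<omega>. H (p, \<omega>) \<partial>M) \<partial>(lborel \<Otimes>\<^sub>M lborel))"
    by (rule P.Fubini_integral[OF H_int'])
  also have "\<dots> \<le> (\<integral>p. k p \<partial>(lborel \<Otimes>\<^sub>M lborel))"
  proof (rule integral_mono[OF P.integrable_fst[OF H_int'] k_int])
    fix p :: "real \<times> real"
    show "(\<integral>\<omega>. H (p, \<omega>) \<partial>M) \<le> k p"
    proof (cases "p \<in> {0..T} \<times> {0..T}")
      case True
      then obtain s t where p: "p = (s, t)" and st: "s \<in> {0..T}" "t \<in> {0..T}" by auto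
      then have eq: "(\<integral>\<omega>. H (p, \<omega>) \<partial>M) = (\<integral>\<omega>. F (Y s \<omega>) * F (Y t \<omega>) \<partial>M)"
        by (simp add: H_def Zpath)
      show ?thesis
      proof (cases "s \<le> t")
        case True
        with corr[of s t] st show ?thesis unfolding eq by (simp add: k_def box_def p)
      next
        case False
        with corr[of t s] st show ?thesis unfolding eq by (simp add: k_def box_def p mult.commute)
      qed
    next
      case False
      then have "H (p, \<omega>) = 0" for \<omega> by (cases p) (auto simp: H_def Zpath)
      then show ?thesis using \<rho> by (simp add: k_def box_def)
    qed
  qed
  also have "\<dots> = (LBINT s. LBINT t. k (s, t))"
    by (rule lborel_pair.integral_fst'[OF k_int, symmetric])
  also have "\<dots> \<le> (LBINT s. indicator {0..T} s * (2 * \<rho> / \<delta>))"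
    by (intro integral_mono lborel_pair.integrable_fst'[OF k_int] k_inner
        integrable_mult_left integrable_real_indicator) (auto simp: emeasure_lborel_Icc_eq)
  also have "\<dots> = 2 * \<rho> / \<delta> * T" using T by simp
  finally have le: "(\<integral>\<omega>. (J \<omega>)\<^sup>2 \<partial>M) \<le> 2 * \<rho> / \<delta> * T" .
  have Jint: "integrable M (\<lambda>\<omega>. (J \<omega>)\<^sup>2)"
  proof (rule integrable_cong_AE_imp[OF P.integrable_snd[OF H_int']])
    show "(\<lambda>\<omega>. (J \<omega>)\<^sup>2) \<in> borel_measurable M" by (rule J_meas)
  qed (use J_sq in auto)
  have "(\<integral>\<^sup>+\<omega>. ennreal ((LBINT t:{0..T}. F (Y t \<omega>))\<^sup>2) \<partial>M) = (\<integral>\<^sup>+\<omega>. ennreal ((J \<omega>)\<^sup>2) \<partial>M)"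
    unfolding J_def Z_def set_integral_path ..
  also have "\<dots> = ennreal (\<integral>\<omega>. (J \<omega>)\<^sup>2 \<partial>M)"
    by (rule nn_integral_eq_integral[OF Jint]) simp
  also have "\<dots> \<le> ennreal (2 * \<rho> / \<delta> * T)" by (rule ennreal_leI[OF le])
  finally show ?thesis .
qed

text \<open>
  To each time \<open>t\<close> belongs an interval of constancy that starts at \<open>t\<close> and contains a rational
  number; no assumption on left limits is needed.
\<close>

lemma countable_discontinuities:
  assumes \<omega>: "\<omega> \<in> space M"
  shows "countable {t. t > 0 \<and> \<not> (\<forall>\<^sub>F s in at_left t. Y s \<omega> = Y t \<omega>)}" (is "countable ?D")
proof -
  have "\<exists>q\<in>\<rat>. t < q \<and> (\<forall>s. t \<le> s \<and> s \<le> q \<longrightarrow> Y s \<omega> = Y t \<omega>)" if t: "t > 0" for t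
  proof -
    obtain e where e: "e > t" "\<And>s. t < s \<Longrightarrow> s < e \<Longrightarrow> Y s \<omega> = Y t \<omega>"
      using right_continuous[OF \<omega> less_imp_le[OF t]] unfolding eventually_at_right_field by metis
    obtain q where q: "q \<in> \<rat>" "t < q" "q < e" using Rats_dense_in_real[OF e(1)] by blast
    show ?thesis
    proof (intro bexI[of _ q] conjI allI impI)
      fix s assume "t \<le> s \<and> s \<le> q"
      then show "Y s \<omega> = Y t \<omega>" using e(2)[of s] q by (cases "s = t") auto
    qed (use q in auto)
  qed
  then obtain q where q: "\<And>t. t > 0 \<Longrightarrow> q t \<in> \<rat>" "\<And>t. t > 0 \<Longrightarrow> t < q t"
    "\<And>t s. t > 0 \<Longrightarrow> t \<le> s \<Longrightarrow> s \<le> q t \<Longrightarrow> Y s \<omega> = Y t \<omega>"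
    by metis
  \<comment> \<open>Two discontinuities cannot share the same rational: the later one would lie inside the
    interval of constancy of the earlier one.\<close>
  have neq: "q t \<noteq> q t'" if "t \<in> ?D" "t' \<in> ?D" "t < t'" for t t'
  proof
    assume eq: "q t = q t'"
    have t: "t > 0" "t' > 0" using that by auto
    have "t' < q t" using q(2)[OF t(2)] eq by simp
    have "\<forall>\<^sub>F s in at_left t'. Y s \<omega> = Y t' \<omega>"
      unfolding eventually_at_left_field
    proof (intro exI[of _ t] conjI allI impI)
      fix s assume s: "t < s" "s < t'"
      have "Y s \<omega> = Y t \<omega>" using q(3)[OF t(1), of s] s \<open>t' < q t\<close> by simp
      moreover have "Y t' \<omega> = Y t \<omega>" using q(3)[OF t(1), of t'] that(3) \<open>t' < q t\<close> by simp
      ultimately show "Y s \<omega> = Y t' \<omega>" by simp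
    qed (rule that(3))
    with that(2) show False by simp
  qed
  have "inj_on q ?D"
  proof (rule inj_onI)
    fix t t' assume t: "t \<in> ?D" "t' \<in> ?D" "q t = q t'"
    show "t = t'" using neq[OF t(1,2)] neq[OF t(2,1)] t(3) by (cases t t' rule: linorder_cases) auto
  qed
  moreover have "countable (q ` ?D)"
    by (rule countable_subset[OF _ countable_rat]) (use q(1) in auto)
  ultimately show ?thesis by (rule countable_image_inj_on[rotated])
qed

end

text \<open>
  For nondecreasing \<open>A\<close>, averages along the squares control all averages, because consecutive squares
  have ratio tending to \<open>1\<close>.
\<close>

lemma average_tendsto_of_squares:
  fixes A :: "real \<Rightarrow> real"
  assumes mono: "\<And>s t. 0 \<le> s \<Longrightarrow> s \<le> t \<Longrightarrow> A s \<le> A t" and nn: "\<And>t. 0 \<le> t \<Longrightarrow> A t \<ge> 0"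
    and lim: "(\<lambda>n. A ((real n)\<^sup>2) / (real n)\<^sup>2) \<longlonglongrightarrow> g"
  shows "((\<lambda>T. A T / T) \<longlongrightarrow> g) at_top"
proof -
  define n where "n T = nat \<lfloor>sqrt T\<rfloor>" for T
  have n_top: "filterlim n at_top at_top"
    unfolding n_def
    by (intro filterlim_compose[OF filterlim_nat_sequentially] filterlim_compose[OF filterlim_floor_sequentially]
        sqrt_at_top)
  define a where "a n = A ((real n)\<^sup>2) / (real n)\<^sup>2" for n
  have ratio: "(\<lambda>n. (real (Suc n))\<^sup>2 / (real n)\<^sup>2) \<longlonglongrightarrow> 1"
    using tendsto_power[OF LIMSEQ_Suc_n_over_n[where 'a=real], of 2] by (simp add: power_divide)
  have ratio': "(\<lambda>n. (real n)\<^sup>2 / (real (Suc n))\<^sup>2) \<longlonglongrightarrow> 1"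
    using tendsto_power[OF LIMSEQ_n_over_Suc_n[where 'a=real], of 2] by (simp add: power_divide)
  have "(\<lambda>n. a n * ((real n)\<^sup>2 / (real (Suc n))\<^sup>2)) \<longlonglongrightarrow> g * 1"
    using lim ratio' unfolding a_def by (rule tendsto_mult)
  then have low: "((\<lambda>T. a (n T) * ((real (n T))\<^sup>2 / (real (Suc (n T)))\<^sup>2)) \<longlongrightarrow> g) at_top"
    using filterlim_compose[OF _ n_top] by simp
  have "(\<lambda>n. a (Suc n) * ((real (Suc n))\<^sup>2 / (real n)\<^sup>2)) \<longlonglongrightarrow> g * 1"
    using LIMSEQ_Suc[OF lim] ratio unfolding a_def by (rule tendsto_mult)
  then have high: "((\<lambda>T. a (Suc (n T)) * ((real (Suc (n T)))\<^sup>2 / (real (n T))\<^sup>2)) \<longlongrightarrow> g) at_top"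
    using filterlim_compose[OF _ n_top] by simp
  have bounds: "a (n T) * ((real (n T))\<^sup>2 / (real (Suc (n T)))\<^sup>2) \<le> A T / T \<and>
      A T / T \<le> a (Suc (n T)) * ((real (Suc (n T)))\<^sup>2 / (real (n T))\<^sup>2)" if T: "T \<ge> 1" for T
  proof -
    let ?n = "real (n T)"
    have n_eq: "?n = of_int \<lfloor>sqrt T\<rfloor>" using T unfolding n_def by (subst of_nat_nat) auto
    have "sqrt T \<ge> 1" using T by simp
    then have n1: "?n \<ge> 1" unfolding n_eq by (simp add: le_floor_iff)
    have "?n \<le> sqrt T" "sqrt T \<le> real (Suc (n T))" using n_eq by linarith+
    then have "?n\<^sup>2 \<le> (sqrt T)\<^sup>2" "(sqrt T)\<^sup>2 \<le> (real (Suc (n T)))\<^sup>2"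
      using n1 T by (intro power_mono; simp)+
    then have b: "?n\<^sup>2 \<le> T" "T \<le> (real (Suc (n T)))\<^sup>2" using T by auto
    have "A (?n\<^sup>2) / (real (Suc (n T)))\<^sup>2 \<le> A T / T"
      by (rule frac_le) (use b T nn mono in auto)
    moreover have "A T / T \<le> A ((real (Suc (n T)))\<^sup>2) / ?n\<^sup>2"
      by (rule frac_le) (use b T nn mono n1 in auto)
    ultimately show ?thesis using n1 by (simp add: a_def)
  qed
  show ?thesis
    by (rule tendsto_sandwich[OF _ _ low high])
       (use bounds in \<open>auto intro: eventually_mono[OF eventually_ge_at_top[of 1]]\<close>)
qed

context right_continuous_process
begin

text \<open>
  The squared deviations of the averages over \<open>[0, n\<^sup>2]\<close> have expectations of order
  \<open>1 / n\<^sup>2\<close>, so they are almost surely summable.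
\<close>

lemma time_average_tendsto:
  fixes f :: "'a \<Rightarrow> real"
  assumes \<delta>: "\<delta> > 0" and \<rho>: "\<rho> \<ge> 0" and f: "\<And>x. f x \<ge> 0"
    and int: "\<And>t. t \<ge> 0 \<Longrightarrow> integrable M (\<lambda>\<omega>. f (Y t \<omega>))"
    and int_le: "\<And>t. t \<ge> 0 \<Longrightarrow> (\<integral>\<omega>. f (Y t \<omega>) \<partial>M) \<le> \<kappa>'"
    and sq: "\<And>t. t \<ge> 0 \<Longrightarrow> integrable M (\<lambda>\<omega>. (f (Y t \<omega>) - g)\<^sup>2)"
    and sq_le: "\<And>t. t \<ge> 0 \<Longrightarrow> (\<integral>\<omega>. (f (Y t \<omega>) - g)\<^sup>2 \<partial>M) \<le> \<kappa>"
    and corr: "\<And>s t. 0 \<le> s \<Longrightarrow> s \<le> t \<Longrightarrow>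
      \<bar>\<integral>\<omega>. (f (Y s \<omega>) - g) * (f (Y t \<omega>) - g) \<partial>M\<bar> \<le> \<rho> * exp (- \<delta> * (t - s))"
  shows "AE \<omega> in M. ((\<lambda>T. (LBINT t:{0..T}. f (Y t \<omega>)) / T) \<longlongrightarrow> g) at_top"
proof -
  define X where "X n \<omega> = (LBINT t:{0..(real n)\<^sup>2}. f (Y t \<omega>) - g) / (real n)\<^sup>2" for n \<omega>
  have X_meas: "X n \<in> borel_measurable M" for n
  proof -
    have "(\<lambda>(\<omega>, t). indicator {0..(real n)\<^sup>2} t * path (\<lambda>x. f x - g) t \<omega>) \<in> borel_measurable (M \<Otimes>\<^sub>M lborel)"
      using measurable_compose[OF measurable_pair_swap' path_measurable[of "\<lambda>x. f x - g"]]
      by (auto simp: split_beta' intro!: borel_measurable_times)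
    then show ?thesis
      unfolding X_def set_integral_path[of _ "\<lambda>x. f x - g"]
      by (intro borel_measurable_divide lborel.borel_measurable_lebesgue_integral) auto
  qed
  have X_sq: "(\<integral>\<^sup>+\<omega>. ennreal ((X n \<omega>)\<^sup>2) \<partial>M) \<le> ennreal (2 * \<rho> / \<delta> * (1 / (real n)\<^sup>2))" for n
  proof (cases "n = 0")
    case True
    then show ?thesis by (simp add: X_def)
  next
    case False
    let ?S = "\<lambda>\<omega>. LBINT t:{0..(real n)\<^sup>2}. f (Y t \<omega>) - g"
    have "(\<integral>\<^sup>+\<omega>. ennreal ((X n \<omega>)\<^sup>2) \<partial>M) = (\<integral>\<^sup>+\<omega>. ennreal (1 / (real n) ^ 4) * ennreal ((?S \<omega>)\<^sup>2) \<partial>M)"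
      by (intro nn_integral_cong) (simp add: X_def power_divide flip: ennreal_mult power_mult)
    also have "\<dots> = ennreal (1 / (real n) ^ 4) * (\<integral>\<^sup>+\<omega>. ennreal ((?S \<omega>)\<^sup>2) \<partial>M)"
    proof (rule nn_integral_cmult)
      have "(\<lambda>\<omega>. (real n)\<^sup>2 * X n \<omega>) \<in> borel_measurable M" using X_meas by auto
      also have "(\<lambda>\<omega>. (real n)\<^sup>2 * X n \<omega>) = ?S" using False by (simp add: X_def)
      finally show "(\<lambda>\<omega>. ennreal ((?S \<omega>)\<^sup>2)) \<in> borel_measurable M" by measurable
    qed
    also have "\<dots> \<le> ennreal (1 / (real n) ^ 4) * ennreal (2 * \<rho> / \<delta> * (real n)\<^sup>2)"
      by (intro mult_left_mono time_integral_second_moment[OF \<delta> _ \<rho> sq sq_le corr]) auto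
    also have "\<dots> = ennreal (2 * \<rho> / \<delta> * (1 / (real n)\<^sup>2))"
      using \<rho> \<delta> False by (simp add: field_simps power4_eq_xxxx power2_eq_square flip: ennreal_mult)
    finally show ?thesis .
  qed
  have "(\<integral>\<^sup>+\<omega>. (\<Sum>n. ennreal ((X n \<omega>)\<^sup>2)) \<partial>M) = (\<Sum>n. \<integral>\<^sup>+\<omega>. ennreal ((X n \<omega>)\<^sup>2) \<partial>M)"
    using X_meas by (intro nn_integral_suminf) auto
  also have "\<dots> \<le> (\<Sum>n. ennreal (2 * \<rho> / \<delta> * (1 / (real n)\<^sup>2)))"
    by (intro suminf_le X_sq) auto
  also have "\<dots> = ennreal (\<Sum>n. 2 * \<rho> / \<delta> * (1 / (real n)\<^sup>2))"
    using inverse_power_summable[of 2, where 'a=real] \<rho> \<delta>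
    by (intro suminf_ennreal2 summable_mult) (auto simp: inverse_eq_divide)
  finally have "(\<integral>\<^sup>+\<omega>. (\<Sum>n. ennreal ((X n \<omega>)\<^sup>2)) \<partial>M) \<noteq> \<infinity>"
    by (auto simp: top_unique)
  then have "AE \<omega> in M. (\<Sum>n. ennreal ((X n \<omega>)\<^sup>2)) \<noteq> \<infinity>"
    using X_meas by (intro nn_integral_PInf_AE) auto
  moreover have "AE \<omega> in M. \<forall>n. set_integrable lborel {0..real n} (\<lambda>t. f (Y t \<omega>))"
    unfolding AE_all_countable
    using f int_le by (intro allI AE_set_integrable_path[where \<kappa>=\<kappa>'] int) auto
  ultimately show ?thesis
  proof eventually_elim
    case (elim \<omega>)
    have int_T: "set_integrable lborel {0..T} (\<lambda>t. f (Y t \<omega>))" for T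
    proof -
      obtain n where "T \<le> real n" using real_arch_simple by blast
      then show ?thesis
        by (intro set_integrable_subset[OF elim(2)[rule_format, of n]]) auto
    qed
    define A where "A T = (LBINT t:{0..T}. f (Y t \<omega>))" for T
    have "summable (\<lambda>n. (X n \<omega>)\<^sup>2)"
      using elim(1) by (intro summable_suminf_not_top) auto
    then have "(\<lambda>n. (X n \<omega>)\<^sup>2) \<longlonglongrightarrow> 0" by (rule summable_LIMSEQ_zero)
    then have "(\<lambda>n. X n \<omega>) \<longlonglongrightarrow> 0"
      using tendsto_real_sqrt[of "\<lambda>n. (X n \<omega>)\<^sup>2" 0] by (simp add: tendsto_rabs_zero_iff)
    then have "(\<lambda>n. X n \<omega> + g) \<longlonglongrightarrow> g" using tendsto_add[OF _ tendsto_const, of _ 0 _ g] by simp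
    moreover have "X n \<omega> + g = A ((real n)\<^sup>2) / (real n)\<^sup>2" if "n > 0" for n
    proof -
      have "(LBINT t:{0..(real n)\<^sup>2}. f (Y t \<omega>) - g) = A ((real n)\<^sup>2) - (LBINT t:{0..(real n)\<^sup>2}. g)"
        unfolding A_def by (rule set_integral_diff[OF int_T]) (simp add: set_integrable_def)
      also have "(LBINT t:{0..(real n)\<^sup>2}. g) = (real n)\<^sup>2 * g"
        by (simp add: set_lebesgue_integral_def)
      finally show ?thesis using that by (simp add: X_def field_simps)
    qed
    then have "\<forall>\<^sub>F n in sequentially. X n \<omega> + g = A ((real n)\<^sup>2) / (real n)\<^sup>2"
      by (intro eventually_mono[OF eventually_gt_at_top[of 0]])
    ultimately have lim: "(\<lambda>n. A ((real n)\<^sup>2) / (real n)\<^sup>2) \<longlonglongrightarrow> g"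
      by (rule Lim_transform_eventually)
    have "((\<lambda>T. A T / T) \<longlongrightarrow> g) at_top"
    proof (rule average_tendsto_of_squares[OF _ _ lim])
      show "A s \<le> A t" if "s \<le> t" for s t
        unfolding A_def set_lebesgue_integral_def
        using int_T[unfolded set_integrable_def] that f
        by (intro integral_mono) (auto simp: indicator_def)
      show "A t \<ge> 0" for t
        unfolding A_def set_lebesgue_integral_def using f by (intro Bochner_Integration.integral_nonneg) auto
    qed
    then show ?case by (simp add: A_def)
  qed
qed

end

text \<open>
  The strong law of large numbers for an ergodic semigroup. Besides right-continuity of the paths,
  only the joint laws of \<open>(Y s, Y (s + t))\<close> enter: conditioning at the earlier time turns the correlation
  into \<open>F y * Pt t F y\<close> with \<open>F = f - E f\<close>, which is at most
  \<open>exp (- \<delta> * t)\<close> times a multiple of \<open>(W y)\<^sup>2\<close>, and \<open>W1\<close> keeps the expectation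
  of \<open>(W (Y s))\<^sup>2\<close> bounded in \<open>s\<close>.
\<close>

lemma ergodic_time_average:
  fixes K :: "real \<Rightarrow> 'a::countable \<Rightarrow> 'a pmf" and M :: "'w measure"
  assumes "ergodic_semigroup K Q N \<Lambda> \<theta> W z c b \<delta> L"
    and "right_continuous_process M Y"
    and joint: "\<And>s t. 0 \<le> s \<Longrightarrow> 0 \<le> t \<Longrightarrow> distr M (count_space UNIV) (\<lambda>\<omega>. (Y s \<omega>, Y (s + t) \<omega>))
      = measure_pmf (bind_pmf (K s x) (\<lambda>y. map_pmf (Pair y) (K t y)))"
    and c1: "c1 > 0" and b1: "b1 \<ge> 0" and W1: "\<And>x. W1 x \<ge> 0"
    and drift1: "\<And>x. (\<Sum>y\<in>N x. Q x y * W1 y) \<le> - c1 * W1 x + b1"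
    and M1: "M1 \<ge> 0" and W_sq: "\<And>x. (W x)\<^sup>2 \<le> M1 * W1 x"
    and f: "\<And>y. f y \<ge> 0" "\<And>y. f y \<le> C * W y"
  shows "AE \<omega> in M. ((\<lambda>T. (LBINT t:{0..T}. f (Y t \<omega>)) / T) \<longlongrightarrow> measure_pmf.expectation \<theta> f) at_top"
proof -
  interpret ergodic_semigroup K Q N \<Lambda> \<theta> W z c b \<delta> L by fact
  interpret right_continuous_process M Y by fact
  define g where "g = measure_pmf.expectation \<theta> f"
  define F where "F y = f y - g" for y
  define B where "B = C + \<bar>g\<bar>"
  define \<kappa> where "\<kappa> = B\<^sup>2 * M1 * (W1 x + b1 / c1)"
  have fW: "\<bar>f y\<bar> \<le> C * W y" for y using f[of y] by simp
  have FW: "\<bar>F y\<bar> \<le> B * W y" for y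
  proof -
    have "\<bar>g\<bar> * 1 \<le> \<bar>g\<bar> * W y" by (intro mult_left_mono W_ge_1) simp
    then show ?thesis using fW[of y] by (simp add: F_def B_def algebra_simps)
  qed
  have B: "B \<ge> 0" by (rule C_nonneg[where u=F, OF FW])
  have \<theta>F: "measure_pmf.expectation \<theta> F = 0"
    unfolding F_def using integrable_\<theta>[where u=f, OF fW] by (simp add: g_def)
  have FF: "\<bar>F y\<bar> * \<bar>F y\<bar> \<le> B\<^sup>2 * M1 * W1 y" for y
  proof -
    have "\<bar>F y\<bar> * \<bar>F y\<bar> \<le> (B * W y) * (B * W y)"
      by (intro mult_mono FW) (use B W_nonneg[of y] in auto)
    also have "\<dots> = B\<^sup>2 * (W y)\<^sup>2" by (simp add: power2_eq_square)
    also have "\<dots> \<le> B\<^sup>2 * (M1 * W1 y)" by (intro mult_left_mono W_sq) simp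
    finally show ?thesis by (simp add: mult.assoc)
  qed
  have drift1': "G W1 y \<le> - c1 * W1 y + b1" for y using drift1[of y] by (simp add: G_def)
  have W1_int: "integrable (measure_pmf (K t x)) W1" and W1_le: "Pt t W1 x \<le> W1 x + b1 / c1"
    if "t \<ge> 0" for t
    using integrable_drift[OF c1 b1 W1 drift1' that] Pt_drift_le[OF c1 b1 W1 drift1' that] by auto
  have bnd: "measure_pmf.expectation (K t x) (\<lambda>y. B\<^sup>2 * M1 * W1 y) \<le> \<kappa>" if "t \<ge> 0" for t
    using W1_le[OF that] M1 by (simp add: \<kappa>_def Pt_def mult_left_mono)
  have \<kappa>: "\<kappa> \<ge> 0" using W1[of x] M1 b1 c1 by (simp add: \<kappa>_def)
  have law: "distr M (count_space UNIV) (Y t) = measure_pmf (K t x)" if t: "t \<ge> 0" for t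
  proof -
    have pair: "(\<lambda>\<omega>. (Y t \<omega>, Y (t + 0) \<omega>)) \<in> measurable M (count_space UNIV)"
      using measurable_compose[OF Y_measurable[OF t], of "\<lambda>y. (y, y)" "count_space UNIV"] by simp
    have "distr M (count_space UNIV) (Y t)
        = distr (distr M (count_space UNIV) (\<lambda>\<omega>. (Y t \<omega>, Y (t + 0) \<omega>))) (count_space UNIV) fst"
      by (subst distr_distr[OF _ pair]) (auto simp: comp_def)
    also have "\<dots> = measure_pmf (map_pmf fst (bind_pmf (K t x) (\<lambda>y. map_pmf (Pair y) (K 0 y))))"
      by (subst joint[OF t order_refl]) (simp add: map_pmf_rep_eq)
    also have "map_pmf fst (bind_pmf (K t x) (\<lambda>y. map_pmf (Pair y) (K 0 y))) = K t x"
      by (simp add: map_bind_pmf pmf.map_comp comp_def K_0 bind_return_pmf')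
    finally show ?thesis .
  qed
  have int_law: "integrable M (\<lambda>\<omega>. u (Y t \<omega>)) \<longleftrightarrow> integrable (measure_pmf (K t x)) u"
    and E_law: "(\<integral>\<omega>. u (Y t \<omega>) \<partial>M) = measure_pmf.expectation (K t x) u"
    if "t \<ge> 0" for t and u :: "'a \<Rightarrow> real"
    using integrable_distr_eq[OF Y_measurable[OF that], of u] integral_distr[OF Y_measurable[OF that], of u]
    by (simp_all add: law[OF that])
  have sq_int: "integrable (measure_pmf (K t x)) (\<lambda>y. (F y)\<^sup>2)" if "t \<ge> 0" for t
  proof (rule Bochner_Integration.integrable_bound)
    show "integrable (measure_pmf (K t x)) (\<lambda>y. B\<^sup>2 * M1 * W1 y)" using W1_int[OF that] by simp
    have "norm ((F y)\<^sup>2) \<le> norm (B\<^sup>2 * M1 * W1 y)" for y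
      using FF[of y] abs_ge_self[of "B\<^sup>2 * M1 * W1 y"] by (simp add: power2_eq_square)
    then show "AE y in measure_pmf (K t x). norm ((F y)\<^sup>2) \<le> norm (B\<^sup>2 * M1 * W1 y)" by simp
  qed simp
  show ?thesis
    unfolding g_def[symmetric]
  proof (rule time_average_tendsto[OF \<delta>_pos, where \<rho>="L * \<kappa>" and \<kappa>=\<kappa> and \<kappa>'="C * (W x + b / c)"])
    show "0 \<le> L * \<kappa>" using L_pos \<kappa> by simp
    show "f y \<ge> 0" for y by (rule f)
    fix t :: real assume t: "t \<ge> 0"
    have fi: "integrable (measure_pmf (K t x)) f" by (rule integrable_K[where u=f, OF t fW])
    then show "integrable M (\<lambda>\<omega>. f (Y t \<omega>))" by (simp add: int_law[OF t])
    have "measure_pmf.expectation (K t x) f \<le> measure_pmf.expectation (K t x) (\<lambda>y. C * W y)"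
      using f integrable_K_W[OF t] by (intro integral_mono fi) auto
    also have "\<dots> \<le> C * (W x + b / c)"
      using Pt_W_le[OF t, of x] C_nonneg[where u=f, OF fW] by (simp add: Pt_def mult_left_mono)
    finally show "(\<integral>\<omega>. f (Y t \<omega>) \<partial>M) \<le> C * (W x + b / c)" by (simp add: E_law[OF t])
    show "integrable M (\<lambda>\<omega>. (f (Y t \<omega>) - g)\<^sup>2)"
      using sq_int[OF t] int_law[OF t, of "\<lambda>y. (F y)\<^sup>2"] by (simp add: F_def)
    have "measure_pmf.expectation (K t x) (\<lambda>y. (F y)\<^sup>2) \<le> measure_pmf.expectation (K t x) (\<lambda>y. B\<^sup>2 * M1 * W1 y)"
      using W1_int[OF t] FF by (intro integral_mono sq_int t) (auto simp: power2_eq_square)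
    also have "\<dots> \<le> \<kappa>" by (rule bnd[OF t])
    finally show "(\<integral>\<omega>. (f (Y t \<omega>) - g)\<^sup>2 \<partial>M) \<le> \<kappa>"
      using E_law[OF t, of "\<lambda>y. (F y)\<^sup>2"] by (simp add: F_def)
  next
    fix s t :: real assume st: "0 \<le> s" "s \<le> t"
    define h where "h = t - s"
    have h: "h \<ge> 0" "t = s + h" using st by (auto simp: h_def)
    have tn: "t \<ge> 0" using st by simp
    let ?J = "bind_pmf (K s x) (\<lambda>y. map_pmf (Pair y) (K h y))"
    let ?\<phi> = "\<lambda>p. F (fst p) * F (snd p)"
    have pair: "(\<lambda>\<omega>. (Y s \<omega>, Y (s + h) \<omega>)) \<in> measurable M (count_space UNIV)"
    proof -
      have "(\<lambda>\<omega>. (Y s \<omega>, Y (s + h) \<omega>)) \<in> measurable M (count_space UNIV \<Otimes>\<^sub>M count_space UNIV)"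
        using Y_measurable[OF st(1)] Y_measurable[OF tn] by (simp add: h(2))
      then show ?thesis by (simp add: pair_measure_countable)
    qed
    have "(\<integral>\<omega>. F (Y s \<omega>) * F (Y t \<omega>) \<partial>M) = measure_pmf.expectation ?J ?\<phi>"
      using integral_distr[OF pair, of ?\<phi>] unfolding joint[OF st(1) h(1)] by (simp add: h(2))
    also have "\<dots> = measure_pmf.expectation (K s x) (\<lambda>y. F y * Pt h F y)"
    proof (subst pmf_bind_integral)
      have "integrable M (\<lambda>\<omega>. F (Y s \<omega>) * F (Y t \<omega>))"
      proof (rule Bochner_Integration.integrable_bound)
        show "integrable M (\<lambda>\<omega>. (F (Y s \<omega>))\<^sup>2 + (F (Y t \<omega>))\<^sup>2)"
          using sq_int[OF st(1)] sq_int[OF tn] int_law[OF st(1), of "\<lambda>y. (F y)\<^sup>2"]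
            int_law[OF tn, of "\<lambda>y. (F y)\<^sup>2"] by simp
        show "(\<lambda>\<omega>. F (Y s \<omega>) * F (Y t \<omega>)) \<in> borel_measurable M"
          by (intro borel_measurable_times measurable_compose[OF Y_measurable[OF st(1)]]
              measurable_compose[OF Y_measurable[OF tn]]) auto
        have "\<bar>a * b\<bar> \<le> \<bar>a\<^sup>2 + b\<^sup>2\<bar>" for a b :: real
        proof -
          have "2 * \<bar>a * b\<bar> \<le> a\<^sup>2 + b\<^sup>2"
            using sum_squares_bound[of "\<bar>a\<bar>" "\<bar>b\<bar>"] by (simp add: abs_mult mult.assoc)
          then show ?thesis by linarith
        qed
        then show "AE \<omega> in M. norm (F (Y s \<omega>) * F (Y t \<omega>)) \<le> norm ((F (Y s \<omega>))\<^sup>2 + (F (Y t \<omega>))\<^sup>2)"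
          by simp
      qed
      then show "integrable (measure_pmf ?J) ?\<phi>"
        using integrable_distr_eq[OF pair, of ?\<phi>] unfolding joint[OF st(1) h(1)] by (simp add: h(2))
      show "measure_pmf.expectation (K s x) (\<lambda>y. measure_pmf.expectation (map_pmf (Pair y) (K h y)) ?\<phi>)
          = measure_pmf.expectation (K s x) (\<lambda>y. F y * Pt h F y)"
        by (simp add: Pt_def)
    qed
    also have "\<bar>\<dots>\<bar> \<le> measure_pmf.expectation (K s x) (\<lambda>y. L * exp (- \<delta> * h) * (B\<^sup>2 * M1 * W1 y))"
    proof -
      have pw: "\<bar>F y * Pt h F y\<bar> \<le> L * exp (- \<delta> * h) * (B\<^sup>2 * M1 * W1 y)" for y
      proof -
        have "\<bar>Pt h F y\<bar> \<le> L * exp (- \<delta> * h) * B * W y"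
          using ergodic[where u=F and x=y, OF FW h(1)] by (simp add: \<theta>F)
        then have "\<bar>F y\<bar> * \<bar>Pt h F y\<bar> \<le> (B * W y) * (L * exp (- \<delta> * h) * B * W y)"
          by (intro mult_mono FW) (use B W_nonneg[of y] in auto)
        also have "\<dots> = L * exp (- \<delta> * h) * (B\<^sup>2 * (W y)\<^sup>2)" by (simp add: power2_eq_square)
        also have "\<dots> \<le> L * exp (- \<delta> * h) * (B\<^sup>2 * (M1 * W1 y))"
          using L_pos by (intro mult_left_mono W_sq) auto
        finally show ?thesis by (simp add: abs_mult mult.assoc)
      qed
      have i: "integrable (measure_pmf (K s x)) (\<lambda>y. L * exp (- \<delta> * h) * (B\<^sup>2 * M1 * W1 y))"
        using W1_int[OF st(1)] by simp
      show ?thesis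
        unfolding real_norm_def[symmetric]
        by (rule order_trans[OF integral_norm_bound integral_mono_AE'[OF i]]) (use pw order_trans[OF abs_ge_zero pw] in auto)
    qed
    also have "\<dots> \<le> L * exp (- \<delta> * h) * \<kappa>"
      using bnd[OF st(1)] L_pos by (simp add: mult_left_mono del: mult_le_cancel_left_pos)
    finally show "\<bar>\<integral>\<omega>. (f (Y s \<omega>) - g) * (f (Y t \<omega>) - g) \<partial>M\<bar> \<le> L * \<kappa> * exp (- \<delta> * (t - s))"
      by (simp add: F_def h_def mult_ac)
  qed
qed

section \<open>From right-continuous Markov chains to semigroups\<close>

text \<open>The law of \<open>Y t\<close> under \<open>P x\<close>, as a probability mass function on the states.\<close>

definition chain_law :: "(state \<Rightarrow> 'w measure) \<Rightarrow> (real \<Rightarrow> 'w \<Rightarrow> state) \<Rightarrow> real \<Rightarrow> state \<Rightarrow> state pmf" where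
  "chain_law P Y t x = embed_pmf (\<lambda>y. \<P>(\<omega> in P x. Y t \<omega> = y))"

context
  fixes Q :: "state \<Rightarrow> state \<Rightarrow> real" and P :: "state \<Rightarrow> 'w measure" and Y :: "real \<Rightarrow> 'w \<Rightarrow> state"
  assumes chain: "right_continuous_markov_chain Q P Y"
begin

lemmas chain_at = chain[unfolded right_continuous_markov_chain_def, THEN spec]

lemma chain_prob_space: "prob_space (P x)"
  and chain_measurable: "t \<ge> 0 \<Longrightarrow> Y t \<in> measurable (P x) (count_space UNIV)"
  and chain_start: "AE \<omega> in P x. Y 0 \<omega> = x"
  using chain_at[of x] by blast+

lemma chain_process: "right_continuous_process (P x) Y"
proof -
  interpret prob_space "P x" by (rule chain_prob_space)
  show ?thesis
  proof
    show "t \<ge> 0 \<Longrightarrow> Y t \<in> measurable (P x) (count_space UNIV)" for t by (rule chain_measurable)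
    fix \<omega> t assume "\<omega> \<in> space (P x)" "0 \<le> (t::real)"
    then have "continuous (at_right t) (\<lambda>s. Y s \<omega>)"
      using chain_at[of x] by blast
    then have lim: "((\<lambda>s. Y s \<omega>) \<longlongrightarrow> Y t \<omega>) (at_right t)"
      by (simp add: continuous_within)
    have "open {Y t \<omega>}"
      using open_Times[OF Topological_Spaces.open_discrete Topological_Spaces.open_discrete, of "{fst (Y t \<omega>)}" "{snd (Y t \<omega>)}"] by simp
    from topological_tendstoD[OF lim this] show "\<forall>\<^sub>F s in at_right t. Y s \<omega> = Y t \<omega>" by simp
  qed
qed

lemma measure_chain_law:
  assumes t: "t \<ge> 0"
  shows "measure_pmf (chain_law P Y t x) = distr (P x) (count_space UNIV) (Y t)"
    and "pmf (chain_law P Y t x) y = \<P>(\<omega> in P x. Y t \<omega> = y)"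
proof -
  interpret prob_space "P x" by (rule chain_prob_space)
  note meas = chain_measurable[OF t, of x]
  interpret D: prob_space "distr (P x) (count_space UNIV) (Y t)" by (rule prob_space_distr[OF meas])
  have eq: "emeasure (distr (P x) (count_space UNIV) (Y t)) {y} = ennreal (\<P>(\<omega> in P x. Y t \<omega> = y))" for y
    by (subst emeasure_distr[OF meas]) (auto simp: emeasure_eq_measure vimage_def Int_def conj_commute)
  have "(\<integral>\<^sup>+y. ennreal (\<P>(\<omega> in P x. Y t \<omega> = y)) \<partial>count_space UNIV)
      = emeasure (distr (P x) (count_space UNIV) (Y t)) UNIV"
    unfolding eq[symmetric] by (rule emeasure_countable_singleton[symmetric]) auto
  also have "\<dots> = 1" using D.emeasure_space_1 by simp
  finally have pmf: "pmf (chain_law P Y t x) y = \<P>(\<omega> in P x. Y t \<omega> = y)" for y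
    unfolding chain_law_def by (intro pmf_embed_pmf) auto
  then show "pmf (chain_law P Y t x) y = \<P>(\<omega> in P x. Y t \<omega> = y)" .
  show "measure_pmf (chain_law P Y t x) = distr (P x) (count_space UNIV) (Y t)"
    by (rule measure_eqI_countable[of _ UNIV]) (auto simp: eq emeasure_pmf_single pmf)
qed

lemma chain_pair_measurable:
  assumes "0 \<le> s" "0 \<le> t"
  shows "(\<lambda>\<omega>. (Y s \<omega>, Y t \<omega>)) \<in> measurable (P x) (count_space UNIV)"
proof -
  have "(\<lambda>\<omega>. (Y s \<omega>, Y t \<omega>)) \<in> measurable (P x) (count_space UNIV \<Otimes>\<^sub>M count_space UNIV)"
    using chain_measurable[OF assms(1)] chain_measurable[OF assms(2)] by simp
  then show ?thesis by (simp add: pair_measure_countable)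
qed

text \<open>The Markov property at two times, stated as an identity of measures.\<close>

lemma chain_joint_law:
  assumes "0 \<le> s" "0 \<le> t"
  shows "distr (P x) (count_space UNIV) (\<lambda>\<omega>. (Y s \<omega>, Y (s + t) \<omega>))
    = measure_pmf (bind_pmf (chain_law P Y s x) (\<lambda>y. map_pmf (Pair y) (chain_law P Y t y)))"
    (is "_ = measure_pmf ?J")
proof -
  interpret prob_space "P x" by (rule chain_prob_space)
  have st: "s + t \<ge> 0" using assms by simp
  note pair = chain_pair_measurable[OF assms(1) st]
  have eq: "pmf ?J (y, z) = \<P>(\<omega> in P x. Y s \<omega> = y \<and> Y (s + t) \<omega> = z)" for y z
  proof -
    let ?t = "\<lambda>l::nat. if l = 0 then s else s + t" and ?y = "\<lambda>l::nat. if l = 0 then y else z"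
    have all: "(\<forall>l\<le>Suc 0. Y (?t l) \<omega> = ?y l) \<longleftrightarrow> Y s \<omega> = y \<and> Y (s + t) \<omega> = z" for \<omega>
      by (auto simp: le_Suc_eq)
    have "\<P>(\<omega> in P x. \<forall>l\<le>Suc 0. Y (?t l) \<omega> = ?y l) =
        \<P>(\<omega> in P x. \<forall>l\<le>0. Y (?t l) \<omega> = ?y l) * \<P>(\<omega> in P (?y 0). Y (?t (Suc 0) - ?t 0) \<omega> = ?y (Suc 0))"
      using chain_at[of x, THEN conjunct2, THEN conjunct2,
          THEN conjunct2, THEN conjunct2, THEN conjunct1, rule_format, of ?t 0 ?y] assms by simp
    then have markov: "\<P>(\<omega> in P x. Y s \<omega> = y \<and> Y (s + t) \<omega> = z)
        = pmf (chain_law P Y s x) y * pmf (chain_law P Y t y) z"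
      unfolding all using assms by (simp add: measure_chain_law)
    have single: "pmf (map_pmf (Pair y') (chain_law P Y t y')) (y, z) = (if y' = y then pmf (chain_law P Y t y) z else 0)" for y'
    proof (cases "y' = y")
      case True
      then show ?thesis by (simp add: pmf_map_inj' inj_def)
    next
      case False
      then have "(y, z) \<notin> set_pmf (map_pmf (Pair y') (chain_law P Y t y'))" by auto
      then have "pmf (map_pmf (Pair y') (chain_law P Y t y')) (y, z) = 0"
        unfolding set_pmf_iff by simp
      then show ?thesis using False by simp
    qed
    have "pmf ?J (y, z) = pmf (chain_law P Y t y) z * pmf (chain_law P Y s x) y"
      unfolding pmf_bind single by (subst integral_measure_pmf_real[of "{y}"]) (auto split: if_splits)
    then show ?thesis by (simp add: markov mult.commute)
  qed
  have vim: "(\<lambda>\<omega>. (Y s \<omega>, Y (s + t) \<omega>)) -` {(y, z)} \<inter> space (P x)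
      = {\<omega> \<in> space (P x). Y s \<omega> = y \<and> Y (s + t) \<omega> = z}" for y z by auto
  show ?thesis
  proof (rule measure_eqI_countable[of _ UNIV])
    fix p :: "state \<times> state"
    obtain y z where p: "p = (y, z)" by (cases p)
    show "emeasure (distr (P x) (count_space UNIV) (\<lambda>\<omega>. (Y s \<omega>, Y (s + t) \<omega>))) {p} = emeasure (measure_pmf ?J) {p}"
      unfolding p by (subst emeasure_distr[OF pair]) (auto simp: emeasure_pmf_single eq vim emeasure_eq_measure)
  qed auto
qed

lemma chain_law_add:
  assumes "0 \<le> s" "0 \<le> t"
  shows "chain_law P Y (s + t) x = bind_pmf (chain_law P Y s x) (chain_law P Y t)"
proof -
  have st: "s + t \<ge> 0" using assms by simp
  let ?J = "bind_pmf (chain_law P Y s x) (\<lambda>y. map_pmf (Pair y) (chain_law P Y t y))"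
  note pair = chain_pair_measurable[OF assms(1) st]
  have "measure_pmf (chain_law P Y (s + t) x) = distr (P x) (count_space UNIV) (Y (s + t))"
    by (rule measure_chain_law[OF st])
  also have "\<dots> = distr (distr (P x) (count_space UNIV) (\<lambda>\<omega>. (Y s \<omega>, Y (s + t) \<omega>))) (count_space UNIV) snd"
    by (subst distr_distr[OF _ pair]) (auto simp: comp_def)
  also have "\<dots> = measure_pmf (map_pmf snd ?J)"
    by (simp add: chain_joint_law[OF assms] map_pmf_rep_eq)
  finally have "chain_law P Y (s + t) x = map_pmf snd ?J" by (simp add: measure_pmf_inject)
  also have "\<dots> = bind_pmf (chain_law P Y s x) (chain_law P Y t)"
    by (simp add: map_bind_pmf pmf.map_comp comp_def)
  finally show ?thesis .
qed

lemma chain_law_0: "chain_law P Y 0 x = return_pmf x"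
proof (rule pmf_eqI)
  fix y
  interpret prob_space "P x" by (rule chain_prob_space)
  have "\<P>(\<omega> in P x. Y 0 \<omega> = y) = of_bool (y = x)"
  proof (cases "y = x")
    case True
    have "\<P>(\<omega> in P x. Y 0 \<omega> = x) = 1"
      using chain_start[of x] measurable_sets[OF chain_measurable[of 0 x], of "{x}"]
      by (subst prob_Collect_eq_1) (auto simp: vimage_def Int_def conj_commute)
    then show ?thesis using True by simp
  next
    case False
    have "AE \<omega> in P x. Y 0 \<omega> \<noteq> y" using chain_start[of x] by eventually_elim (use False in auto)
    then have "\<P>(\<omega> in P x. Y 0 \<omega> = y) = 0"
      using measurable_sets[OF chain_measurable[of 0 x], of "{y}"]
      by (subst prob_Collect_eq_0) (auto simp: vimage_def Int_def conj_commute)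
    then show ?thesis using False by simp
  qed
  then show "pmf (chain_law P Y 0 x) y = pmf (return_pmf x) y"
    by (auto simp: measure_chain_law pmf_return indicator_def)
qed

lemma chain_law_deriv:
  "((\<lambda>t. (pmf (chain_law P Y t x) y - of_bool (y = x)) / t) \<longlongrightarrow> Q x y) (at_right 0)"
proof -
  have "((\<lambda>t. (\<P>(\<omega> in P x. Y t \<omega> = y) - of_bool (y = x)) / t) \<longlongrightarrow> Q x y) (at_right 0)"
    using chain_at[of x] by blast
  moreover have "\<forall>\<^sub>F t in at_right 0. (\<P>(\<omega> in P x. Y t \<omega> = y) - of_bool (y = x)) / t
      = (pmf (chain_law P Y t x) y - of_bool (y = x)) / t"
    using eventually_at_right_less[of "0::real"] by eventually_elim (simp add: measure_chain_law)
  ultimately show ?thesis by (rule Lim_transform_eventually)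
qed

lemma expectation_chain_law:
  "t \<ge> 0 \<Longrightarrow> measure_pmf.expectation (chain_law P Y t x) u = (\<integral>\<omega>. (u (Y t \<omega>) :: real) \<partial>P x)"
  by (simp add: measure_chain_law integral_distr[OF chain_measurable])

text \<open>
  The left limit in the cost rate differs from the current state at countably many times only, so
  the limit of the time averages is the pathwise average cost.
\<close>

lemma pathwise_average_cost_eq:
  assumes \<omega>: "\<omega> \<in> space (P x)"
    and lim: "((\<lambda>T. (LBINT t:{0..T}. r (Y t \<omega>) (\<beta> (Y t \<omega>))) / T) \<longlongrightarrow> g) at_top"
  shows "pathwise_average_cost r Y \<beta> \<omega> = ereal g"
proof -
  interpret right_continuous_process "P x" Y by (rule chain_process)
  let ?D = "{t. t > 0 \<and> \<not> (\<forall>\<^sub>F s in at_left t. Y s \<omega> = Y t \<omega>)}"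
  have "(LBINT t:{0..T}. r (Y t \<omega>) (\<beta> (Lim (at_left t) (\<lambda>s. Y s \<omega>))))
      = (LBINT t:{0..T}. r (Y t \<omega>) (\<beta> (Y t \<omega>)))" for T
    unfolding set_lebesgue_integral_def
  proof (rule integral_discrete_difference[where X="insert 0 ?D"])
    show "countable (insert 0 ?D)" using countable_discontinuities[OF \<omega>] by simp
    fix t :: real assume "t \<notin> insert 0 ?D"
    then consider "t < 0" | "\<forall>\<^sub>F s in at_left t. Y s \<omega> = Y t \<omega>" by fastforce
    then show "indicator {0..T} t *\<^sub>R r (Y t \<omega>) (\<beta> (Lim (at_left t) (\<lambda>s. Y s \<omega>)))
        = indicator {0..T} t *\<^sub>R r (Y t \<omega>) (\<beta> (Y t \<omega>))"
    proof cases
      case 2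
      have "Lim (at_left t) (\<lambda>s. Y s \<omega>) = Y t \<omega>"
        by (rule tendsto_Lim[OF trivial_limit_at_left_real tendsto_eventually[OF 2]])
      then show ?thesis by simp
    qed simp
  qed auto
  then have "pathwise_average_cost r Y \<beta> \<omega>
      = Limsup at_top (\<lambda>T::real. ereal ((LBINT t:{0..T}. r (Y t \<omega>) (\<beta> (Y t \<omega>))) / T))"
    by (simp add: pathwise_average_cost_def)
  also have "\<dots> = ereal g"
    using lim by (intro lim_imp_Limsup) auto
  finally show ?thesis .
qed

end

section \<open>The controlled queue\<close>

text \<open>
  A finite set containing all states that can be reached from \<open>x\<close> in one transition, and \<open>x\<close> itself.
  Truncated subtraction adds at most harmless states, to which the rate is \<open>0\<close>.
\<close>

definition queue_nbhd :: "state \<Rightarrow> state set" where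
  "queue_nbhd x = {x, (fst x, snd x + 1), (fst x + 1, snd x), (fst x - 1, snd x - 1)}"

lemma finite_queue_nbhd: "finite (queue_nbhd x)"
  and self_queue_nbhd: "x \<in> queue_nbhd x"
  by (simp_all add: queue_nbhd_def)

lemma jump_rate_outside: "y \<notin> queue_nbhd x \<Longrightarrow> jump_rate lam mu a x y = 0"
  by (cases x; cases y) (auto simp: queue_nbhd_def)

lemma jump_rate_nonneg: "0 \<le> lam \<Longrightarrow> 0 \<le> mu \<Longrightarrow> 0 \<le> a \<Longrightarrow> 0 \<le> jump_rate lam mu a x y"
  by (cases x; cases y) auto

lemma jump_rate_le: "0 \<le> lam \<Longrightarrow> 0 \<le> mu \<Longrightarrow> 0 \<le> a \<Longrightarrow> jump_rate lam mu a x y \<le> a + lam + mu"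
  by (cases x; cases y) auto

lemma tendsto_jump_rate:
  "(f \<longlongrightarrow> a) F \<Longrightarrow> ((\<lambda>k. jump_rate lam mu (f k) x y) \<longlongrightarrow> jump_rate lam mu a x y) F"
  by (cases x; cases y) auto

lemma queue_rate_diag:
  "queue_rate lam mu a x x = - (\<Sum>y\<in>queue_nbhd x - {x}. jump_rate lam mu a x y)"
proof -
  have "(\<Sum>\<^sub>\<infinity>y\<in>- {x}. jump_rate lam mu a x y) = (\<Sum>\<^sub>\<infinity>y\<in>queue_nbhd x - {x}. jump_rate lam mu a x y)"
    by (rule infsum_cong_neutral) (auto intro: jump_rate_outside)
  then show ?thesis by (simp add: queue_rate_def finite_queue_nbhd)
qed

lemma queue_rate_off_diag: "y \<noteq> x \<Longrightarrow> queue_rate lam mu a x y = jump_rate lam mu a x y"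
  by (simp add: queue_rate_def)

lemma queue_rate_outside: "y \<notin> queue_nbhd x \<Longrightarrow> queue_rate lam mu a x y = 0"
  using jump_rate_outside[of y x] self_queue_nbhd[of x] by (metis queue_rate_off_diag)

lemma queue_rate_conservative: "(\<Sum>y\<in>queue_nbhd x. queue_rate lam mu a x y) = 0"
  by (subst sum.remove[OF finite_queue_nbhd self_queue_nbhd])
     (auto simp: queue_rate_diag queue_rate_off_diag intro!: sum.cong)

lemma queue_exit_rate_le:
  assumes "0 \<le> lam" "0 \<le> mu" "0 \<le> a"
  shows "- queue_rate lam mu a x x \<le> 4 * (a + lam + mu)"
proof -
  have "card (queue_nbhd x - {x}) \<le> card (queue_nbhd x)"
    by (intro card_mono finite_queue_nbhd) auto
  also have "\<dots> \<le> 4" by (simp add: queue_nbhd_def card_insert_if)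
  finally have card: "real (card (queue_nbhd x - {x})) \<le> 4" by simp
  have "- queue_rate lam mu a x x \<le> real (card (queue_nbhd x - {x})) * (a + lam + mu)"
    unfolding queue_rate_diag by (simp add: sum_bounded_above jump_rate_le assms)
  also have "\<dots> \<le> 4 * (a + lam + mu)"
    using card assms by (intro mult_right_mono) auto
  finally show ?thesis .
qed

lemma tendsto_queue_rate:
  assumes "(f \<longlongrightarrow> a) F"
  shows "((\<lambda>k. queue_rate lam mu (f k) x y) \<longlongrightarrow> queue_rate lam mu a x y) F"
proof (cases "y = x")
  case True
  show ?thesis unfolding True queue_rate_diag
    by (intro tendsto_minus tendsto_sum tendsto_jump_rate assms)
qed (simp add: queue_rate_off_diag tendsto_jump_rate[OF assms])

lemma tendsto_queue_cost:
  "(f \<longlongrightarrow> a) F \<Longrightarrow> ((\<lambda>k. queue_cost c0 c1 c2 c3 S x (f k)) \<longlongrightarrow> queue_cost c0 c1 c2 c3 S x a) F"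
  by (cases x) (auto intro!: tendsto_intros)

lemma generator_queue:
  "generator (queue_rate lam mu) a u x = (\<Sum>y\<in>queue_nbhd x. queue_rate lam mu a x y * u y)"
proof -
  have "generator (queue_rate lam mu) a u x = (\<Sum>\<^sub>\<infinity>y\<in>queue_nbhd x. queue_rate lam mu a x y * u y)"
    unfolding generator_def by (rule infsum_cong_neutral) (auto simp: queue_rate_outside)
  then show ?thesis by (simp add: finite_queue_nbhd)
qed

text \<open>
  The queue with the constants of the assumptions fixed: \<open>W\<close> with \<open>c\<close>, \<open>d\<close>, \<open>M\<close> from the drift
  condition, \<open>\<delta>\<close> and \<open>L\<close> from uniform ergodicity, and \<open>W1\<close> with \<open>d1\<close>, \<open>b1\<close>, \<open>M1\<close> from the second
  moment condition. All of them are independent of the policy.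
\<close>

locale controlled_queue =
  fixes lam mu gam R c0 c1 c2 c3 :: real and S :: nat
    and P :: "policy \<Rightarrow> state \<Rightarrow> 'w measure" and Y :: "policy \<Rightarrow> real \<Rightarrow> 'w \<Rightarrow> state"
    and W W1 :: "state \<Rightarrow> real" and c d M \<delta> L d1 b1 M1 :: real
  assumes rates: "lam > 0" "mu > 0" "gam > 0" "gam \<le> R"
    and costs: "c0 \<ge> 0" "c1 \<ge> 0" "c2 \<ge> 0" "c3 \<ge> 0"
    and chain: "b \<in> stationary_policies {gam..R} \<Longrightarrow>
      right_continuous_markov_chain (policy_rate (queue_rate lam mu) b) (P b) (Y b)"
    and W_ge_1: "W x \<ge> 1"
    and c_pos: "c > 0" and d_nonneg: "d \<ge> 0" and M_pos: "M > 0"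
    and drift_W: "a \<in> {gam..R} \<Longrightarrow>
      generator (queue_rate lam mu) a W x \<le> - c * W x + d * of_bool (x = (0, 0))"
    and cost_le: "a \<in> {gam..R} \<Longrightarrow> queue_cost c0 c1 c2 c3 S x a \<le> M * W x"
    and \<delta>_pos: "\<delta> > 0" and L_pos: "L > 0"
    and uniform_ergodicity: "b \<in> stationary_policies {gam..R} \<Longrightarrow> u \<in> weighted_space W \<Longrightarrow> t \<ge> 0 \<Longrightarrow>
      \<bar>(LINT \<omega>|P b x. u (Y b t \<omega>)) - measure_pmf.expectation (the_invariant_pmf (P b) (Y b)) u\<bar>
        \<le> L * exp (- \<delta> * t) * weighted_norm W u * W x"
    and d1_pos: "d1 > 0" and b1_nonneg: "b1 \<ge> 0" and M1_pos: "M1 > 0" and W1_ge_1: "W1 x \<ge> 1"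
    and drift_W1: "a \<in> {gam..R} \<Longrightarrow> generator (queue_rate lam mu) a W1 x \<le> - d1 * W1 x + b1"
    and W_sq: "(W x)\<^sup>2 \<le> M1 * W1 x"
begin

abbreviation "A \<equiv> {gam..R}"
abbreviation "SM \<equiv> stationary_policies A"
abbreviation "q \<equiv> queue_rate lam mu"
abbreviation "r \<equiv> queue_cost c0 c1 c2 c3 S"
abbreviation "\<theta> b \<equiv> the_invariant_pmf (P b) (Y b)"
abbreviation "g b \<equiv> gain r (P b) (Y b) b"
abbreviation "h b \<equiv> bias r (P b) (Y b) b"
abbreviation "K b \<equiv> chain_law (P b) (Y b)"

text \<open>
  A crude bound on the exit rates: \<open>queue_nbhd x\<close> has at most four elements, and every rate is at most
  \<open>R + lam + mu\<close>.
\<close>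

definition \<Lambda> :: real where "\<Lambda> = 4 * (R + lam + mu)"

lemma SM_D: "b \<in> SM \<Longrightarrow> b x \<in> A"
  unfolding stationary_policies_def by blast

lemma A_nonempty: "gam \<in> A"
  using rates by simp

lemma \<Lambda>_pos: "\<Lambda> > 0"
  using rates by (simp add: \<Lambda>_def)

lemma cost_nonneg: "a \<in> A \<Longrightarrow> r x a \<ge> 0"
  using costs rates by (cases x) (auto intro!: add_nonneg_nonneg mult_nonneg_nonneg)

lemma ergodic_semigroup_policy:
  assumes b: "b \<in> SM"
  shows "ergodic_semigroup (K b) (policy_rate q b) queue_nbhd \<Lambda> (\<theta> b) W (0, 0) c d \<delta> L"
proof -
  have bA: "0 \<le> b x" "b x \<le> R" for x using SM_D[OF b, of x] rates by auto
  interpret bounded_rate_semigroup "K b" "policy_rate q b" queue_nbhd \<Lambda>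
  proof
    show "K b 0 x = return_pmf x" for x by (rule chain_law_0[OF chain[OF b]])
    show "K b (s + t) x = K b s x \<bind> K b t" if "0 \<le> s" "0 \<le> t" for s t x
      by (rule chain_law_add[OF chain[OF b] that])
    show "((\<lambda>t. (pmf (K b t x) y - of_bool (y = x)) / t) \<longlongrightarrow> policy_rate q b x y) (at_right 0)" for x y
      by (rule chain_law_deriv[OF chain[OF b]])
    show "finite (queue_nbhd x)" "x \<in> queue_nbhd x" for x
      by (rule finite_queue_nbhd, rule self_queue_nbhd)
    show "policy_rate q b x y = 0" if "y \<notin> queue_nbhd x" for x y
      unfolding policy_rate_def by (rule queue_rate_outside[OF that])
    show "(\<Sum>y\<in>queue_nbhd x. policy_rate q b x y) = 0" for x
      unfolding policy_rate_def by (rule queue_rate_conservative)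
    show "0 \<le> policy_rate q b x y" if "y \<noteq> x" for x y
      unfolding policy_rate_def queue_rate_off_diag[OF that]
      using rates bA[of x] by (intro jump_rate_nonneg) auto
    show "- policy_rate q b x x \<le> \<Lambda>" for x
      unfolding policy_rate_def \<Lambda>_def
      using queue_exit_rate_le[of lam mu "b x" x] rates bA[of x] by simp
  qed
  show ?thesis
  proof
    show "1 \<le> W x" for x by (rule W_ge_1)
    show "G W x \<le> - c * W x + d * of_bool (x = (0, 0))" for x
      using drift_W[OF SM_D[OF b], of x x] by (simp add: G_def generator_queue policy_rate_def)
    fix u C t x assume u: "\<And>y. \<bar>u y\<bar> \<le> C * W y" and t: "0 \<le> (t::real)"
    have ratio: "\<bar>u y\<bar> / W y \<le> C" for y
      using u[of y] W_ge_1[of y] by (simp add: pos_divide_le_eq)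
    have uW: "u \<in> weighted_space W"
      unfolding weighted_space_def by (auto intro!: bdd_aboveI2[where M=C] ratio)
    have "weighted_norm W u \<le> C"
      unfolding weighted_norm_def by (rule cSUP_least) (auto intro: ratio)
    then have "L * exp (- \<delta> * t) * weighted_norm W u * W x \<le> L * exp (- \<delta> * t) * C * W x"
      using L_pos W_ge_1[of x] by (intro mult_right_mono mult_left_mono) auto
    with uniform_ergodicity[OF b uW t, of x]
    show "\<bar>Pt t u x - measure_pmf.expectation (\<theta> b) u\<bar> \<le> L * exp (- \<delta> * t) * C * W x"
      by (simp add: Pt_def expectation_chain_law[OF chain[OF b] t])
  qed (use c_pos d_nonneg \<delta>_pos L_pos in auto)
qed

lemma policy_G:
  assumes b: "b \<in> SM"
  shows "bounded_rate_semigroup.G (policy_rate q b) queue_nbhd u x = generator q (b x) u x"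
proof -
  interpret ergodic_semigroup "K b" "policy_rate q b" queue_nbhd \<Lambda> "\<theta> b" W "(0, 0)" c d \<delta> L
    by (rule ergodic_semigroup_policy[OF b])
  show ?thesis by (simp add: G_def generator_queue policy_rate_def)
qed

lemma cost_weighted: "b \<in> SM \<Longrightarrow> \<bar>r x (b x)\<bar> \<le> M * W x"
  using cost_nonneg[OF SM_D] cost_le[OF SM_D] by (simp add: abs_of_nonneg)

lemma
  assumes b: "b \<in> SM"
  shows integrable_W: "integrable (\<theta> b) W"
    and integrable_weighted_policy: "(\<And>y. \<bar>u y\<bar> \<le> C * W y) \<Longrightarrow> integrable (\<theta> b) u"
    and expectation_generator: "(\<And>y. \<bar>u y\<bar> \<le> C * W y) \<Longrightarrow>
      measure_pmf.expectation (\<theta> b) (\<lambda>x. generator q (b x) u x) = 0"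
    and abs_generator_policy_le: "(\<And>y. \<bar>u y\<bar> \<le> C * W y) \<Longrightarrow>
      \<bar>generator q (b x) u x\<bar> \<le> C * (2 * \<Lambda> + d) * W x"
    and Poisson_equation_policy: "g b = r x (b x) + generator q (b x) (h b) x"
    and abs_bias_le: "\<bar>h b x\<bar> \<le> L * M / \<delta> * W x"
    and stationary_center: "c \<le> d * pmf (\<theta> b) (0, 0)"
    and stationary_flow: "y \<noteq> x \<Longrightarrow> pmf (\<theta> b) x * q (b x) x y \<le> \<Lambda> * pmf (\<theta> b) y"
proof -
  interpret ergodic_semigroup "K b" "policy_rate q b" queue_nbhd \<Lambda> "\<theta> b" W "(0, 0)" c d \<delta> L
    by (rule ergodic_semigroup_policy[OF b])
  note G_eq = policy_G[OF b]
  let ?f = "\<lambda>x. r x (b x)"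
  show "integrable (\<theta> b) W" by (rule integrable_\<theta>_W)
  show "integrable (\<theta> b) u" if "\<And>y. \<bar>u y\<bar> \<le> C * W y" by (rule integrable_\<theta>[where u=u, OF that])
  show "measure_pmf.expectation (\<theta> b) (\<lambda>x. generator q (b x) u x) = 0" if "\<And>y. \<bar>u y\<bar> \<le> C * W y"
    using \<theta>_G[where u=u, OF that] by (simp add: G_eq[abs_def])
  show "\<bar>generator q (b x) u x\<bar> \<le> C * (2 * \<Lambda> + d) * W x" if "\<And>y. \<bar>u y\<bar> \<le> C * W y"
    using abs_G_weighted_le[where u=u and x=x, OF that] by (simp add: G_eq)
  have h_eq: "h b = potential ?f"
  proof
    fix x
    show "h b x = potential ?f x"
      unfolding potential_eq_Ici bias_def
    proof (rule set_lebesgue_integral_cong)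
      show "\<forall>t. t \<in> {0..} \<longrightarrow>
          (LINT \<omega>|P b x. r (Y b t \<omega>) (b (Y b t \<omega>))) - g b = transient ?f t x"
        by (simp add: transient_def Pt_def gain_def expectation_chain_law[OF chain[OF b]])
    qed simp
  qed
  show "g b = r x (b x) + generator q (b x) (h b) x"
    using Poisson_equation[where u="?f" and x=x, OF cost_weighted[OF b] cost_nonneg[OF SM_D[OF b]]]
    by (simp add: gain_def h_eq G_eq)
  show "\<bar>h b x\<bar> \<le> L * M / \<delta> * W x"
    unfolding h_eq by (rule abs_potential_le[OF cost_weighted[OF b]])
  show "c \<le> d * pmf (\<theta> b) (0, 0)" by (rule pmf_\<theta>_center)
  show "y \<noteq> x \<Longrightarrow> pmf (\<theta> b) x * q (b x) x y \<le> \<Lambda> * pmf (\<theta> b) y"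
    using pmf_\<theta>_flow[of y x] by (simp add: policy_rate_def)
qed

lemma abs_generator_le:
  assumes a: "a \<in> A" and u: "\<And>y. \<bar>u y\<bar> \<le> C * W y"
  shows "\<bar>generator q a u x\<bar> \<le> C * (2 * \<Lambda> + d) * W x"
proof -
  have "(\<lambda>_. a) \<in> SM" using a by (simp add: stationary_policies_def)
  from abs_generator_policy_le[where u=u and x=x, OF this u] show ?thesis by simp
qed

lemma pathwise_average_cost_policy:
  assumes b: "b \<in> SM"
  shows "AE \<omega> in P b x. pathwise_average_cost r (Y b) b \<omega> = ereal (g b)"
proof -
  let ?f = "\<lambda>x. r x (b x)"
  have "AE \<omega> in P b x. ((\<lambda>T. (LBINT t:{0..T}. ?f (Y b t \<omega>)) / T) \<longlongrightarrow> measure_pmf.expectation (\<theta> b) ?f) at_top"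
  proof (rule ergodic_time_average[OF ergodic_semigroup_policy[OF b] chain_process[OF chain[OF b]]
        chain_joint_law[OF chain[OF b]] d1_pos b1_nonneg _ _ less_imp_le[OF M1_pos] W_sq])
    show "0 \<le> W1 y" for y using W1_ge_1[of y] by linarith
    show "(\<Sum>y\<in>queue_nbhd x. policy_rate q b x y * W1 y) \<le> - d1 * W1 x + b1" for x
      using drift_W1[OF SM_D[OF b], of x x] by (simp add: generator_queue policy_rate_def)
    show "0 \<le> ?f y" "?f y \<le> M * W y" for y
      using cost_nonneg[OF SM_D[OF b]] cost_le[OF SM_D[OF b]] by auto
  qed
  then show ?thesis
    using AE_space
  proof eventually_elim
    case (elim \<omega>)
    show ?case
      unfolding gain_def
      by (rule pathwise_average_cost_eq[where r=r and \<beta>=b, OF chain[OF b] elim(2,1)])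
  qed
qed

text \<open>
  The stationary probabilities are bounded away from \<open>0\<close> uniformly in the policy: at the empty
  system by the drift of \<open>W\<close>, elsewhere because probability flows along the transitions.
\<close>

definition uniformly_charged :: "state \<Rightarrow> bool" where
  "uniformly_charged x \<longleftrightarrow> (\<exists>m>0. \<forall>b\<in>SM. m \<le> pmf (\<theta> b) x)"

lemma uniformly_charged_step:
  assumes x: "uniformly_charged x" and "y \<noteq> x" and \<kappa>: "\<kappa> > 0"
    and rate: "\<And>a. a \<in> A \<Longrightarrow> \<kappa> \<le> jump_rate lam mu a x y"
  shows "uniformly_charged y"
proof -
  obtain m where m: "m > 0" "\<And>b. b \<in> SM \<Longrightarrow> m \<le> pmf (\<theta> b) x"
    using x by (auto simp: uniformly_charged_def)
  have "m * \<kappa> / \<Lambda> \<le> pmf (\<theta> b) y" if b: "b \<in> SM" for b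
  proof -
    have "m * \<kappa> \<le> pmf (\<theta> b) x * q (b x) x y"
      using m(2)[OF b] rate[OF SM_D[OF b, of x]] \<kappa> m(1) \<open>y \<noteq> x\<close>
      by (intro mult_mono) (auto simp: queue_rate_off_diag)
    also have "\<dots> \<le> \<Lambda> * pmf (\<theta> b) y" by (rule stationary_flow[OF b \<open>y \<noteq> x\<close>])
    finally show ?thesis using \<Lambda>_pos by (simp add: pos_divide_le_eq mult.commute)
  qed
  then show ?thesis
    unfolding uniformly_charged_def using m(1) \<kappa> \<Lambda>_pos by (intro exI[of _ "m * \<kappa> / \<Lambda>"]) auto
qed

lemma uniformly_charged: "uniformly_charged x"
proof -
  have "(\<lambda>_. gam) \<in> SM" using rates by (simp add: stationary_policies_def)
  from stationary_center[OF this] have d: "d > 0"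
    using c_pos d_nonneg by (cases "d = 0") auto
  have start: "uniformly_charged (0, 0)"
    unfolding uniformly_charged_def
    using stationary_center c_pos d
    by (intro exI[of _ "c / d"]) (auto simp: pos_divide_le_eq mult.commute)
  have up: "uniformly_charged (0, i)" for i
  proof (induction i)
    case (Suc i)
    show ?case
      by (rule uniformly_charged_step[OF Suc, where \<kappa>=gam]) (use rates in auto)
  qed (rule start)
  have right: "uniformly_charged (n, Suc i)" for n i
  proof (induction n)
    case (Suc n)
    show ?case
      by (rule uniformly_charged_step[OF Suc, where \<kappa>=lam]) (use rates in auto)
  qed (rule up)
  have bottom: "uniformly_charged (n, 0)" for n
    by (rule uniformly_charged_step[OF right[of "Suc n" 0], where \<kappa>=mu]) (use rates in auto)
  show ?thesis
  proof (cases x)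
    case (Pair n i)
    then show ?thesis using right bottom by (cases i) auto
  qed
qed

section \<open>Policy iteration\<close>

text \<open>The bound \<open>H * W\<close> for the bias holds for all policies at once.\<close>

definition H :: real where "H = L * M / \<delta>"

lemma abs_bias_le': "b \<in> SM \<Longrightarrow> \<bar>h b x\<bar> \<le> H * W x"
  unfolding H_def by (rule abs_bias_le)

lemma W_nonneg: "W x \<ge> 0"
  using W_ge_1[of x] by linarith

lemma abs_generator_bias_le: "b \<in> SM \<Longrightarrow> a \<in> A \<Longrightarrow> \<bar>generator q a (h b) x\<bar> \<le> H * (2 * \<Lambda> + d) * W x"
  by (rule abs_generator_le[OF _ abs_bias_le'])

text \<open>The corresponding bound \<open>B * W\<close> for the values in the improvement step.\<close>

definition B :: real where "B = M + H * (2 * \<Lambda> + d)"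

lemma abs_improvement_value_le:
  assumes "b \<in> SM" "a \<in> A"
  shows "\<bar>improvement_value q r (h b) x a\<bar> \<le> B * W x"
  using abs_generator_bias_le[OF assms, of x] cost_nonneg[OF assms(2), of x] cost_le[OF assms(2), of x]
  by (simp add: improvement_value_def B_def algebra_simps)

lemma improvement_value_self: "b \<in> SM \<Longrightarrow> improvement_value q r (h b) x (b x) = g b"
  using Poisson_equation_policy by (simp add: improvement_value_def)

text \<open>
  The improvement values of \<open>b\<close> at the actions of \<open>b'\<close> average to the gain of \<open>b'\<close>, because the
  generator term has expectation \<open>0\<close> under the invariant law of \<open>b'\<close>.
\<close>

lemma expectation_improvement_value:
  assumes b: "b \<in> SM" and b': "b' \<in> SM"
  shows "measure_pmf.expectation (\<theta> b') (\<lambda>x. improvement_value q r (h b) x (b' x)) = g b'"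
proof -
  have i: "integrable (\<theta> b') (\<lambda>x. r x (b' x))"
    by (rule integrable_weighted_policy[OF b' cost_weighted[OF b']])
  have j: "integrable (\<theta> b') (\<lambda>x. generator q (b' x) (h b) x)"
    by (rule integrable_weighted_policy[OF b' abs_generator_bias_le[OF b SM_D[OF b']]])
  show ?thesis
    unfolding improvement_value_def
    using Bochner_Integration.integral_add[OF i j] expectation_generator[OF b' abs_bias_le'[OF b]]
    by (simp add: gain_def)
qed

lemma gain_nonneg: "b \<in> SM \<Longrightarrow> g b \<ge> 0"
  unfolding gain_def by (intro Bochner_Integration.integral_nonneg cost_nonneg SM_D)

text \<open>The infimum over the actions in the improvement step for policy \<open>b\<close>.\<close>

definition best_value :: "policy \<Rightarrow> state \<Rightarrow> real" where
  "best_value b x = (INF a\<in>A. improvement_value q r (h b) x a)"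

lemma best_value_le: "b \<in> SM \<Longrightarrow> a \<in> A \<Longrightarrow> best_value b x \<le> improvement_value q r (h b) x a"
  unfolding best_value_def
  by (rule cINF_lower) (auto intro!: bdd_belowI2[where m="- B * W x"] dest!: abs_improvement_value_le[where x=x])

lemma best_value_ge: "b \<in> SM \<Longrightarrow> best_value b x \<ge> - B * W x"
  unfolding best_value_def
  using A_nonempty by (intro cINF_greatest) (auto dest!: abs_improvement_value_le[where x=x])

text \<open>How much the gain of \<open>b\<close> exceeds the infimum in the improvement step at \<open>x\<close>.\<close>

definition gap :: "policy \<Rightarrow> state \<Rightarrow> real" where
  "gap b x = g b - best_value b x"

lemma gap_nonneg: "b \<in> SM \<Longrightarrow> gap b x \<ge> 0"
  using best_value_le[of b "b x" x] SM_D[of b x] by (simp add: gap_def improvement_value_self)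

lemma gap_le:
  assumes b: "b \<in> SM"
  shows "\<bar>gap b x\<bar> \<le> (g b + B) * W x"
proof -
  have "g b * 1 \<le> g b * W x" by (intro mult_left_mono W_ge_1 gain_nonneg b)
  then show ?thesis
    using gap_nonneg[OF b, of x] best_value_ge[OF b, of x] by (simp add: gap_def algebra_simps)
qed

lemma gain_minus_gap_le:
  assumes b: "b \<in> SM" and b': "b' \<in> SM"
  shows "g b - measure_pmf.expectation (\<theta> b') (gap b) \<le> g b'"
proof -
  have i: "integrable (\<theta> b') (gap b)" by (rule integrable_weighted_policy[OF b' gap_le[OF b]])
  have "g b - measure_pmf.expectation (\<theta> b') (gap b) = measure_pmf.expectation (\<theta> b') (\<lambda>x. g b - gap b x)"
    using i by simp
  also have "\<dots> \<le> measure_pmf.expectation (\<theta> b') (\<lambda>x. improvement_value q r (h b) x (b' x))"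
  proof (rule integral_mono)
    show "integrable (\<theta> b') (\<lambda>x. g b - gap b x)" using i by simp
    show "integrable (\<theta> b') (\<lambda>x. improvement_value q r (h b) x (b' x))"
      by (rule integrable_weighted_policy[OF b' abs_improvement_value_le[OF b SM_D[OF b']]])
    show "g b - gap b x \<le> improvement_value q r (h b) x (b' x)" for x
      using best_value_le[OF b SM_D[OF b'], of x x] by (simp add: gap_def)
  qed
  also have "\<dots> = g b'" by (rule expectation_improvement_value[OF b b'])
  finally show ?thesis .
qed

lemma limit_policy_optimal:
  assumes iteration: "policy_iteration A q r P Y \<beta>"
    and \<beta>': "\<beta>' \<in> SM" and \<sigma>: "strict_mono \<sigma>" and lim: "(\<lambda>k. \<beta> (\<sigma> k)) \<longlonglongrightarrow> \<beta>'"
    and b: "b \<in> SM"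
  shows "g \<beta>' \<le> g b"
proof -
  have step: "improvement_value q r (h (\<beta> k)) x (\<beta> (Suc k) x) = best_value (\<beta> k) x \<and>
      (\<beta> k \<in> SM \<longrightarrow> \<beta> (Suc k) x \<in> A)" for k x
  proof -
    have "let f = improvement_value q r (h (\<beta> k)) x; v = (INF a\<in>A. f a)
        in if f (\<beta> k x) = v then \<beta> (Suc k) x = \<beta> k x else \<beta> (Suc k) x \<in> A \<and> f (\<beta> (Suc k) x) = v"
      using iteration by (auto simp only: policy_iteration_def)
    then show ?thesis
      using SM_D[of "\<beta> k" x] by (auto simp: Let_def best_value_def split: if_splits)
  qed
  have SM: "\<beta> k \<in> SM" for k
  proof (induction k)
    case 0
    then show ?case using iteration by (simp add: policy_iteration_def)
  next
    case (Suc k)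
    then show ?case using step[of k] by (simp add: stationary_policies_def)
  qed
  have gap_int: "integrable (\<theta> b) (gap (\<beta> k))" if "b \<in> SM" for b k
    by (rule integrable_weighted_policy[OF that gap_le[OF SM]])
  have gain_step: "g (\<beta> (Suc k)) = g (\<beta> k) - measure_pmf.expectation (\<theta> (\<beta> (Suc k))) (gap (\<beta> k))" for k
  proof -
    have "g (\<beta> (Suc k)) = measure_pmf.expectation (\<theta> (\<beta> (Suc k))) (\<lambda>x. g (\<beta> k) - gap (\<beta> k) x)"
      using expectation_improvement_value[OF SM[of k] SM[of "Suc k"]] step by (simp add: gap_def)
    then show ?thesis using gap_int[OF SM[of "Suc k"]] by simp
  qed
  have dec: "decseq (\<lambda>k. g (\<beta> k))"
    unfolding decseq_Suc_iff gain_step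
    using gap_nonneg[OF SM] by (auto intro!: Bochner_Integration.integral_nonneg)
  have gain_nn: "\<forall>k. 0 \<le> g (\<beta> k)" by (intro allI gain_nonneg[OF SM])
  obtain g' where g': "(\<lambda>k. g (\<beta> k)) \<longlonglongrightarrow> g'"
    by (rule decseq_convergent[OF dec gain_nn])
  have gap_lim: "(\<lambda>k. gap (\<beta> k) x) \<longlonglongrightarrow> 0" for x
  proof -
    obtain m where m: "m > 0" "\<And>b. b \<in> SM \<Longrightarrow> m \<le> pmf (\<theta> b) x"
      using uniformly_charged[of x] by (auto simp: uniformly_charged_def)
    \<comment> \<open>A single state contributes at least \<open>m * gap (\<beta> k) x\<close> to the decrease of the gain.\<close>
    have "gap (\<beta> k) x \<le> (g (\<beta> k) - g (\<beta> (Suc k))) / m" for k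
    proof -
      let ?\<theta> = "\<theta> (\<beta> (Suc k))"
      have "m * gap (\<beta> k) x \<le> pmf ?\<theta> x * gap (\<beta> k) x"
        by (intro mult_right_mono m(2) gap_nonneg SM)
      also have "\<dots> = measure_pmf.expectation ?\<theta> (\<lambda>y. gap (\<beta> k) x * indicator {x} y)"
        by (simp add: measure_pmf_single mult.commute)
      also have "\<dots> \<le> measure_pmf.expectation ?\<theta> (gap (\<beta> k))"
        using gap_nonneg[OF SM]
        by (intro integral_mono gap_int SM integrable_pmf_bounded[where B="\<bar>gap (\<beta> k) x\<bar>"])
           (auto simp: indicator_def)
      finally show ?thesis using m(1) gain_step[of k] by (simp add: pos_le_divide_eq mult.commute)
    qed
    then have upper: "\<forall>\<^sub>F k in sequentially. gap (\<beta> k) x \<le> (g (\<beta> k) - g (\<beta> (Suc k))) / m"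
      by (rule always_eventually[OF allI])
    have lower: "\<forall>\<^sub>F k in sequentially. 0 \<le> gap (\<beta> k) x"
      by (rule always_eventually[OF allI]) (rule gap_nonneg[OF SM])
    have "(\<lambda>k. g (\<beta> k) - g (\<beta> (Suc k))) \<longlonglongrightarrow> g' - g'"
      by (rule tendsto_diff[OF g' LIMSEQ_Suc[OF g']])
    then have "(\<lambda>k. (g (\<beta> k) - g (\<beta> (Suc k))) / m) \<longlonglongrightarrow> (g' - g') / m"
      by (rule tendsto_divide[OF _ tendsto_const]) (use m(1) in simp)
    then show ?thesis
      using tendsto_sandwich[OF lower upper tendsto_const] by simp
  qed
  have "g' \<le> g b"
  proof -
    have "(\<lambda>k. measure_pmf.expectation (\<theta> b) (gap (\<beta> k))) \<longlonglongrightarrow> measure_pmf.expectation (\<theta> b) (\<lambda>_. 0)"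
    proof (rule integral_dominated_convergence[where w="\<lambda>x. (g (\<beta> 0) + B) * W x"])
      have "\<bar>gap (\<beta> k) x\<bar> \<le> (g (\<beta> 0) + B) * W x" for k x
      proof -
        have "(g (\<beta> k) + B) * W x \<le> (g (\<beta> 0) + B) * W x"
          using decseqD[OF dec, of 0 k] by (intro mult_right_mono W_nonneg) auto
        with gap_le[OF SM, of k x] show ?thesis by linarith
      qed
      then show "AE x in \<theta> b. norm (gap (\<beta> k) x) \<le> (g (\<beta> 0) + B) * W x" for k by simp
    qed (use gap_lim integrable_W[OF b] in auto)
    then have "(\<lambda>k. g (\<beta> k) - measure_pmf.expectation (\<theta> b) (gap (\<beta> k))) \<longlonglongrightarrow> g' - 0"
      by (intro tendsto_diff g') simp
    then show ?thesis
      using gain_minus_gap_le[OF SM b] by (intro LIMSEQ_le_const2[where X="\<lambda>k. g (\<beta> k) - _ k"]) auto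
  qed
  moreover have "g \<beta>' = g'"
  proof -
    \<comment> \<open>The Poisson equation of the iterate expresses \<open>D k x\<close> through the difference of the two
      actions at \<open>x\<close>, so it tends to \<open>0\<close>; its expectation under the invariant law of the limit
      policy is the difference of the gains.\<close>
    define D where "D k x = g (\<beta> (\<sigma> k)) - improvement_value q r (h (\<beta> (\<sigma> k))) x (\<beta>' x)" for k x
    have coord: "(\<lambda>k. \<beta> (\<sigma> k) x) \<longlonglongrightarrow> \<beta>' x" for x
      using continuous_on_tendsto_compose[OF continuous_on_product_coordinates lim, of x] by simp
    have D_lim: "(\<lambda>k. D k x) \<longlonglongrightarrow> 0" for x
    proof -
      have D_eq: "D k x = (r x (\<beta> (\<sigma> k) x) - r x (\<beta>' x)) +
          (\<Sum>y\<in>queue_nbhd x. (q (\<beta> (\<sigma> k) x) x y - q (\<beta>' x) x y) * h (\<beta> (\<sigma> k)) y)" for k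
        using improvement_value_self[OF SM, of "\<sigma> k" x]
        by (simp add: D_def improvement_value_def generator_queue sum_subtractf left_diff_distrib)
      have "(\<lambda>k. (q (\<beta> (\<sigma> k) x) x y - q (\<beta>' x) x y) * h (\<beta> (\<sigma> k)) y) \<longlonglongrightarrow> 0" for y
      proof (rule Lim_null_comparison)
        have "(\<lambda>k. \<bar>q (\<beta> (\<sigma> k) x) x y - q (\<beta>' x) x y\<bar> * (H * W y)) \<longlonglongrightarrow> \<bar>q (\<beta>' x) x y - q (\<beta>' x) x y\<bar> * (H * W y)"
          by (intro tendsto_intros tendsto_queue_rate coord)
        then show "(\<lambda>k. \<bar>q (\<beta> (\<sigma> k) x) x y - q (\<beta>' x) x y\<bar> * (H * W y)) \<longlonglongrightarrow> 0" by simp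
        show "\<forall>\<^sub>F k in sequentially. norm ((q (\<beta> (\<sigma> k) x) x y - q (\<beta>' x) x y) * h (\<beta> (\<sigma> k)) y)
            \<le> \<bar>q (\<beta> (\<sigma> k) x) x y - q (\<beta>' x) x y\<bar> * (H * W y)"
          by (intro always_eventually allI) (simp add: abs_mult mult_left_mono abs_bias_le' SM)
      qed
      then have "(\<lambda>k. D k x) \<longlonglongrightarrow> (r x (\<beta>' x) - r x (\<beta>' x)) + (\<Sum>y\<in>queue_nbhd x. 0)"
        unfolding D_eq by (intro tendsto_add tendsto_diff tendsto_const tendsto_sum tendsto_queue_cost coord)
      then show ?thesis by simp
    qed
    have D_le: "\<bar>D k x\<bar> \<le> 2 * B * W x" for k x
      using abs_improvement_value_le[where b="\<beta> (\<sigma> k)" and x=x and a="\<beta> (\<sigma> k) x", OF SM SM_D[OF SM]]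
        abs_improvement_value_le[where b="\<beta> (\<sigma> k)" and x=x and a="\<beta>' x", OF SM SM_D[OF \<beta>']]
      by (simp add: D_def improvement_value_self[OF SM] abs_le_iff)
    have "(\<lambda>k. measure_pmf.expectation (\<theta> \<beta>') (D k)) \<longlonglongrightarrow> measure_pmf.expectation (\<theta> \<beta>') (\<lambda>_. 0)"
      by (rule integral_dominated_convergence[where w="\<lambda>x. 2 * B * W x"])
         (use D_lim D_le integrable_W[OF \<beta>'] in auto)
    moreover have "measure_pmf.expectation (\<theta> \<beta>') (D k) = g (\<beta> (\<sigma> k)) - g \<beta>'" for k
    proof -
      have "integrable (\<theta> \<beta>') (\<lambda>x. improvement_value q r (h (\<beta> (\<sigma> k))) x (\<beta>' x))"
        by (rule integrable_weighted_policy[OF \<beta>' abs_improvement_value_le[OF SM SM_D[OF \<beta>']]])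
      then show ?thesis
        by (simp add: D_def[abs_def] expectation_improvement_value[OF SM \<beta>'])
    qed
    ultimately have "(\<lambda>k. g (\<beta> (\<sigma> k)) - g \<beta>') \<longlonglongrightarrow> 0" by simp
    then have "(\<lambda>k. g (\<beta> (\<sigma> k))) \<longlonglongrightarrow> g \<beta>'" by (rule LIM_zero_cancel)
    then show ?thesis
      using LIMSEQ_subseq_LIMSEQ[OF g' \<sigma>] by (auto simp: comp_def intro: LIMSEQ_unique)
  qed
  ultimately show ?thesis by simp
qed

lemma limit_policy_PAC_optimal:
  assumes "policy_iteration A q r P Y \<beta>"
    and \<beta>': "\<beta>' \<in> SM" and "strict_mono \<sigma>" and "(\<lambda>k. \<beta> (\<sigma> k)) \<longlonglongrightarrow> \<beta>'"
  shows "PAC_optimal A r P Y \<beta>'"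
  unfolding PAC_optimal_def
proof (intro conjI exI[of _ "g \<beta>'"] allI ballI)
  show "\<beta>' \<in> SM" by fact
  show "AE \<omega> in P \<beta>' x. pathwise_average_cost r (Y \<beta>') \<beta>' \<omega> \<le> ereal (g \<beta>')" for x
    using pathwise_average_cost_policy[OF \<beta>', of x] by eventually_elim simp
  show "AE \<omega> in P b x. pathwise_average_cost r (Y b) b \<omega> \<ge> ereal (g \<beta>')" if b: "b \<in> SM" for b x
    using pathwise_average_cost_policy[OF b, of x]
    by eventually_elim (use limit_policy_optimal[OF assms b] in simp)
qed

end

theorem proposition6p1:
  fixes lam mu gam R c0 c1 c2 c3 :: real
    and S :: nat
    and P :: "policy \<Rightarrow> state \<Rightarrow> 'w measure"
    and Y :: "policy \<Rightarrow> real \<Rightarrow> 'w \<Rightarrow> state"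
    and W :: "state \<Rightarrow> real"
    and \<beta> :: "nat \<Rightarrow> policy"
    and \<beta>' :: policy
    and \<sigma> :: "nat \<Rightarrow> nat"
  assumes "lam > 0" and "mu > 0" and "0 < gam" and "gam \<le> R"
    and "c0 \<ge> 0" and "c1 \<ge> 0" and "c2 \<ge> 0" and "c3 \<ge> 0"
    and "\<And>b. b \<in> stationary_policies {gam..R} \<Longrightarrow>
           right_continuous_markov_chain (policy_rate (queue_rate lam mu) b) (P b) (Y b)"
    and "assumption_I {gam..R} (queue_rate lam mu) (queue_cost c0 c1 c2 c3 S) W"
    and "assumption_II {gam..R} (queue_rate lam mu) W"
    and "assumption_III {gam..R} P Y W"
    and "assumption_IV {gam..R} (queue_rate lam mu) W"
    and "policy_iteration {gam..R} (queue_rate lam mu) (queue_cost c0 c1 c2 c3 S) P Y \<beta>"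
    and "\<beta>' \<in> stationary_policies {gam..R}"
    and "strict_mono \<sigma>" and "(\<lambda>k. \<beta> (\<sigma> k)) \<longlonglongrightarrow> \<beta>'"
  shows "PAC_optimal {gam..R} (queue_cost c0 c1 c2 c3 S) P Y \<beta>'"
proof -
  let ?A = "{gam..R}" and ?q = "queue_rate lam mu" and ?r = "queue_cost c0 c1 c2 c3 S"
  have gam: "gam \<in> ?A" using assms(4) by simp
  obtain c d M where I: "\<And>x. W x \<ge> 1" "c > 0" "d \<ge> 0" "M > 0"
    "\<And>x a. a \<in> ?A \<Longrightarrow> generator ?q a W x \<le> - c * W x + d * of_bool (x = (0, 0))"
    "\<And>x a. a \<in> ?A \<Longrightarrow> ?r x a \<le> M * W x"
    using assms(10) unfolding assumption_I_def by blast
  obtain \<delta> L where III: "\<delta> > 0" "L > 0"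
    "\<And>x u t. u \<in> weighted_space W \<Longrightarrow> t \<ge> 0 \<Longrightarrow>
      (SUP b\<in>stationary_policies ?A. ereal \<bar>(LINT \<omega>|P b x. u (Y b t \<omega>)) -
        measure_pmf.expectation (the_invariant_pmf (P b) (Y b)) u\<bar>)
      \<le> ereal (L * exp (- \<delta> * t) * weighted_norm W u * W x)"
    using assms(12) unfolding assumption_III_def by blast
  obtain W1 W2 :: "state \<Rightarrow> real" and d1 d2 b1 b2 M1 M2 where IV: "\<forall>x. W1 x \<ge> 1 \<and> W2 x \<ge> 1"
    "d1 > 0" "d2 > 0" "b1 \<ge> 0" "b2 \<ge> 0" "M1 > 0" "M2 > 0"
    "\<forall>x. \<forall>a\<in>?A. (W x)\<^sup>2 \<le> M1 * W1 x \<and> (max_exit_rate ?A ?q x * W x)\<^sup>2 \<le> M2 * W2 x \<and>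
      generator ?q a W1 x \<le> - d1 * W1 x + b1 \<and> generator ?q a W2 x \<le> - d2 * W2 x + b2"
    using assms(13) unfolding assumption_IV_def by blast
  interpret controlled_queue lam mu gam R c0 c1 c2 c3 S P Y W W1 c d M \<delta> L d1 b1 M1
  proof
    show "\<bar>(LINT \<omega>|P b x. u (Y b t \<omega>)) - measure_pmf.expectation (the_invariant_pmf (P b) (Y b)) u\<bar>
        \<le> L * exp (- \<delta> * t) * weighted_norm W u * W x"
      if "b \<in> stationary_policies ?A" "u \<in> weighted_space W" "t \<ge> 0" for b u t x
    proof -
      have "ereal \<bar>(LINT \<omega>|P b x. u (Y b t \<omega>)) - measure_pmf.expectation (the_invariant_pmf (P b) (Y b)) u\<bar>
          \<le> ereal (L * exp (- \<delta> * t) * weighted_norm W u * W x)"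
        by (rule order_trans[OF SUP_upper[OF that(1)] III(3)[OF that(2,3)]])
      then show ?thesis by simp
    qed
    show "(W x)\<^sup>2 \<le> M1 * W1 x" for x using IV(8) gam by blast
    show "generator ?q a W1 x \<le> - d1 * W1 x + b1" if "a \<in> ?A" for a x using IV(8) that by blast
  qed (use assms(1-9) I III(1,2) IV(1-7) in auto)
  show ?thesis by (rule limit_policy_PAC_optimal) fact+
qed

end
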